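(* Let $N\ge 2$ be an integer. Then $C_0^\infty(\mathbb{R}^N)$ is dense in $W_{\mu_N}(\mathbb{R}^N)$ with respect to the norm $\lVert\cdot\rVert_{\mu_N}$, i.e. $$W_{\mu_N}(\mathbb{R}^N)=\overline{C_0^{\infty}(\mathbb{R}^N)}^{\lVert\cdot\rVert_{\mu_N}}.$$
   Context: $V_N$ is the volume of the unit ball of $\mathbb{R}^N$. Define $\mu_N(x):=\dfrac{1}{V_N\left(1+|x|^{\frac{N}{N-1}}\right)^N}$ for $x\in\mathbb{R}^N$, $d\mu_N:=\mu_N(x)\,dx$ (a probability measure on $\mathbb{R}^N$), and $v_N:=\ln\mu_N$. When $N=2$, $|\nabla v_N|^{N-2}$ is understood as $1$. $C_0^\infty(\mathbb{R}^N)$ denotes the real-valued smooth compactly supported functions. With $\nabla u$ denoting the weak (distributional) gradient, $$W_{\mu_N}(\mathbb{R}^N):=\{u\in L^1(\mathbb{R}^N,d\mu_N):\ |\nabla u|\in L^N(\mathbb{R}^N,dx),\ |\nabla u|^2|\nabla v_N|^{N-2}\in L^1(\mathbb{R}^N,dx)\},$$ with the norm $$\lVert u\rVert_{\mu_N}:=\int_{\mathbb{R}^N}|u|\,d\mu_N+\lVert\nabla u\rVert_{N}+\left(\int_{\mathbb{R}^N}|\nabla u|^2|\nabla v_N|^{N-2}\,dx\right)^{1/2},$$ where $\lVert\cdot\rVert_N$ is the norm of $L^N(\mathbb{R}^N,dx)$. The closure is taken in $W_{\mu_N}(\mathbb{R}^N)$. *)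

theory Defs
  imports "HOL-Analysis.Analysis"
begin

(* Everything is stated on a Euclidean space 'a whose dimension DIM('a) plays the role of N;
   for 'a = real ^ 'n one has DIM('a) = CARD('n). *)

definition grad :: "('a::euclidean_space \<Rightarrow> real) \<Rightarrow> 'a \<Rightarrow> 'a" where
  "grad f x = (THE D. GDERIV f x :> D)"

lemma grad_eqI:
  assumes "GDERIV f x :> D"
  shows "grad f x = D"
  unfolding grad_def
proof (rule the_equality)
  show "GDERIV f x :> D" by (rule assms)
next
  fix D' assume "GDERIV f x :> D'"
  then have "(\<lambda>h. inner h D') = (\<lambda>h. inner h D)"
    using assms unfolding gderiv_def by (rule has_derivative_unique)
  then have "inner h D' = inner h D" for h
    by (rule fun_cong)
  then show "D' = D"
    by (simp add: euclidean_eq_iff[of D' D] inner_commute)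
qed

primrec C_k :: "nat \<Rightarrow> ('a::euclidean_space \<Rightarrow> real) \<Rightarrow> bool" where
  "C_k 0 f \<longleftrightarrow> continuous_on UNIV f"
| "C_k (Suc k) f \<longleftrightarrow>
    (\<forall>x. f differentiable (at x)) \<and> (\<forall>b\<in>Basis. C_k k (\<lambda>x. grad f x \<bullet> b))"

definition C0_infinity :: "('a::euclidean_space \<Rightarrow> real) set" where
  "C0_infinity = {\<phi>. (\<forall>k. C_k k \<phi>) \<and> compact (closure {x. \<phi> x \<noteq> 0})}"

definition locally_integrable :: "('a::euclidean_space \<Rightarrow> 'b::euclidean_space) \<Rightarrow> bool" where
  "locally_integrable f \<longleftrightarrow> (\<forall>K. compact K \<longrightarrow> f absolutely_integrable_on K)"

definition has_weak_gradient ::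
    "('a::euclidean_space \<Rightarrow> real) \<Rightarrow> ('a \<Rightarrow> 'a) \<Rightarrow> bool" where
  "has_weak_gradient u g \<longleftrightarrow> locally_integrable u \<and> locally_integrable g \<and>
    (\<forall>\<phi>\<in>C0_infinity. \<forall>b\<in>Basis.
      (\<integral>x. u x * (grad \<phi> x \<bullet> b) \<partial>lebesgue) = - (\<integral>x. (g x \<bullet> b) * \<phi> x \<partial>lebesgue))"

(* A weak gradient is determined only up to a null set; the choice of representative does not
   affect integrability or the integrals below. *)
definition weak_grad :: "('a::euclidean_space \<Rightarrow> real) \<Rightarrow> 'a \<Rightarrow> 'a" where
  "weak_grad u = (SOME g. has_weak_gradient u g)"

definition mu_density :: "'a::euclidean_space \<Rightarrow> real" where
  "mu_density x = 1 / (measure lebesgue (ball (0::'a) 1) *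
     (1 + norm x powr (real DIM('a) / (real DIM('a) - 1))) ^ DIM('a))"

definition mu_measure :: "'a::euclidean_space measure" where
  "mu_measure = density lebesgue (\<lambda>x. ennreal (mu_density x))"

definition v_mu :: "'a::euclidean_space \<Rightarrow> real" where
  "v_mu x = ln (mu_density x)"

(* |grad v|^(N-2); for N = 2 this is 1 even at the zero of grad v, since 0 ^ 0 = 1. *)
definition grad_weight :: "'a::euclidean_space \<Rightarrow> real" where
  "grad_weight x = norm (grad v_mu x) ^ (DIM('a) - 2)"

(* Elements are functions, not classes modulo almost everywhere equality; mu_norm below is
   accordingly a seminorm whose kernel consists of the functions vanishing almost everywhere. *)
definition W_mu :: "('a::euclidean_space \<Rightarrow> real) set" where
  "W_mu = {u. integrable mu_measure u \<and> (\<exists>g. has_weak_gradient u g) \<and>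
     integrable lebesgue (\<lambda>x. norm (weak_grad u x) ^ DIM('a)) \<and>
     integrable lebesgue (\<lambda>x. norm (weak_grad u x) ^ 2 * grad_weight x)}"

definition mu_norm :: "('a::euclidean_space \<Rightarrow> real) \<Rightarrow> real" where
  "mu_norm u = (\<integral>x. \<bar>u x\<bar> \<partial>mu_measure)
     + root DIM('a) (\<integral>x. norm (weak_grad u x) ^ DIM('a) \<partial>lebesgue)
     + sqrt (\<integral>x. norm (weak_grad u x) ^ 2 * grad_weight x \<partial>lebesgue)"

definition W_mu_closure :: "('a::euclidean_space \<Rightarrow> real) set \<Rightarrow> ('a \<Rightarrow> real) set" where
  "W_mu_closure S = {u \<in> W_mu. \<forall>\<epsilon>>0. \<exists>\<phi>\<in>S. mu_norm (\<lambda>x. u x - \<phi> x) < \<epsilon>}"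

end

(* A function in the space is first mollified, which is possible globally because all three weights
   are comparable on balls of radius 1 (the weight |grad v|^(N-2) after replacing it by
   (1 + |x|)^-(N-2), which only matters near the origin, where the L^N norm controls the gradient).
   For the resulting smooth v all calculus is classical: M sin (v / M) converges to v and is bounded,
   and a bounded smooth function is cut off by the average of the dyadic plateaus theta (x / 2^k),
   k <= m, whose gradient tends to 0 in L^N and in the weighted L^2 space because both energies are scale
   invariant and the plateaus have gradients with disjoint supports. *)
theory Submission
  imports Defs "HOL-Computational_Algebra.Polynomial"
begin

section \<open>Calculus of smooth functions\<close>

text \<open>A single dilated plateau would not do as a cutoff: the L^N energy of its gradient is the
  same at every scale, and the weighted L^2 energy has no reason to become small, since the weight
  behaves like |x|^-(N-2) at infinity. Averaging m + 1 separated scales gives energy of order (m +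
  1)^(1 - p), which tends to 0 because p is N or 2 and hence at least 2. The product rule also
  produces v times the gradient of the cutoff, and the norm offers no control of v against that term
  near infinity; this is why the values are made bounded first. Mollifying before that, and
  truncating by a smooth function, avoids any chain or product rule for weak derivatives. For N > 2
  the original weight vanishes at the origin and nowhere else, so it cannot be comparable on unit
  balls, as the mollification estimate requires; this is the obstacle that the substitute weight
  removes.\<close>

lemma GDERIV_grad:
  fixes f :: "'a::euclidean_space \<Rightarrow> real"
  assumes "f differentiable (at x)"
  shows "GDERIV f x :> grad f x"
proof -
  obtain D where D: "(f has_derivative D) (at x)"
    using assms unfolding differentiable_def by blast
  then interpret D: bounded_linear D by (rule has_derivative_bounded_linear)
  have "D h = h \<bullet> (\<Sum>b\<in>Basis. D b *\<^sub>R b)" for h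
  proof -
    have "D h = D (\<Sum>b\<in>Basis. (h \<bullet> b) *\<^sub>R b)" by (simp add: euclidean_representation)
    also have "\<dots> = (\<Sum>b\<in>Basis. (h \<bullet> b) * D b)" by (simp add: D.sum D.scaleR)
    finally show ?thesis by (simp add: inner_sum_right mult.commute)
  qed
  then have "D = (\<lambda>h. h \<bullet> (\<Sum>b\<in>Basis. D b *\<^sub>R b))" by (rule ext)
  with D have "GDERIV f x :> (\<Sum>b\<in>Basis. D b *\<^sub>R b)"
    unfolding gderiv_def by simp
  with grad_eqI[OF this] show ?thesis by simp
qed

lemma GDERIV_differentiable: "GDERIV f x :> D \<Longrightarrow> f differentiable (at x)"
  unfolding gderiv_def differentiable_def by blast

lemma GDERIV_isCont: "GDERIV f x :> D \<Longrightarrow> isCont f x"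
  unfolding gderiv_def by (rule has_derivative_continuous)

lemma C_k_SucI:
  fixes f :: "'a::euclidean_space \<Rightarrow> real"
  assumes "\<And>x. GDERIV f x :> G x" and "\<And>b. b \<in> Basis \<Longrightarrow> C_k k (\<lambda>x. G x \<bullet> b)"
  shows "C_k (Suc k) f"
  using assms by (auto simp: grad_eqI[OF assms(1)] intro: GDERIV_differentiable)

lemma C_k_SucD:
  assumes "C_k (Suc k) f"
  shows "GDERIV f x :> grad f x" "b \<in> Basis \<Longrightarrow> C_k k (\<lambda>x. grad f x \<bullet> b)"
  using assms by (auto intro: GDERIV_grad)

text \<open>The recursion for \<open>C_k (Suc k)\<close> speaks only about differentiability and the
  partial derivatives, so monotonicity in the order needs its own induction, anchored at the
  continuity of differentiable functions. The product, inverse and chain rules use it for factors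
  that stay undifferentiated.\<close>

lemma C_k_lower: "C_k (Suc k) f \<Longrightarrow> C_k k f"
proof (induction k arbitrary: f)
  case 0
  then show ?case
    by (auto intro!: continuous_at_imp_continuous_on differentiable_imp_continuous_within)
next
  case (Suc k)
  show ?case
    by (rule C_k_SucI[OF C_k_SucD(1)[OF Suc.prems]])
      (use Suc.IH C_k_SucD(2)[OF Suc.prems] in blast)
qed

lemma C_k_const: "C_k k (\<lambda>x. c)"
proof (induction k arbitrary: c)
  case (Suc k)
  show ?case
    by (rule C_k_SucI[where G = "\<lambda>_. 0"]) (auto intro: GDERIV_const Suc)
qed auto

lemma C_k_add: "C_k k f \<Longrightarrow> C_k k g \<Longrightarrow> C_k k (\<lambda>x. f x + g x)"
proof (induction k arbitrary: f g)
  case (Suc k)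
  note f = C_k_SucD[OF Suc.prems(1)] and g = C_k_SucD[OF Suc.prems(2)]
  show ?case
    by (rule C_k_SucI[OF GDERIV_add[OF f(1) g(1)]])
      (use Suc.IH[OF f(2) g(2)] in \<open>simp add: inner_add_left\<close>)
qed (auto intro: continuous_intros)

lemma C_k_mult: "C_k k f \<Longrightarrow> C_k k g \<Longrightarrow> C_k k (\<lambda>x. f x * g x)"
proof (induction k arbitrary: f g)
  case (Suc k)
  note f = C_k_SucD[OF Suc.prems(1)] and g = C_k_SucD[OF Suc.prems(2)]
  show ?case
    by (rule C_k_SucI[OF GDERIV_mult[OF f(1) g(1)]])
      (use C_k_add[OF Suc.IH[OF C_k_lower[OF Suc.prems(1)] g(2)]
          Suc.IH[OF C_k_lower[OF Suc.prems(2)] f(2)]] in \<open>simp add: inner_add_left\<close>)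
qed (auto intro: continuous_intros)

lemma C_k_cmult: "C_k k f \<Longrightarrow> C_k k (\<lambda>x. c * f x)"
  by (rule C_k_mult[OF C_k_const])

lemma C_k_diff: "C_k k f \<Longrightarrow> C_k k g \<Longrightarrow> C_k k (\<lambda>x. f x - g x)"
  using C_k_add[OF _ C_k_cmult[of k g "-1"]] by simp

lemma C_k_sum: "(\<And>i. i \<in> I \<Longrightarrow> C_k k (f i)) \<Longrightarrow> C_k k (\<lambda>x. \<Sum>i\<in>I. f i x)"
  by (induction I rule: infinite_finite_induct) (auto intro: C_k_const C_k_add)

lemma C_k_inverse: "C_k k f \<Longrightarrow> (\<And>x. f x \<noteq> 0) \<Longrightarrow> C_k k (\<lambda>x. inverse (f x))"
proof (induction k arbitrary: f)
  case (Suc k)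
  note f = C_k_SucD[OF Suc.prems(1)]
  have i: "C_k k (\<lambda>x. inverse (f x))"
    by (rule Suc.IH[OF C_k_lower]) (use Suc.prems in auto)
  show ?case
    by (rule C_k_SucI[OF GDERIV_inverse[OF f(1) Suc.prems(2)]])
      (use C_k_cmult[of _ _ "-1", OF C_k_mult[OF C_k_mult[OF i i] f(2)]] in
        \<open>simp add: power2_eq_square\<close>)
qed (auto intro: continuous_intros)

text \<open>The chain rule replaces \<open>h\<close> by its derivative while \<open>f\<close> stays
  inside, so the induction runs over a family \<open>F\<close> of outer functions that is closed
  under differentiation.\<close>

lemma C_k_compose:
  fixes f :: "'a::euclidean_space \<Rightarrow> real"
  assumes F: "\<And>h. h \<in> F \<Longrightarrow> \<exists>h'\<in>F. \<forall>t. (h has_real_derivative h' t) (at t)"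
    and h: "h \<in> F" and f: "C_k k f"
  shows "C_k k (\<lambda>x. h (f x))"
  using h f
proof (induction k arbitrary: h)
  case 0
  obtain h' where h': "\<forall>t. (h has_real_derivative h' t) (at t)" using F[OF 0(1)] by blast
  then have "continuous_on UNIV h"
    by (intro continuous_at_imp_continuous_on ballI DERIV_isCont) auto
  then show ?case using 0 by (auto intro: continuous_on_compose2[of UNIV h])
next
  case (Suc k)
  note f = C_k_SucD[OF Suc.prems(2)]
  obtain h' where h': "h' \<in> F" "\<forall>t. (h has_real_derivative h' t) (at t)" using F[OF Suc(2)] by blast
  have "GDERIV (\<lambda>x. h (f x)) x :> h' (f x) *\<^sub>R grad f x" for x
    using GDERIV_DERIV_compose[OF f(1)] h'(2) by blast
  then show ?case
    by (rule C_k_SucI) (use C_k_mult[OF Suc.IH[OF h'(1) C_k_lower[OF Suc.prems(2)]] f(2)] in simp)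
qed

lemma GDERIV_affine:
  fixes f :: "'a::euclidean_space \<Rightarrow> real"
  assumes "GDERIV f (a + c *\<^sub>R x) :> D"
  shows "GDERIV (\<lambda>x. f (a + c *\<^sub>R x)) x :> c *\<^sub>R D"
proof -
  have "((\<lambda>x. a + c *\<^sub>R x) has_derivative (\<lambda>h. c *\<^sub>R h)) (at x)"
    by (auto intro!: derivative_eq_intros)
  from has_derivative_compose[OF this assms[unfolded gderiv_def]] show ?thesis
    unfolding gderiv_def by simp
qed

lemma C_k_affine: "C_k k f \<Longrightarrow> C_k k (\<lambda>x. f (a + c *\<^sub>R x))"
proof (induction k arbitrary: f)
  case 0
  then show ?case by (auto intro!: continuous_on_compose2[of UNIV f] continuous_intros)
next
  case (Suc k)
  note f = C_k_SucD[OF Suc.prems]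
  show ?case
    by (rule C_k_SucI[OF GDERIV_affine[OF f(1)]])
      (use C_k_cmult[OF Suc.IH[OF f(2)], of _ c] in simp)
qed

lemma C_k_inner: "C_k k (\<lambda>x::'a::euclidean_space. x \<bullet> v)"
proof (cases k)
  case 0
  then show ?thesis by (auto intro: continuous_intros)
next
  case (Suc j)
  have "GDERIV (\<lambda>x::'a. x \<bullet> v) x :> v" for x
    unfolding gderiv_def by (auto intro!: derivative_eq_intros)
  then show ?thesis unfolding Suc by (rule C_k_SucI) (rule C_k_const)
qed

lemma C_k_norm_square: "C_k k (\<lambda>x::'a::euclidean_space. (norm x)\<^sup>2)"
proof -
  have "C_k k (\<lambda>x::'a. \<Sum>b\<in>Basis. (x \<bullet> b) * (x \<bullet> b))"
    by (intro C_k_sum C_k_mult C_k_inner)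
  then show ?thesis by (simp add: power2_norm_eq_inner euclidean_inner[symmetric])
qed

section \<open>Smooth functions that are flat at a point, and the sine\<close>

definition flat_exp :: "real poly \<Rightarrow> real \<Rightarrow> real" where
  "flat_exp p t = (if t \<le> 0 then 0 else poly p (1 / t) * exp (- (1 / t)))"

lemma tendsto_poly_div_exp_0: "((\<lambda>x::real. poly p x * exp (- x)) \<longlongrightarrow> 0) at_top"
proof -
  have "((\<lambda>x::real. \<Sum>i\<le>degree p. coeff p i * (x ^ i / exp x)) \<longlongrightarrow> (\<Sum>i\<le>degree p. coeff p i * 0)) at_top"
    by (intro tendsto_sum tendsto_mult tendsto_const tendsto_power_div_exp_0)
  then show ?thesis
    by (simp add: poly_altdef exp_minus sum_divide_distrib flip: divide_inverse)
qed

lemma flat_exp_tendsto_0: "(flat_exp p \<longlongrightarrow> 0) (at 0)"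
proof -
  have "((\<lambda>t. poly p (1 / t) * exp (- (1 / t))) \<longlongrightarrow> 0) (at_right (0::real))"
    using filterlim_compose[OF tendsto_poly_div_exp_0 filterlim_inverse_at_top_right]
    by (simp add: inverse_eq_divide)
  then have "(flat_exp p \<longlongrightarrow> 0) (at_right 0)"
    by (rule Lim_transform_eventually)
      (auto simp: flat_exp_def eventually_at_right_less eventually_at_filter)
  moreover have "(flat_exp p \<longlongrightarrow> 0) (at_left 0)"
    by (rule Lim_transform_eventually[OF tendsto_const])
      (auto simp: flat_exp_def eventually_at_filter)
  ultimately show ?thesis by (simp add: filterlim_at_split)
qed

text \<open>With s = 1 / t one has ds/dt = - s^2, so the derivative of p(s) exp(-s) is s^2 (p(s) -
  p'(s)) exp(-s). Admitting all polynomials p makes the family closed under differentiation, as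
  \<open>C_k_compose\<close> demands.\<close>

lemma DERIV_flat_exp:
  "(flat_exp p has_real_derivative flat_exp (monom 1 2 * (p - pderiv p)) t) (at t)"
proof -
  consider "t < 0" | "t = 0" | "t > 0" by linarith
  then show ?thesis
  proof cases
    case 1
    have "((\<lambda>_. 0) has_real_derivative 0) (at t)" by simp
    moreover have "eventually (\<lambda>s. 0 = flat_exp p s) (nhds t)"
      using eventually_nhds_in_open[of "{..<0}" t] 1
      by (auto elim!: eventually_mono simp: flat_exp_def)
    ultimately show ?thesis using 1
      by (subst (asm) DERIV_cong_ev[OF refl _ refl]) (auto simp: flat_exp_def)
  next
    case 2
    \<comment> \<open>The polynomial is evaluated at 1 / t, so the difference quotient at 0 is again
      a member of the family, with p multiplied by the variable.\<close>
    have "(flat_exp (monom 1 1 * p) \<longlongrightarrow> 0) (at 0)" by (rule flat_exp_tendsto_0)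
    moreover
    have "flat_exp (monom 1 1 * p) s = flat_exp p s / s" for s
      by (simp add: flat_exp_def poly_monom)
    then have "flat_exp (monom 1 1 * p) = (\<lambda>s. flat_exp p s / s)" by (rule ext)
    ultimately have "((\<lambda>s. flat_exp p s / s) \<longlongrightarrow> 0) (at 0)" by (simp only:)
    then show ?thesis using 2 by (simp add: has_field_derivative_iff flat_exp_def)
  next
    case 3
    have "((\<lambda>t. poly p (1 / t) * exp (- (1 / t))) has_real_derivative
        flat_exp (monom 1 2 * (p - pderiv p)) t) (at t)"
      using 3 by (auto intro!: derivative_eq_intros simp: flat_exp_def poly_monom field_simps power2_eq_square)
    moreover have "eventually (\<lambda>s. poly p (1 / s) * exp (- (1 / s)) = flat_exp p s) (nhds t)"
      using eventually_nhds_in_open[of "{0<..}" t] 3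
      by (auto elim!: eventually_mono simp: flat_exp_def)
    ultimately show ?thesis
      by (subst (asm) DERIV_cong_ev[OF refl _ refl]) auto
  qed
qed

lemma C_k_flat_exp: "C_k k f \<Longrightarrow> C_k k (\<lambda>x. flat_exp p (f x))"
  by (rule C_k_compose[where F = "range flat_exp"]) (use DERIV_flat_exp in blast)+

text \<open>Differentiation shifts the argument of the sine by \<open>pi / 2\<close>, so the shifted
  sines form a family closed under it.\<close>

lemma C_k_sin: "C_k k f \<Longrightarrow> C_k k (\<lambda>x. sin (f x))"
proof (rule C_k_compose[where F = "range (\<lambda>a t. sin (a + t))" and h = sin])
  fix h assume "h \<in> range (\<lambda>(a::real) t. sin (a + t))"
  then obtain a where h: "h = (\<lambda>t. sin (a + t))" by blast
  have "(h has_real_derivative sin ((a + pi / 2) + t)) (at t)" for t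
    unfolding h by (auto intro!: derivative_eq_intros simp: sin_add cos_add)
  then show "\<exists>h'\<in>range (\<lambda>(a::real) t. sin (a + t)). \<forall>t. (h has_real_derivative h' t) (at t)"
    unfolding bex_simps by blast
qed (auto intro: range_eqI[of _ _ 0])

section \<open>Convolution with test functions\<close>

definition smooth :: "('a::euclidean_space \<Rightarrow> real) \<Rightarrow> bool" where
  "smooth f \<longleftrightarrow> (\<forall>k. C_k k f)"

lemma smooth_GDERIV: "smooth f \<Longrightarrow> GDERIV f x :> grad f x"
  unfolding smooth_def using C_k_SucD(1) by blast

lemma smooth_grad: "smooth f \<Longrightarrow> b \<in> Basis \<Longrightarrow> smooth (\<lambda>x. grad f x \<bullet> b)"
  unfolding smooth_def using C_k_SucD(2) by blast

lemma smooth_continuous: "smooth f \<Longrightarrow> continuous_on UNIV f"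
  unfolding smooth_def using C_k.simps(1) by blast

lemma smooth_continuous_grad:
  fixes f :: "'a::euclidean_space \<Rightarrow> real"
  assumes "smooth f"
  shows "continuous_on UNIV (grad f)"
proof -
  have "continuous_on UNIV (\<lambda>x. \<Sum>b\<in>Basis. (grad f x \<bullet> b) *\<^sub>R b)"
    by (intro continuous_intros smooth_continuous smooth_grad assms)
  then show ?thesis by (simp add: euclidean_representation)
qed

lemma smooth_borel:
  assumes "smooth f"
  shows "f \<in> borel_measurable borel" "grad f \<in> borel_measurable borel"
  using smooth_continuous[OF assms] smooth_continuous_grad[OF assms]
  by (auto intro: borel_measurable_continuous_onI)

lemma smooth_mult: "smooth f \<Longrightarrow> smooth g \<Longrightarrow> smooth (\<lambda>x. f x * g x)"
  unfolding smooth_def using C_k_mult by blast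

lemma smooth_const: "smooth (\<lambda>x. c)"
  unfolding smooth_def using C_k_const by blast

lemma smooth_sum: "(\<And>i. i \<in> I \<Longrightarrow> smooth (f i)) \<Longrightarrow> smooth (\<lambda>x. \<Sum>i\<in>I. f i x)"
  unfolding smooth_def by (auto intro: C_k_sum)

lemma smooth_affine: "smooth f \<Longrightarrow> smooth (\<lambda>x. f (a + c *\<^sub>R x))"
  unfolding smooth_def using C_k_affine by blast

lemma smooth_sin: "smooth f \<Longrightarrow> smooth (\<lambda>x. sin (f x))"
  unfolding smooth_def using C_k_sin by blast

lemma grad_mult:
  assumes "smooth f" "smooth g"
  shows "grad (\<lambda>x. f x * g x) x = f x *\<^sub>R grad g x + g x *\<^sub>R grad f x"
  by (rule grad_eqI[OF GDERIV_mult[OF smooth_GDERIV smooth_GDERIV]]) fact+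

lemma grad_eq_0_of_const:
  assumes "open S" "x \<in> S" "\<And>y. y \<in> S \<Longrightarrow> f y = c"
  shows "grad f x = 0"
proof (rule grad_eqI)
  have "((\<lambda>_. c) has_derivative (\<lambda>_. 0)) (at x)" by simp
  then have "(f has_derivative (\<lambda>_. 0)) (at x)"
    by (rule has_derivative_transform_within_open[OF _ assms(1,2)]) (use assms(3) in auto)
  then show "GDERIV f x :> 0" by (simp add: gderiv_def)
qed

lemma C0_infinityI:
  assumes "smooth f" and "\<And>x. norm x > R \<Longrightarrow> f x = 0"
  shows "f \<in> C0_infinity"
proof -
  have "{x. f x \<noteq> 0} \<subseteq> cball 0 R" using assms(2) by (force simp: not_less)
  then have "bounded {x. f x \<noteq> 0}" by (rule bounded_subset[OF bounded_cball])
  then have "compact (closure {x. f x \<noteq> 0})" by (simp add: compact_closure)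
  then show ?thesis using assms(1) by (simp add: C0_infinity_def smooth_def)
qed

lemma C0_infinity_smooth: "f \<in> C0_infinity \<Longrightarrow> smooth f"
  by (simp add: C0_infinity_def smooth_def)

lemma C0_infinity_support:
  fixes f :: "'a::euclidean_space \<Rightarrow> real"
  assumes "f \<in> C0_infinity"
  obtains R where "R > 0" "\<And>x. norm x \<ge> R \<Longrightarrow> f x = 0" "\<And>x. norm x \<ge> R \<Longrightarrow> grad f x = 0"
proof -
  have "bounded {x. f x \<noteq> 0}"
    using assms by (auto simp: C0_infinity_def compact_closure)
  then obtain R where R: "R > 0" "\<And>x. f x \<noteq> 0 \<Longrightarrow> norm x \<le> R"
    unfolding bounded_pos by auto
  \<comment> \<open>The gradient vanishes on the open complement of the ball of radius R; increasing
    the radius by 1 gives one radius with a weak inequality for both \<open>f\<close> and its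
    gradient.\<close>
  have "grad f x = 0" if "norm x \<ge> R + 1" for x
    by (rule grad_eq_0_of_const[of "- cball 0 R" _ _ 0]) (use that R in \<open>auto simp: open_Compl\<close>)
  with R that[of "R + 1"] show ?thesis by force
qed

lemma C0_infinity_grad:
  assumes "f \<in> C0_infinity" "b \<in> Basis"
  shows "(\<lambda>x. grad f x \<bullet> b) \<in> C0_infinity"
proof -
  obtain R where R: "R > 0" "\<And>x. norm x \<ge> R \<Longrightarrow> f x = 0"
    "\<And>x. norm x \<ge> R \<Longrightarrow> grad f x = 0"
    using C0_infinity_support[OF assms(1)] by blast
  show ?thesis
    using R smooth_grad[OF C0_infinity_smooth[OF assms(1)] assms(2)]
    by (intro C0_infinityI[where R = R]) auto
qed

lemma C0_infinity_mult:
  assumes "smooth f" "g \<in> C0_infinity"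
  shows "(\<lambda>x. f x * g x) \<in> C0_infinity"
proof -
  obtain R where R: "R > 0" "\<And>x. norm x \<ge> R \<Longrightarrow> g x = 0"
    "\<And>x. norm x \<ge> R \<Longrightarrow> grad g x = 0"
    using C0_infinity_support[OF assms(2)] by blast
  show ?thesis
    using R smooth_mult[OF assms(1) C0_infinity_smooth[OF assms(2)]]
    by (intro C0_infinityI[where R = R]) auto
qed

text \<open>Makes the reflected and translated kernel of a convolution admissible as a test function
  for weak gradients. The sign of its gradient cancels the sign of integration by parts.\<close>

lemma C0_infinity_reflect:
  fixes f :: "'a::euclidean_space \<Rightarrow> real"
  assumes "f \<in> C0_infinity"
  shows "(\<lambda>y. f (x - y)) \<in> C0_infinity" "grad (\<lambda>y. f (x - y)) y = - grad f (x - y)"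
proof -
  obtain R where R: "R > 0" "\<And>x. norm x \<ge> R \<Longrightarrow> f x = 0"
    "\<And>x. norm x \<ge> R \<Longrightarrow> grad f x = 0"
    using C0_infinity_support[OF assms] by blast
  show "(\<lambda>y. f (x - y)) \<in> C0_infinity"
  proof (rule C0_infinityI[where R = "R + norm x"])
    show "smooth (\<lambda>y. f (x - y))"
      using smooth_affine[OF C0_infinity_smooth[OF assms], of x "-1"] by simp
    show "f (x - y) = 0" if "norm y > R + norm x" for y
    proof (rule R(2))
      show "R \<le> norm (x - y)"
        using that norm_triangle_ineq2[of y x] by (simp add: norm_minus_commute)
    qed
  qed
  show "grad (\<lambda>y. f (x - y)) y = - grad f (x - y)"
    using GDERIV_affine[of f x "-1" y, OF smooth_GDERIV[OF C0_infinity_smooth[OF assms]]]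
    by (intro grad_eqI) simp
qed

section \<open>Uniform estimates and differentiation of convolutions\<close>

lemma uniformly_continuous_compact_support:
  fixes F :: "'a::euclidean_space \<Rightarrow> 'b::euclidean_space"
  assumes "continuous_on UNIV F" and "\<And>x. norm x \<ge> R \<Longrightarrow> F x = 0" and "e > 0"
  obtains d where "d > 0" "\<And>x y. norm (x - y) < d \<Longrightarrow> norm (F x - F y) < e"
proof -
  \<comment> \<open>The margin of 1 pays for the pairs of points that the ball misses: with the
    distance capped by 1, if one point has norm above R + 1, both have norm at least R and
    \<open>F\<close> vanishes at both.\<close>
  have "uniformly_continuous_on (cball 0 (R + 1)) F"
    by (intro compact_uniformly_continuous continuous_on_subset[OF assms(1)]) auto
  then obtain d where d: "d > 0"
    "\<And>x y. norm x \<le> R + 1 \<Longrightarrow> norm y \<le> R + 1 \<Longrightarrow> norm (x - y) < d \<Longrightarrow> norm (F x - F y) < e"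
    using \<open>e > 0\<close> unfolding uniformly_continuous_on_def dist_norm by (metis mem_cball_0)
  show thesis
  proof (rule that[of "min d 1"])
    fix x y :: 'a assume xy: "norm (x - y) < min d 1"
    show "norm (F x - F y) < e"
    proof (cases "norm x \<le> R + 1 \<and> norm y \<le> R + 1")
      case False
      then have "norm x \<ge> R" "norm y \<ge> R"
        using xy norm_triangle_ineq2[of x y] norm_triangle_ineq2[of y x] by (auto simp: norm_minus_commute)
      then show ?thesis using assms by simp
    qed (use d xy in auto)
  qed (use d in auto)
qed

lemma bounded_compact_support:
  fixes F :: "'a::euclidean_space \<Rightarrow> 'b::euclidean_space"
  assumes "continuous_on UNIV F" and "\<And>x. norm x \<ge> R \<Longrightarrow> F x = 0"
  obtains B where "B > 0" "\<And>x. norm (F x) \<le> B"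
proof -
  have "compact (F ` cball 0 R)"
    by (intro compact_continuous_image continuous_on_subset[OF assms(1)]) auto
  then obtain B where B: "B > 0" "\<And>x. norm x \<le> R \<Longrightarrow> norm (F x) \<le> B"
    using compact_imp_bounded[of "F ` cball 0 R"] unfolding bounded_pos by auto
  have "norm (F x) \<le> B" for x
    using B assms(2)[of x] by (cases "norm x \<le> R") auto
  with B that show thesis by blast
qed

text \<open>The version of \<open>locally_integrable\<close> for Borel functions and
  \<open>lborel\<close>, where joint measurability and Fubini are at hand; closed balls suffice
  because every compact set lies in one. \<open>weak_gradient\<close> below stands to
  \<open>has_weak_gradient\<close> in the same way.\<close>

definition loc_int :: "('a::euclidean_space \<Rightarrow> 'b::euclidean_space) \<Rightarrow> bool" where
  "loc_int f \<longleftrightarrow> f \<in> borel_measurable borel \<and>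
    (\<forall>R. integrable lborel (\<lambda>x. indicator (cball 0 R) x *\<^sub>R f x))"

definition conv :: "('a::euclidean_space \<Rightarrow> real) \<Rightarrow> ('a \<Rightarrow> 'b::euclidean_space) \<Rightarrow> 'a \<Rightarrow> 'b" where
  "conv \<eta> f x = (\<integral>y. \<eta> (x - y) *\<^sub>R f y \<partial>lborel)"

lemma loc_int_borel: "loc_int f \<Longrightarrow> f \<in> borel_measurable borel"
  by (simp add: loc_int_def)

lemma loc_int_bounded_mult:
  fixes \<eta> :: "'a::euclidean_space \<Rightarrow> real" and f :: "'a \<Rightarrow> 'b::euclidean_space"
  assumes [measurable]: "\<eta> \<in> borel_measurable borel" and f: "loc_int f"
    and "\<And>x. norm x > R \<Longrightarrow> \<eta> x = 0" and "\<And>x. norm (\<eta> x) \<le> B"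
  shows "integrable lborel (\<lambda>y. \<eta> y *\<^sub>R f y)"
proof (rule Bochner_Integration.integrable_bound)
  note loc_int_borel[OF f, measurable]
  show "integrable lborel (\<lambda>y. B *\<^sub>R (indicator (cball 0 R) y *\<^sub>R f y))"
    using f by (intro integrable_scaleR_right) (auto simp: loc_int_def)
  show "(\<lambda>y. \<eta> y *\<^sub>R f y) \<in> borel_measurable lborel" by measurable
  have "B \<ge> 0" using assms(4)[of 0] norm_ge_zero order_trans by blast
  then have "norm (\<eta> y *\<^sub>R f y) \<le> norm (B *\<^sub>R (indicator (cball 0 R) y *\<^sub>R f y))" for y
    using assms(3)[of y] mult_right_mono[OF assms(4)[of y] norm_ge_zero[of "f y"]]
    by (cases "norm y \<le> R") auto
  then show "AE y in lborel. norm (\<eta> y *\<^sub>R f y) \<le> norm (B *\<^sub>R (indicator (cball 0 R) y *\<^sub>R f y))"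
    by simp
qed

lemma integrable_conv:
  fixes \<eta> :: "'a::euclidean_space \<Rightarrow> real" and f :: "'a \<Rightarrow> 'b::euclidean_space"
  assumes \<eta>: "continuous_on UNIV \<eta>" "\<And>x. norm x \<ge> R \<Longrightarrow> \<eta> x = 0" and f: "loc_int f"
  shows "integrable lborel (\<lambda>y. \<eta> (x - y) *\<^sub>R f y)"
proof -
  obtain B where B: "\<And>x. norm (\<eta> x) \<le> B" using bounded_compact_support[OF \<eta>] by blast
  have [measurable]: "\<eta> \<in> borel_measurable borel" by (rule borel_measurable_continuous_onI) fact
  show ?thesis
  proof (rule loc_int_bounded_mult[OF _ f, where R = "norm x + R" and B = B])
    show "\<eta> (x - y) = 0" if "norm y > norm x + R" for y
    proof (rule \<eta>)
      show "R \<le> norm (x - y)"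
        using that norm_triangle_ineq2[of y x] by (simp add: norm_minus_commute)
    qed
  qed (use B in auto)
qed

text \<open>The remainder is governed by the oscillation of the gradient along a segment, and the
  gradient is uniformly continuous. That \<open>d\<close> does not depend on \<open>z\<close> lets
  the estimate be integrated against \<open>u\<close> in \<open>GDERIV_conv\<close>.\<close>

lemma C0_infinity_linearization:
  fixes \<eta> :: "'a::euclidean_space \<Rightarrow> real"
  assumes "\<eta> \<in> C0_infinity" "e > 0"
  obtains d where "d > 0"
    "\<And>z h. norm h < d \<Longrightarrow> \<bar>\<eta> (z + h) - \<eta> z - h \<bullet> grad \<eta> z\<bar> \<le> e * norm h"
proof -
  note s = C0_infinity_smooth[OF assms(1)]
  obtain R where R: "R > 0" "\<And>x. norm x \<ge> R \<Longrightarrow> \<eta> x = 0"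
    "\<And>x. norm x \<ge> R \<Longrightarrow> grad \<eta> x = 0"
    using C0_infinity_support[OF assms(1)] by blast
  from this(3) obtain d where d: "d > 0" "\<And>x y. norm (x - y) < d \<Longrightarrow> norm (grad \<eta> x - grad \<eta> y) < e"
    using uniformly_continuous_compact_support[OF smooth_continuous_grad[OF s] _ \<open>e > 0\<close>, of R] by blast
  show thesis
  proof (rule that[OF d(1)])
    fix z h :: 'a assume h: "norm h < d"
    have "norm (\<eta> (z + h) - \<eta> z - (z + h - z) \<bullet> grad \<eta> z) \<le> norm (z + h - z) * e"
    proof (rule differentiable_bound_linearization[where S = "ball z d" and f' = "\<lambda>w h. h \<bullet> grad \<eta> w"])
      fix t :: real assume "t \<in> {0..1}"
      then have "\<bar>t\<bar> * norm h \<le> norm h" by (intro mult_left_le_one_le) auto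
      then show "z + t *\<^sub>R (z + h - z) \<in> ball z d" using h by (simp add: dist_norm)
    next
      fix w assume w: "w \<in> ball z d"
      show "(\<eta> has_derivative (\<lambda>h. h \<bullet> grad \<eta> w)) (at w within ball z d)"
        using smooth_GDERIV[OF s, of w] by (auto simp: gderiv_def intro: has_derivative_at_withinI)
      show "onorm ((\<lambda>h. h \<bullet> grad \<eta> w) - (\<lambda>h. h \<bullet> grad \<eta> z)) \<le> e"
      proof (rule onorm_bound)
        fix h
        have "norm (h \<bullet> (grad \<eta> w - grad \<eta> z)) \<le> norm h * norm (grad \<eta> w - grad \<eta> z)"
          using Cauchy_Schwarz_ineq2 by auto
        also have "\<dots> \<le> norm h * e"
          using w d(2)[of w z] by (intro mult_left_mono) (auto simp: dist_norm norm_minus_commute less_imp_le)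
        finally show "norm (((\<lambda>h. h \<bullet> grad \<eta> w) - (\<lambda>h. h \<bullet> grad \<eta> z)) h) \<le> e * norm h"
          by (simp add: inner_diff_right mult.commute)
      qed (use \<open>e > 0\<close> in auto)
    qed (use d in auto)
    then show "\<bar>\<eta> (z + h) - \<eta> z - h \<bullet> grad \<eta> z\<bar> \<le> e * norm h" by (simp add: mult.commute)
  qed
qed

text \<open>Differentiation under the integral sign: the linearization error of the kernel is a
  small multiple of the increment, uniformly, and lives on a bounded set, so integrating it against
  \<open>u\<close> costs only the mass of \<open>u\<close> on a ball. By the second claim every
  partial derivative is again a convolution with a test function.\<close>

lemma GDERIV_conv:
  fixes u :: "'a::euclidean_space \<Rightarrow> real"
  assumes \<eta>: "\<eta> \<in> C0_infinity" and u: "loc_int u"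
  shows "GDERIV (conv \<eta> u) x :> (\<integral>y. u y *\<^sub>R grad \<eta> (x - y) \<partial>lborel)"
    and "\<And>b. b \<in> Basis \<Longrightarrow>
      (\<integral>y. u y *\<^sub>R grad \<eta> (x - y) \<partial>lborel) \<bullet> b = conv (\<lambda>z. grad \<eta> z \<bullet> b) u x"
proof -
  note s = C0_infinity_smooth[OF \<eta>]
  obtain R where R: "R > 0" "\<And>x. norm x \<ge> R \<Longrightarrow> \<eta> x = 0" "\<And>x. norm x \<ge> R \<Longrightarrow> grad \<eta> x = 0"
    using C0_infinity_support[OF \<eta>] by blast
  note [measurable] = smooth_borel[OF s] loc_int_borel[OF u]
  have gi: "integrable lborel (\<lambda>y. u y *\<^sub>R grad \<eta> (x - y))"
  proof -
    have "integrable lborel (\<lambda>y. \<Sum>b\<in>Basis. ((grad \<eta> (x - y) \<bullet> b) *\<^sub>R u y) *\<^sub>R b)"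
      by (intro Bochner_Integration.integrable_sum integrable_scaleR_left integrable_conv[OF smooth_continuous[OF smooth_grad[OF s]], where R = R])
        (use R u in auto)
    also have "(\<lambda>y. \<Sum>b\<in>Basis. ((grad \<eta> (x - y) \<bullet> b) *\<^sub>R u y) *\<^sub>R b) = (\<lambda>y. u y *\<^sub>R grad \<eta> (x - y))"
      by (simp add: euclidean_representation mult.commute scaleR_sum_right[symmetric] flip: scaleR_scaleR)
    finally show ?thesis .
  qed
  show "(\<integral>y. u y *\<^sub>R grad \<eta> (x - y) \<partial>lborel) \<bullet> b = conv (\<lambda>z. grad \<eta> z \<bullet> b) u x" if "b \<in> Basis" for b
    unfolding conv_def using integral_inner_left[OF gi, of b] by (simp add: mult.commute)
  have ci: "integrable lborel (\<lambda>y. \<eta> (z - y) *\<^sub>R u y)" for z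
    by (rule integrable_conv[OF smooth_continuous[OF s] R(2) u])
  show "GDERIV (conv \<eta> u) x :> (\<integral>y. u y *\<^sub>R grad \<eta> (x - y) \<partial>lborel)"
    unfolding gderiv_def has_derivative_at_alt
  proof (intro conjI allI impI)
    fix e :: real assume "e > 0"
    \<comment> \<open>For \<open>norm (z - x) < 1\<close>, every y outside this ball has both x - y
      and z - y of norm at least R, where the kernel and its gradient vanish.\<close>
    let ?c = "cball 0 (norm x + R + 1) :: 'a set"
    \<comment> \<open>The summand 1 keeps \<open>K\<close> positive, so that \<open>e / K\<close> is
      a legitimate tolerance.\<close>
    define K where "K = (\<integral>y. norm (indicator ?c y *\<^sub>R u y) \<partial>lborel) + 1"
    have K: "K > 0" unfolding K_def by (intro add_nonneg_pos integral_nonneg) auto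
    have ui: "integrable lborel (\<lambda>y. norm (indicator ?c y *\<^sub>R u y))" using u by (simp only: loc_int_def integrable_norm)
    obtain d where d: "d > 0" "\<And>z h. norm h < d \<Longrightarrow> \<bar>\<eta> (z + h) - \<eta> z - h \<bullet> grad \<eta> z\<bar> \<le> e / K * norm h"
      using C0_infinity_linearization[OF \<eta>, of "e / K"] \<open>e > 0\<close> K by (metis divide_pos_pos)
    show "\<exists>d>0. \<forall>y. norm (y - x) < d \<longrightarrow>
        norm (conv \<eta> u y - conv \<eta> u x - (y - x) \<bullet> (\<integral>y. u y *\<^sub>R grad \<eta> (x - y) \<partial>lborel)) \<le> e * norm (y - x)"
    proof (intro exI[of _ "min d 1"] conjI allI impI)
      fix z assume z: "norm (z - x) < min d 1"
      let ?F = "\<lambda>y. \<eta> (z - y) *\<^sub>R u y - \<eta> (x - y) *\<^sub>R u y - (z - x) \<bullet> (u y *\<^sub>R grad \<eta> (x - y))"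
      have Fi: "integrable lborel ?F" by (intro Bochner_Integration.integrable_diff ci integrable_inner_right gi)
      have "norm (conv \<eta> u z - conv \<eta> u x - (z - x) \<bullet> (\<integral>y. u y *\<^sub>R grad \<eta> (x - y) \<partial>lborel))
        = norm (\<integral>y. ?F y \<partial>lborel)"
        unfolding conv_def using ci gi by (simp add: integral_inner_right[OF gi] del: inner_scaleR_right real_scaleR_def)
      also have "\<dots> \<le> (\<integral>y. norm (?F y) \<partial>lborel)" by (rule integral_norm_bound)
      also have "\<dots> \<le> (\<integral>y. (e / K * norm (z - x)) * norm (indicator ?c y *\<^sub>R u y) \<partial>lborel)"
      proof (rule integral_mono)
        fix y
        show "norm (?F y) \<le> (e / K * norm (z - x)) * norm (indicator ?c y *\<^sub>R u y)"
        proof (cases "y \<in> ?c")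
          case True
          have "?F y = u y * (\<eta> (x - y + (z - x)) - \<eta> (x - y) - (z - x) \<bullet> grad \<eta> (x - y))"
            by (simp add: algebra_simps)
          also have "norm \<dots> \<le> \<bar>u y\<bar> * (e / K * norm (z - x))"
            unfolding real_norm_def abs_mult using z by (intro mult_left_mono d) auto
          finally show ?thesis using True by (simp add: mult_ac)
        next
          case False
          then have "norm y > norm x + R + 1" by simp
          then have "norm (x - y) \<ge> R" "norm (z - y) \<ge> R"
            using z norm_triangle_ineq2[of y x] norm_triangle_ineq2[of y z] norm_triangle_ineq2[of z x]
            by (auto simp: norm_minus_commute)
          then show ?thesis using R False by simp
        qed
      qed (intro integrable_norm Fi integrable_mult_right ui)+
      also have "\<dots> = (e / K * norm (z - x)) * (K - 1)"
        unfolding K_def by simp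
      also have "\<dots> \<le> (e / K * norm (z - x)) * K"
        using \<open>e > 0\<close> K by (intro mult_left_mono) auto
      also have "\<dots> = e * norm (z - x)" using K by simp
      finally show "norm (conv \<eta> u z - conv \<eta> u x - (z - x) \<bullet> (\<integral>y. u y *\<^sub>R grad \<eta> (x - y) \<partial>lborel)) \<le> e * norm (z - x)" .
    qed (use d in auto)
  qed (rule bounded_linear_inner_left)
qed

text \<open>All derivatives fall on the kernel, so local integrability of \<open>u\<close> is
  enough; the induction therefore generalises over the kernel.\<close>

lemma smooth_conv:
  fixes u :: "'a::euclidean_space \<Rightarrow> real"
  assumes "\<eta> \<in> C0_infinity" and u: "loc_int u"
  shows "smooth (conv \<eta> u)"
proof -
  have "C_k k (conv \<eta> u)" if "\<eta> \<in> C0_infinity" for k \<eta>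
    using that
  proof (induction k arbitrary: \<eta>)
    case 0
    show ?case
      by (auto intro!: continuous_at_imp_continuous_on GDERIV_isCont[OF GDERIV_conv(1)] 0 u)
  next
    case (Suc k)
    show ?case
      by (rule C_k_SucI[OF GDERIV_conv(1)[OF Suc.prems u]])
        (use Suc.IH[OF C0_infinity_grad[OF Suc.prems]] GDERIV_conv(2)[OF Suc.prems u] in simp)
  qed
  then show ?thesis using assms unfolding smooth_def by blast
qed

lemma lborel_distr_reflect: "distr lborel borel (\<lambda>y. x - y) = (lborel :: 'a::euclidean_space measure)"
  using lborel_affine[of "-1" x] by (simp add: density_1)

lemma integral_lborel_reflect:
  fixes f :: "'a::euclidean_space \<Rightarrow> 'b::euclidean_space"
  assumes "f \<in> borel_measurable borel"
  shows "(\<integral>y. f (x - y) \<partial>lborel) = (\<integral>y. f y \<partial>lborel)"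
  using integral_distr[of "\<lambda>y. x - y" lborel borel f] assms by (simp add: lborel_distr_reflect)

lemma nn_integral_lborel_reflect:
  assumes "f \<in> borel_measurable borel"
  shows "(\<integral>\<^sup>+y. f (x - y) \<partial>lborel) = (\<integral>\<^sup>+y. f y \<partial>(lborel :: 'a::euclidean_space measure))"
  using nn_integral_distr[of "\<lambda>y. x - y" lborel borel f] assms by (simp add: lborel_distr_reflect)

lemma loc_int_continuous:
  fixes f :: "'a::euclidean_space \<Rightarrow> 'b::euclidean_space"
  assumes "continuous_on UNIV f"
  shows "loc_int f"
proof -
  have "set_integrable lborel (cball 0 R) f" for R :: real
    unfolding set_integrable_def
    by (intro borel_integrable_compact continuous_on_subset[OF assms]) auto
  then show ?thesis
    unfolding loc_int_def set_integrable_def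
    using borel_measurable_continuous_onI[OF assms] by auto
qed

text \<open>Convolving with the constant \<open>1\<close> gives a constant function, whose gradient vanishes.\<close>

lemma integral_grad_C0_infinity:
  fixes \<phi> :: "'a::euclidean_space \<Rightarrow> real"
  assumes \<phi>: "\<phi> \<in> C0_infinity" and b: "b \<in> Basis"
  shows "(\<integral>x. grad \<phi> x \<bullet> b \<partial>lborel) = 0"
proof -
  note [measurable] = smooth_borel[OF C0_infinity_smooth[OF \<phi>]]
  have 1: "loc_int (\<lambda>_::'a. 1::real)" by (rule loc_int_continuous) simp
  have "conv \<phi> (\<lambda>_. 1) = (\<lambda>_. \<integral>x. \<phi> x \<partial>lborel)"
    using integral_lborel_reflect[of \<phi>] by (simp add: conv_def fun_eq_iff)
  then have "(\<integral>y. 1 *\<^sub>R grad \<phi> (0 - y) \<partial>lborel) = 0"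
    using grad_eqI[OF GDERIV_conv(1)[OF \<phi> 1, of 0]] grad_eqI[OF GDERIV_const] by metis
  then have "conv (\<lambda>z. grad \<phi> z \<bullet> b) (\<lambda>_. 1::real) 0 = 0"
    using GDERIV_conv(2)[OF \<phi> 1 b, of 0] by simp
  then show ?thesis
    using integral_lborel_reflect[of "\<lambda>x. grad \<phi> x \<bullet> b" 0] by (simp add: conv_def)
qed

text \<open>The product of \<open>v\<close> and \<open>\<phi>\<close> is a test function, so its
  partial derivatives have integral 0. Compact support makes both terms of the product rule
  integrable, which allows the integral to be split.\<close>

lemma integration_by_parts:
  fixes \<phi> :: "'a::euclidean_space \<Rightarrow> real"
  assumes v: "smooth v" and \<phi>: "\<phi> \<in> C0_infinity" and b: "b \<in> Basis"
  shows "(\<integral>x. v x * (grad \<phi> x \<bullet> b) \<partial>lborel) = - (\<integral>x. (grad v x \<bullet> b) * \<phi> x \<partial>lborel)"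
proof -
  note s = C0_infinity_smooth[OF \<phi>]
  obtain R where R: "R > 0" "\<And>x. norm x \<ge> R \<Longrightarrow> \<phi> x = 0" "\<And>x. norm x \<ge> R \<Longrightarrow> grad \<phi> x = 0"
    using C0_infinity_support[OF \<phi>] by blast
  have i: "integrable lborel f" if "continuous_on UNIV f" "\<And>x. norm x \<ge> R \<Longrightarrow> f x = 0" for f :: "'a \<Rightarrow> real"
  proof -
    have "(\<lambda>x. indicator (cball 0 R) x *\<^sub>R f x) = f"
      using that(2) by (force simp: fun_eq_iff indicator_def)
    then show ?thesis using loc_int_continuous[OF that(1)] unfolding loc_int_def by metis
  qed
  have "(\<integral>x. v x * (grad \<phi> x \<bullet> b) + (grad v x \<bullet> b) * \<phi> x \<partial>lborel) = 0"
    using integral_grad_C0_infinity[OF C0_infinity_mult[OF v \<phi>] b] grad_mult[OF v s]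
    by (simp add: inner_add_left mult.commute)
  moreover have "integrable lborel (\<lambda>x. v x * (grad \<phi> x \<bullet> b))" "integrable lborel (\<lambda>x. (grad v x \<bullet> b) * \<phi> x)"
    by (rule i[OF continuous_on_mult]; use R in \<open>simp add: smooth_continuous smooth_grad s v b\<close>)+
  ultimately show ?thesis by simp
qed

section \<open>Weak gradients under convolution\<close>

definition weak_gradient :: "('a::euclidean_space \<Rightarrow> real) \<Rightarrow> ('a \<Rightarrow> 'a) \<Rightarrow> bool" where
  "weak_gradient u g \<longleftrightarrow> loc_int u \<and> loc_int g \<and>
    (\<forall>\<phi>\<in>C0_infinity. \<forall>b\<in>Basis.
      (\<integral>x. u x * (grad \<phi> x \<bullet> b) \<partial>lborel) = - (\<integral>x. (g x \<bullet> b) * \<phi> x \<partial>lborel))"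

lemma weak_gradient_smooth: "smooth v \<Longrightarrow> weak_gradient v (grad v)"
  unfolding weak_gradient_def
  by (auto intro: loc_int_continuous smooth_continuous smooth_continuous_grad integration_by_parts)

text \<open>The classical gradient puts the derivative on the kernel. Using
  \<open>\<lambda>y. \<eta> (x - y)\<close> as the test function moves it over to \<open>u\<close>,
  where it becomes \<open>g\<close>.\<close>

lemma grad_conv:
  assumes ug: "weak_gradient u g" and \<eta>: "\<eta> \<in> C0_infinity"
  shows "grad (conv \<eta> u) x = conv \<eta> g x"
proof (rule euclidean_eqI)
  fix b :: 'a assume b: "b \<in> Basis"
  have u: "loc_int u" and g: "loc_int g" using ug by (auto simp: weak_gradient_def)
  obtain R where R: "R > 0" "\<And>x. norm x \<ge> R \<Longrightarrow> \<eta> x = 0"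
    "\<And>x. norm x \<ge> R \<Longrightarrow> grad \<eta> x = 0"
    using C0_infinity_support[OF \<eta>] by blast
  have gi: "integrable lborel (\<lambda>y. \<eta> (x - y) *\<^sub>R g y)"
    by (rule integrable_conv[OF smooth_continuous[OF C0_infinity_smooth[OF \<eta>]] R(2) g])
  have "grad (conv \<eta> u) x \<bullet> b = conv (\<lambda>z. grad \<eta> z \<bullet> b) u x"
    using GDERIV_conv[OF \<eta> u] b grad_eqI by metis
  also have "\<dots> = - (\<integral>y. u y * (grad (\<lambda>y. \<eta> (x - y)) y \<bullet> b) \<partial>lborel)"
    by (simp add: conv_def C0_infinity_reflect[OF \<eta>] mult.commute)
  also have "\<dots> = (\<integral>y. (g y \<bullet> b) * \<eta> (x - y) \<partial>lborel)"
    using ug C0_infinity_reflect(1)[OF \<eta>] b by (simp add: weak_gradient_def)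
  also have "\<dots> = conv \<eta> g x \<bullet> b"
    unfolding conv_def using integral_inner_left[OF gi, of b] by (simp add: mult.commute)
  finally show "grad (conv \<eta> u) x \<bullet> b = conv \<eta> g x \<bullet> b" .
qed

section \<open>Bump functions and mollifiers\<close>

definition bump :: "real \<Rightarrow> 'a::euclidean_space \<Rightarrow> real" where
  "bump r x = flat_exp 1 (r\<^sup>2 - (norm x)\<^sup>2)"

text \<open>Only the square of the norm enters \<open>bump\<close>, and that is a polynomial, so the
  origin needs no separate treatment.\<close>

lemma smooth_bump: "smooth (bump r)"
  unfolding smooth_def bump_def[abs_def]
  by (intro allI C_k_flat_exp C_k_diff C_k_const C_k_norm_square)

lemma bump_nonneg: "bump r x \<ge> 0"
  by (simp add: bump_def flat_exp_def)

lemma bump_pos_iff: "r > 0 \<Longrightarrow> bump r x > 0 \<longleftrightarrow> norm x < r"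
  using power2_less_imp_less[of "norm x" r] power_strict_mono[of "norm x" r 2]
  by (auto simp: bump_def flat_exp_def not_le)

lemma bump_eq_0: "r > 0 \<Longrightarrow> norm x \<ge> r \<Longrightarrow> bump r x = 0"
  using bump_pos_iff[of r x] bump_nonneg[of r x] by linarith

lemma bump_C0_infinity: "r > 0 \<Longrightarrow> bump r \<in> C0_infinity"
  by (rule C0_infinityI[where R = r, OF smooth_bump]) (simp add: bump_eq_0)

definition mollifier :: "real \<Rightarrow> 'a::euclidean_space \<Rightarrow> real" where
  "mollifier r x = bump r x / (\<integral>y. bump r (y::'a) \<partial>lborel)"

lemma mollifier:
  assumes "r > 0"
  shows "(mollifier r :: 'a::euclidean_space \<Rightarrow> real) \<in> C0_infinity"
    and "mollifier r (x::'a) \<ge> 0"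
    and "norm x \<ge> r \<Longrightarrow> mollifier r (x::'a) = 0"
    and "(\<integral>\<^sup>+x. mollifier r (x::'a) \<partial>lborel) = 1"
proof -
  let ?I = "\<integral>y. bump r (y::'a) \<partial>lborel"
  note [measurable] = smooth_borel(1)[OF smooth_bump]
  have "loc_int (bump r :: 'a \<Rightarrow> real)" by (intro loc_int_continuous smooth_continuous smooth_bump)
  moreover have "(\<lambda>x::'a. indicator (cball 0 r) x *\<^sub>R bump r x) = bump r"
    using bump_eq_0[OF assms] by (force simp: fun_eq_iff indicator_def)
  ultimately have i: "integrable lborel (bump r :: 'a \<Rightarrow> real)" unfolding loc_int_def by metis
  \<comment> \<open>The normalising integral has to be nonzero, since otherwise
    \<open>mollifier\<close> would degenerate to a division by zero. It is, because
    \<open>bump r\<close> is positive on a ball of positive measure.\<close>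
  have "\<not> (AE x::'a in lborel. bump r x = 0)"
  proof
    assume "AE x::'a in lborel. bump r x = 0"
    then have "AE x in lborel. x \<notin> ball (0::'a) r"
      by eventually_elim (use bump_pos_iff[OF assms] in force)
    then have "emeasure lborel (ball (0::'a) r) = 0"
      by (subst (asm) AE_iff_measurable[OF _ refl]) (auto simp: ball_def dist_norm)
    then show False using content_ball_pos[OF assms, of "0::'a"] by (simp add: measure_def)
  qed
  then have "?I \<noteq> 0"
    using integral_nonneg_eq_0_iff_AE[OF i] bump_nonneg by auto
  moreover have "?I \<ge> 0" by (intro Bochner_Integration.integral_nonneg bump_nonneg)
  ultimately have I: "?I > 0" by simp
  have "mollifier r = (\<lambda>x::'a. inverse ?I * bump r x)"
    by (auto simp: mollifier_def fun_eq_iff divide_inverse)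
  then show "(mollifier r :: 'a \<Rightarrow> real) \<in> C0_infinity"
    using C0_infinity_mult[OF smooth_const bump_C0_infinity[OF assms]] by simp
  show "mollifier r (x::'a) \<ge> 0" using I by (simp add: mollifier_def bump_nonneg)
  show "norm x \<ge> r \<Longrightarrow> mollifier r (x::'a) = 0" using assms by (simp add: mollifier_def bump_eq_0)
  have "(\<integral>\<^sup>+x. mollifier r (x::'a) \<partial>lborel) = ennreal (\<integral>x. mollifier r (x::'a) \<partial>lborel)"
    by (rule nn_integral_eq_integral) (use i I in \<open>auto simp: mollifier_def[abs_def] bump_nonneg\<close>)
  also have "(\<integral>x. mollifier r (x::'a) \<partial>lborel) = 1"
    using I by (simp add: mollifier_def[abs_def])
  finally show "(\<integral>\<^sup>+x. mollifier r (x::'a) \<partial>lborel) = 1" by simp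
qed

section \<open>Convergence of mollifications in weighted Lebesgue spaces\<close>

text \<open>The p-th power of a weighted L^p norm. Values in \<open>ennreal\<close> permit estimates
  before finiteness is known, and leaving out the p-th root allows a triangle inequality with a
  factor 2^p in place of Minkowski's inequality.\<close>

definition energy :: "nat \<Rightarrow> ('a::euclidean_space \<Rightarrow> real) \<Rightarrow> ('a \<Rightarrow> 'b::euclidean_space) \<Rightarrow> ennreal" where
  "energy p w f = (\<integral>\<^sup>+x. ennreal (norm (f x) ^ p * w x) \<partial>lborel)"

text \<open>Bounding the sum by twice the maximum is enough: the constant only has to be independent
  of \<open>a\<close> and \<open>b\<close>.\<close>

lemma add_power_le:
  fixes a b :: real
  assumes "a \<ge> 0" "b \<ge> 0"
  shows "(a + b) ^ p \<le> 2 ^ p * (a ^ p + b ^ p)"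
proof -
  have "(a + b) ^ p \<le> (2 * max a b) ^ p" using assms by (intro power_mono) auto
  also have "\<dots> \<le> 2 ^ p * (a ^ p + b ^ p)"
    using assms by (auto simp: power_mult_distrib max_def)
  finally show ?thesis .
qed

lemma energy_add:
  fixes f g :: "'a::euclidean_space \<Rightarrow> 'b::euclidean_space"
  assumes [measurable]: "f \<in> borel_measurable borel" "g \<in> borel_measurable borel" "w \<in> borel_measurable borel"
    and w: "\<And>x. w x \<ge> 0"
  shows "energy p w (\<lambda>x. f x + g x) \<le> 2 ^ p * (energy p w f + energy p w g)"
proof -
  have "energy p w (\<lambda>x. f x + g x)
      \<le> (\<integral>\<^sup>+x. 2 ^ p * (ennreal (norm (f x) ^ p * w x) + ennreal (norm (g x) ^ p * w x)) \<partial>lborel)"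
    unfolding energy_def
  proof (rule nn_integral_mono)
    fix x
    have "norm (f x + g x) ^ p * w x \<le> (norm (f x) + norm (g x)) ^ p * w x"
      by (intro mult_right_mono power_mono norm_triangle_ineq w norm_ge_zero)
    also have "\<dots> \<le> (2 ^ p * (norm (f x) ^ p + norm (g x) ^ p)) * w x"
      by (intro mult_right_mono add_power_le w norm_ge_zero)
    finally have "ennreal (norm (f x + g x) ^ p * w x)
        \<le> ennreal (2 ^ p * (norm (f x) ^ p * w x + norm (g x) ^ p * w x))"
      by (intro ennreal_leI) (simp add: algebra_simps)
    also have "\<dots> = 2 ^ p * (ennreal (norm (f x) ^ p * w x) + ennreal (norm (g x) ^ p * w x))"
      using w by (simp add: ennreal_mult ennreal_power[symmetric])
    finally show "ennreal (norm (f x + g x) ^ p * w x)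
        \<le> 2 ^ p * (ennreal (norm (f x) ^ p * w x) + ennreal (norm (g x) ^ p * w x))" .
  qed
  also have "\<dots> = 2 ^ p * (energy p w f + energy p w g)"
    unfolding energy_def by (simp add: nn_integral_cmult nn_integral_add)
  finally show ?thesis .
qed

lemma energy_minus_commute: "energy p w (\<lambda>x. f x - g x) = energy p w (\<lambda>x. g x - f x)"
  by (simp add: energy_def norm_minus_commute)

lemma energy_triangle:
  fixes f g h :: "'a::euclidean_space \<Rightarrow> 'b::euclidean_space"
  assumes [measurable]: "f \<in> borel_measurable borel" "g \<in> borel_measurable borel"
    "h \<in> borel_measurable borel" "w \<in> borel_measurable borel"
    and w: "\<And>x. w x \<ge> 0"
  shows "energy p w (\<lambda>x. f x - h x) \<le> 2 ^ p * (energy p w (\<lambda>x. f x - g x) + energy p w (\<lambda>x. g x - h x))"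
  using energy_add[of "\<lambda>x. f x - g x" "\<lambda>x. g x - h x" w p] w by simp

text \<open>Convexity of a power in tangent form. Integrated against a probability density with
  \<open>a\<close> the mean, it yields Jensen's inequality in
  \<open>norm_conv_power_le\<close>.\<close>

lemma tangent_power_le:
  fixes a t :: real
  assumes "a \<ge> 0" "t \<ge> 0"
  shows "a ^ Suc p + Suc p * a ^ p * (t - a) \<le> t ^ Suc p"
proof (induction p)
  case (Suc p)
  have "t * (a ^ Suc p + Suc p * a ^ p * (t - a)) \<le> t * t ^ Suc p"
    by (rule mult_left_mono[OF Suc]) fact
  \<comment> \<open>Multiplying the tangent by t gives the next tangent plus a nonnegative square,
    which closes the induction.\<close>
  moreover have "t * (a ^ Suc p + Suc p * a ^ p * (t - a))
      = a ^ Suc (Suc p) + Suc (Suc p) * a ^ Suc p * (t - a) + Suc p * a ^ p * (t - a)\<^sup>2"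
    by (simp add: algebra_simps power2_eq_square)
  moreover have "Suc p * a ^ p * (t - a)\<^sup>2 \<ge> 0" using assms by simp
  ultimately show ?case by simp
qed simp

lemma loc_int_diff: "loc_int f \<Longrightarrow> loc_int g \<Longrightarrow> loc_int (\<lambda>x. f x - g x)"
  unfolding loc_int_def by (auto simp: scaleR_diff_right)

lemma loc_int_integrable: "integrable lborel f \<Longrightarrow> loc_int f"
  unfolding loc_int_def using integrable_mult_indicator[of _ lborel f]
  by (auto dest: borel_measurable_integrable)

lemma integrable_mollifier:
  fixes f :: "'a::euclidean_space \<Rightarrow> 'b::euclidean_space"
  assumes "r > 0" "loc_int f"
  shows "integrable lborel (\<lambda>y. mollifier r (x - y) *\<^sub>R f y)"
  by (rule integrable_conv[OF smooth_continuous[OF C0_infinity_smooth[OF mollifier(1)]] mollifier(3)])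
    (use assms in auto)

lemma mollifier_borel [measurable]: "(mollifier r :: 'a::euclidean_space \<Rightarrow> real) \<in> borel_measurable borel"
  unfolding mollifier_def[abs_def] using smooth_borel(1)[OF smooth_bump] by measurable

lemma conv_borel:
  fixes f :: "'a::euclidean_space \<Rightarrow> 'b::euclidean_space"
  assumes [measurable]: "f \<in> borel_measurable borel"
  shows "conv (mollifier r) f \<in> borel_measurable borel"
  unfolding conv_def[abs_def] by measurable

text \<open>The kernel is even, so it has mass 1 in either variable; the second form is the one left
  over after Fubini in \<open>energy_conv\<close>.\<close>

lemma nn_integral_mollifier:
  fixes x :: "'a::euclidean_space"
  assumes "r > 0"
  shows "(\<integral>\<^sup>+y. mollifier r (x - y) \<partial>lborel) = 1" "(\<integral>\<^sup>+y. mollifier r (y - x) \<partial>lborel) = 1"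
proof -
  show "(\<integral>\<^sup>+y. mollifier r (x - y) \<partial>lborel) = 1"
    using nn_integral_lborel_reflect[of "\<lambda>y::'a. ennreal (mollifier r y)" x] mollifier(4)[OF assms, where 'a='a]
    by simp
  have "mollifier r (y - x) = mollifier r (x - y)" for y
    by (simp add: mollifier_def bump_def norm_minus_commute)
  then show "(\<integral>\<^sup>+y. mollifier r (y - x) \<partial>lborel) = 1"
    using \<open>(\<integral>\<^sup>+y. mollifier r (x - y) \<partial>lborel) = 1\<close> by simp
qed

lemma integral_mollifier:
  fixes x :: "'a::euclidean_space"
  assumes "r > 0"
  shows "integrable lborel (\<lambda>y. mollifier r (x - y))" "(\<integral>y. mollifier r (x - y) \<partial>lborel) = 1"
proof -
  show i: "integrable lborel (\<lambda>y. mollifier r (x - y))"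
    using integrable_mollifier[OF assms, of "\<lambda>_. 1::real" x] loc_int_continuous[of "\<lambda>_. 1::real"] by auto
  show "(\<integral>y. mollifier r (x - y) \<partial>lborel) = 1"
    using nn_integral_mollifier(1)[OF assms, of x] mollifier(2)[OF assms]
    by (subst integral_eq_nn_integral) auto
qed

lemma conv_diff:
  fixes f g :: "'a::euclidean_space \<Rightarrow> 'b::euclidean_space"
  assumes "r > 0" "loc_int f" "loc_int g"
  shows "conv (mollifier r) (\<lambda>x. f x - g x) = (\<lambda>x. conv (mollifier r) f x - conv (mollifier r) g x)"
  unfolding conv_def scaleR_diff_right
  using assms by (intro ext Bochner_Integration.integral_diff integrable_mollifier)

lemma norm_conv_power_le:
  fixes f :: "'a::euclidean_space \<Rightarrow> 'b::euclidean_space"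
  assumes r: "r > 0" and f: "loc_int f" and p: "p \<ge> 1"
  shows "ennreal (norm (conv (mollifier r) f x) ^ p)
    \<le> (\<integral>\<^sup>+y. ennreal (mollifier r (x - y) * norm (f y) ^ p) \<partial>lborel)"
proof (cases "(\<integral>\<^sup>+y. ennreal (mollifier r (x - y) * norm (f y) ^ p) \<partial>lborel) = \<infinity>")
  case False
  let ?m = "\<lambda>y. mollifier r (x - y)"
  note [measurable] = loc_int_borel[OF f] and m0 = mollifier(2)[OF r, where 'a='a]
  obtain q where q: "p = Suc q" using p by (cases p) auto
  have ip: "integrable lborel (\<lambda>y. ?m y * norm (f y) ^ p)"
    by (rule integrableI_nonneg) (use False m0 in \<open>auto simp: less_top mult_nonneg_nonneg\<close>)
  have i1: "integrable lborel (\<lambda>y. ?m y * norm (f y))"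
    using integrable_norm[OF integrable_mollifier[OF r f, of x]] m0 by simp
  define a where "a = (\<integral>y. ?m y * norm (f y) \<partial>lborel)"
  have a0: "a \<ge> 0" unfolding a_def using m0 by (intro Bochner_Integration.integral_nonneg) auto
  have "norm (conv (mollifier r) f x) \<le> (\<integral>y. norm (?m y *\<^sub>R f y) \<partial>lborel)"
    unfolding conv_def by (rule integral_norm_bound)
  also have "\<dots> = a" unfolding a_def using m0 by simp
  finally have "norm (conv (mollifier r) f x) ^ p \<le> a ^ p" by (intro power_mono) auto
  \<comment> \<open>The kernel has mass 1 and \<open>norm (f y)\<close> has mean \<open>a\<close>
    against it, so the linear part of the tangent at \<open>a\<close> integrates to 0.\<close>
  also have "a ^ p = (\<integral>y. a ^ p * ?m y + (p * a ^ q) * (?m y * norm (f y)) - (p * a ^ q * a) * ?m y \<partial>lborel)"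
    using i1 integral_mollifier[OF r, of x] by (simp add: a_def[symmetric])
  also have "\<dots> \<le> (\<integral>y. ?m y * norm (f y) ^ p \<partial>lborel)"
  proof (rule integral_mono)
    fix y
    have "?m y * (a ^ p + p * a ^ q * (norm (f y) - a)) \<le> ?m y * norm (f y) ^ p"
      unfolding q using a0 m0 by (intro mult_left_mono tangent_power_le) auto
    then show "a ^ p * ?m y + (p * a ^ q) * (?m y * norm (f y)) - (p * a ^ q * a) * ?m y
        \<le> ?m y * norm (f y) ^ p" by (simp add: algebra_simps)
  qed (use i1 ip integral_mollifier(1)[OF r, of x] in simp_all)
  finally have "ennreal (norm (conv (mollifier r) f x) ^ p) \<le> ennreal (\<integral>y. ?m y * norm (f y) ^ p \<partial>lborel)"
    by (rule ennreal_leI)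
  also have "\<dots> = (\<integral>\<^sup>+y. ennreal (?m y * norm (f y) ^ p) \<partial>lborel)"
    using ip m0 by (intro nn_integral_eq_integral[symmetric]) auto
  finally show ?thesis .
qed simp

text \<open>The Harnack-type condition for points at distance at most 1 makes mollification at
  scales up to 1 bounded on the weighted space. The upper bound lets unweighted L^1 convergence
  imply weighted convergence for uniformly bounded functions.\<close>

definition slow_weight :: "real \<Rightarrow> ('a::euclidean_space \<Rightarrow> real) \<Rightarrow> bool" where
  "slow_weight C w \<longleftrightarrow> w \<in> borel_measurable borel \<and> (\<forall>x. 0 \<le> w x) \<and> (\<forall>x. w x \<le> C) \<and>
    (\<forall>x y. norm (x - y) \<le> 1 \<longrightarrow> w x \<le> C * w y)"

text \<open>After Jensen's inequality and Fubini the kernel vanishes unless x and y are closer than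
  \<open>r \<le> 1\<close>, so the weight may be moved from x to y at the cost of \<open>C\<close>;
  what remains of the kernel has mass 1. The bound is uniform in \<open>r\<close>.\<close>

lemma energy_conv:
  fixes f :: "'a::euclidean_space \<Rightarrow> 'b::euclidean_space"
  assumes w: "slow_weight C w" and r: "0 < r" "r \<le> 1" and f: "loc_int f" and p: "p \<ge> 1"
  shows "energy p w (conv (mollifier r) f) \<le> ennreal C * energy p w f"
proof -
  have [measurable]: "w \<in> borel_measurable borel" and w0: "\<And>x. w x \<ge> 0"
    and wC: "\<And>x y. norm (x - y) \<le> 1 \<Longrightarrow> w x \<le> C * w y" and C: "C \<ge> 0"
    using w order_trans[of 0 "w 0" C] by (auto simp: slow_weight_def)
  note [measurable] = loc_int_borel[OF f] and m0 = mollifier(2)[OF r(1), where 'a='a]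
  have "energy p w (conv (mollifier r) f)
      \<le> (\<integral>\<^sup>+x. (\<integral>\<^sup>+y. ennreal (mollifier r (x - y) * norm (f y) ^ p) \<partial>lborel) * ennreal (w x) \<partial>lborel)"
    unfolding energy_def ennreal_mult'' [OF w0]
    by (intro nn_integral_mono mult_right_mono norm_conv_power_le r f p) simp
  also have "\<dots> = (\<integral>\<^sup>+x. \<integral>\<^sup>+y. ennreal (mollifier r (x - y) * norm (f y) ^ p) * ennreal (w x) \<partial>lborel \<partial>lborel)"
    by (simp add: nn_integral_multc)
  also have "\<dots> = (\<integral>\<^sup>+y. \<integral>\<^sup>+x. ennreal (mollifier r (x - y) * norm (f y) ^ p) * ennreal (w x) \<partial>lborel \<partial>lborel)"
    by (rule lborel_pair.Fubini'[symmetric]) measurable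
  also have "\<dots> \<le> (\<integral>\<^sup>+y. \<integral>\<^sup>+x. ennreal C * ennreal (norm (f y) ^ p * w y) * ennreal (mollifier r (x - y)) \<partial>lborel \<partial>lborel)"
  proof (intro nn_integral_mono)
    fix x y :: 'a
    have "mollifier r (x - y) * norm (f y) ^ p * w x \<le> C * (norm (f y) ^ p * w y) * mollifier r (x - y)"
    proof (cases "norm (x - y) < r")
      case True
      then have "w x \<le> C * w y" using r by (intro wC) simp
      then have "mollifier r (x - y) * norm (f y) ^ p * w x \<le> mollifier r (x - y) * norm (f y) ^ p * (C * w y)"
        using m0 by (intro mult_left_mono mult_nonneg_nonneg) auto
      then show ?thesis by (simp add: mult_ac)
    next
      case False
      then show ?thesis using mollifier(3)[OF r(1), of "x - y"] by simp
    qed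
    then show "ennreal (mollifier r (x - y) * norm (f y) ^ p) * ennreal (w x)
        \<le> ennreal C * ennreal (norm (f y) ^ p * w y) * ennreal (mollifier r (x - y))"
      using m0 w0 C by (simp add: ennreal_mult[symmetric] ennreal_leI)
  qed
  also have "\<dots> = (\<integral>\<^sup>+y. ennreal C * ennreal (norm (f y) ^ p * w y) \<partial>lborel)"
    by (simp add: nn_integral_cmult nn_integral_mollifier r)
  also have "\<dots> = ennreal C * energy p w f"
    unfolding energy_def by (rule nn_integral_cmult) simp
  finally show ?thesis .
qed

section \<open>Mollification at the scales 1 / (n + 1)\<close>

definition mollify :: "nat \<Rightarrow> ('a::euclidean_space \<Rightarrow> 'b::euclidean_space) \<Rightarrow> 'a \<Rightarrow> 'b" where
  "mollify n = conv (mollifier (1 / Suc n))"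

definition mollify_tends :: "nat \<Rightarrow> ('a::euclidean_space \<Rightarrow> real) \<Rightarrow> ('a \<Rightarrow> 'b::euclidean_space) \<Rightarrow> bool" where
  "mollify_tends p w f \<longleftrightarrow> ((\<lambda>n. energy p w (\<lambda>x. mollify n f x - f x)) \<longlonglongrightarrow> 0)"

lemma ennreal_tendsto_0I:
  fixes X :: "nat \<Rightarrow> ennreal"
  assumes "\<And>e::real. e > 0 \<Longrightarrow> \<forall>\<^sub>F n in sequentially. X n \<le> ennreal e"
  shows "X \<longlonglongrightarrow> 0"
proof (rule order_tendstoI)
  fix a :: ennreal assume "0 < a"
  then obtain b where b: "0 < b" "b < a" using dense by blast
  then have "b < top" using order.strict_trans2 top_greatest by blast
  then obtain e where e: "b = ennreal e" "e \<ge> 0" by (cases b) auto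
  with b have "e > 0" by auto
  from assms[OF this] show "\<forall>\<^sub>F n in sequentially. X n < a"
    by eventually_elim (use b e in auto)
qed auto

lemma ennreal_tendsto_0_le:
  fixes X :: "nat \<Rightarrow> ennreal"
  assumes "X \<longlonglongrightarrow> 0" "e > 0"
  shows "\<forall>\<^sub>F n in sequentially. X n \<le> ennreal e"
  using order_tendstoD(2)[OF assms(1), of "ennreal e"] assms(2)
  by (auto elim: eventually_mono)

lemma ennreal_squeeze_0:
  fixes X Y :: "nat \<Rightarrow> ennreal"
  assumes "Y \<longlonglongrightarrow> 0" "\<And>n. X n \<le> Y n"
  shows "X \<longlonglongrightarrow> 0"
  by (rule tendsto_sandwich[OF _ _ tendsto_const assms(1)]) (simp_all add: assms(2))

text \<open>A density argument: \<open>energy_conv\<close> bounds mollification uniformly in n (all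
  scales are at most 1), so convergence passes from arbitrarily close f' to
  \<open>f\<close>.\<close>

lemma mollify_tends_closure:
  fixes f :: "'a::euclidean_space \<Rightarrow> 'b::euclidean_space"
  assumes w: "slow_weight C w" and p: "p \<ge> 1" and f: "loc_int f"
    and approx: "\<And>e::real. e > 0 \<Longrightarrow> \<exists>f'. loc_int f' \<and> energy p w (\<lambda>x. f x - f' x) \<le> ennreal e \<and> mollify_tends p w f'"
  shows "mollify_tends p w f"
  unfolding mollify_tends_def
proof (rule ennreal_tendsto_0I)
  have wm [measurable]: "w \<in> borel_measurable borel" and w0: "\<And>x. w x \<ge> 0" and C: "C \<ge> 0"
    using w order_trans[of 0 "w 0" C] by (auto simp: slow_weight_def)
  fix e :: real assume e: "e > 0"
  \<comment> \<open>Two nested triangle inequalities, through \<open>mollify n f'\<close> and then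
    f', cost a factor 2 ^ p each; the three distances are at most C d, d and d.\<close>
  define K :: real where "K = 2 ^ p * (C + 2 ^ p * 2)"
  have K: "K > 0" unfolding K_def using C by (intro mult_pos_pos add_nonneg_pos) auto
  define d where "d = e / K"
  have d: "d > 0" using e K by (simp add: d_def)
  obtain f' where f': "loc_int f'" "energy p w (\<lambda>x. f x - f' x) \<le> ennreal d" "mollify_tends p w f'"
    using approx[OF d] by blast
  note [measurable] = loc_int_borel[OF f] loc_int_borel[OF f'(1)]
  have [measurable]: "mollify n f \<in> borel_measurable borel" "mollify n f' \<in> borel_measurable borel" for n
    unfolding mollify_def by (rule conv_borel; measurable)+
  have "\<forall>\<^sub>F n in sequentially. energy p w (\<lambda>x. mollify n f' x - f' x) \<le> ennreal d"
    using f'(3) d unfolding mollify_tends_def by (rule ennreal_tendsto_0_le)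
  then show "\<forall>\<^sub>F n in sequentially. energy p w (\<lambda>x. mollify n f x - f x) \<le> ennreal e"
  proof eventually_elim
    case (elim n)
    have "energy p w (\<lambda>x. mollify n f x - mollify n f' x) \<le> ennreal C * energy p w (\<lambda>x. f x - f' x)"
      using energy_conv[OF w _ _ loc_int_diff[OF f f'(1)] p, of "1 / Suc n"]
      by (simp add: mollify_def conv_diff[OF _ f f'(1)] del: of_nat_Suc)
    also have "\<dots> \<le> ennreal C * ennreal d" by (intro mult_left_mono f') auto
    finally have 1: "energy p w (\<lambda>x. mollify n f x - mollify n f' x) \<le> ennreal C * ennreal d" .
    have "energy p w (\<lambda>x. mollify n f' x - f x)
        \<le> 2 ^ p * (energy p w (\<lambda>x. mollify n f' x - f' x) + energy p w (\<lambda>x. f' x - f x))"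
      by (rule energy_triangle; (rule w0 | measurable))
    also have "\<dots> \<le> 2 ^ p * (ennreal d + ennreal d)"
      using f'(2) elim by (intro mult_left_mono add_mono) (auto simp: energy_minus_commute[of p w f' f])
    finally have 2: "energy p w (\<lambda>x. mollify n f' x - f x) \<le> 2 ^ p * (ennreal d + ennreal d)" .
    have "energy p w (\<lambda>x. mollify n f x - f x)
        \<le> 2 ^ p * (energy p w (\<lambda>x. mollify n f x - mollify n f' x) + energy p w (\<lambda>x. mollify n f' x - f x))"
      by (rule energy_triangle; (rule w0 | measurable))
    also have "\<dots> \<le> 2 ^ p * (ennreal C * ennreal d + 2 ^ p * (ennreal d + ennreal d))"
      by (intro mult_left_mono add_mono 1 2) auto
    also have "\<dots> = ennreal (K * d)"
    proof -
      have "(2::ennreal) ^ p = ennreal (2 ^ p)" by (simp flip: ennreal_power)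
      moreover have "K * d = 2 ^ p * (C * d + 2 ^ p * (d + d))" by (simp add: K_def algebra_simps)
      ultimately show ?thesis using C d by (simp add: ennreal_mult ennreal_plus mult_2[of "ennreal d"] del: ennreal_power)
    qed
    also have "K * d = e" using K by (simp add: d_def)
    finally show ?case .
  qed
qed

lemma slow_weight_1: "slow_weight 1 (\<lambda>_::'a::euclidean_space. 1)"
  by (simp add: slow_weight_def)

text \<open>With \<open>h n\<close> the mollified indicator \<open>u\<close> of \<open>U\<close>, the identity \<open>\<bar>h n - u\<bar> = h n + u - 2 * h n * u\<close> reduces
  convergence in mean to dominated convergence of \<open>h n * u\<close>.\<close>

lemma mollify_tends_open:
  fixes U :: "'a::euclidean_space set" and c :: "'b::euclidean_space"
  assumes U: "open U" and fin: "emeasure lborel U < \<infinity>"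
  shows "mollify_tends 1 (\<lambda>_. 1) (\<lambda>x. indicator U x *\<^sub>R c)"
proof -
  have [measurable]: "U \<in> sets borel" using U by simp
  define u :: "'a \<Rightarrow> real" where "u = indicator U"
  have um [measurable]: "u \<in> borel_measurable borel" unfolding u_def by measurable
  have iu: "integrable lborel u" unfolding u_def using fin by (intro integrable_real_indicator) auto
  note lu = loc_int_integrable[OF iu]
  define h where "h n = mollify n u" for n
  have hm [measurable]: "h n \<in> borel_measurable borel" for n
    unfolding h_def mollify_def by (rule conv_borel) fact
  have r: "0 < 1 / real (Suc n)" "1 / real (Suc n) \<le> 1" for n by auto
  have h0: "h n x \<ge> 0" for n x
    unfolding h_def mollify_def conv_def u_def using mollifier(2)[OF r(1), where 'a='a]
    by (intro Bochner_Integration.integral_nonneg) (auto intro!: mult_nonneg_nonneg)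
  have h1: "h n x \<le> 1" for n x
  proof -
    have "h n x \<le> (\<integral>y. mollifier (1 / Suc n) (x - y) \<partial>lborel)"
      unfolding h_def mollify_def conv_def
      using integrable_mollifier[OF r(1)[of n] lu, of x] mollifier(2)[OF r(1)[of n], where 'a='a]
      by (intro integral_mono integral_mollifier r(1)) (auto simp: u_def indicator_def)
    also have "\<dots> = 1" by (rule integral_mollifier(2)[OF r(1)])
    finally show ?thesis .
  qed
  \<comment> \<open>Openness of \<open>U\<close> enters here: once the support of the kernel around
    x fits into \<open>U\<close>, the average of the indicator is exactly 1.\<close>
  have hU: "\<forall>\<^sub>F n in sequentially. h n x = 1" if x: "x \<in> U" for x
  proof -
    obtain e where e: "e > 0" "ball x e \<subseteq> U" using U x unfolding open_contains_ball by blast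
    have "\<forall>\<^sub>F n in sequentially. 1 / real (Suc n) < e"
      using LIMSEQ_inverse_real_of_nat e(1) by (auto simp: inverse_eq_divide dest: order_tendstoD(2))
    then show ?thesis
    proof eventually_elim
      case (elim n)
      have "mollifier (1 / Suc n) (x - y) * u y = mollifier (1 / Suc n) (x - y)" for y
      proof (cases "y \<in> ball x e")
        case True
        then show ?thesis using e by (auto simp: u_def)
      next
        case False
        then have "mollifier (1 / Suc n) (x - y) = 0"
          using elim by (intro mollifier(3) r(1)) (auto simp: dist_norm)
        then show ?thesis by simp
      qed
      then show ?case
        using integral_mollifier(2)[OF r(1)[of n], of x]
        by (simp only: h_def mollify_def conv_def real_scaleR_def)
    qed
  qed
  have en: "energy 1 (\<lambda>_. 1) (h n) \<le> energy 1 (\<lambda>_. 1) u" for n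
    using energy_conv[OF slow_weight_1 r lu, of 1 n] by (simp add: h_def mollify_def)
  have "energy 1 (\<lambda>_. 1) u < \<infinity>"
    using fin by (simp add: energy_def u_def ennreal_indicator)
  with en have "energy 1 (\<lambda>_. 1) (h n) < \<infinity>" for n by (rule le_less_trans)
  then have ih: "integrable lborel (h n)" for n
    by (intro integrableI_nonneg) (use h0 in \<open>auto simp: energy_def\<close>)
  \<comment> \<open>Mollification does not increase the mass (\<open>energy_conv\<close> with
    constant 1). This replaces the integral of \<open>h n\<close> by that of \<open>u\<close> in the
    final bound, whose limit is then 0.\<close>
  have "ennreal (\<integral>x. h n x \<partial>lborel) \<le> ennreal (\<integral>x. u x \<partial>lborel)" for n
    using en[of n] h0 iu ih by (simp add: energy_def nn_integral_eq_integral u_def)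
  then have hu: "(\<integral>x. h n x \<partial>lborel) \<le> (\<integral>x. u x \<partial>lborel)" for n
    by (subst (asm) ennreal_le_iff) (auto simp: u_def)
  have ihu: "integrable lborel (\<lambda>x. h n x * u x)" for n
    by (rule Bochner_Integration.integrable_bound[OF ih]) (auto simp: u_def indicator_def)
  have lim: "(\<lambda>n. \<integral>x. h n x * u x \<partial>lborel) \<longlonglongrightarrow> (\<integral>x. u x \<partial>lborel)"
  proof (rule integral_dominated_convergence[where w = u])
    show "AE x in lborel. (\<lambda>n. h n x * u x) \<longlonglongrightarrow> u x"
    proof (rule AE_I2)
      fix x
      show "(\<lambda>n. h n x * u x) \<longlonglongrightarrow> u x"
      proof (cases "x \<in> U")
        case True
        then show ?thesis using hU[OF True]
          by (intro tendsto_eventually) (auto elim!: eventually_mono)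
      qed (simp add: u_def)
    qed
  qed (use h0 h1 iu in \<open>auto simp: u_def indicator_def\<close>)
  have bound: "energy 1 (\<lambda>_. 1) (\<lambda>x. mollify n (\<lambda>x. indicator U x *\<^sub>R c) x - indicator U x *\<^sub>R c)
     \<le> ennreal (norm c * (2 * (\<integral>x. u x \<partial>lborel) - 2 * (\<integral>x. h n x * u x \<partial>lborel)))" for n
  proof -
    have "mollify n (\<lambda>x. indicator U x *\<^sub>R c) x = h n x *\<^sub>R c" for x
      unfolding h_def mollify_def conv_def u_def using integrable_mollifier[OF r(1)[of n] lu, of x]
      by (simp add: u_def)
    then have "energy 1 (\<lambda>_. 1) (\<lambda>x. mollify n (\<lambda>x. indicator U x *\<^sub>R c) x - indicator U x *\<^sub>R c)
      = (\<integral>\<^sup>+x. ennreal (norm c * (h n x + u x - 2 * (h n x * u x))) \<partial>lborel)"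
      using h0 h1 unfolding energy_def
      by (intro nn_integral_cong) (auto simp: u_def indicator_def scaleR_left_diff_distrib[symmetric] norm_minus_commute mult.commute
          simp flip: scaleR_left_diff_distrib[of _ 1, simplified])
    also have "\<dots> = ennreal (\<integral>x. norm c * (h n x + u x - 2 * (h n x * u x)) \<partial>lborel)"
    proof (rule nn_integral_eq_integral)
      show "integrable lborel (\<lambda>x. norm c * (h n x + u x - 2 * (h n x * u x)))"
        using ih ihu iu by simp
    qed (use h0 h1 in \<open>auto simp: u_def indicator_def\<close>)
    also have "(\<integral>x. norm c * (h n x + u x - 2 * (h n x * u x)) \<partial>lborel)
       = norm c * ((\<integral>x. h n x \<partial>lborel) + (\<integral>x. u x \<partial>lborel) - 2 * (\<integral>x. h n x * u x \<partial>lborel))"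
      using ih ihu iu by simp
    finally show ?thesis using hu[of n] by (auto intro!: ennreal_leI mult_left_mono)
  qed
  have "(\<lambda>n. norm c * (2 * (\<integral>x. u x \<partial>lborel) - 2 * (\<integral>x. h n x * u x \<partial>lborel)))
      \<longlonglongrightarrow> norm c * (2 * (\<integral>x. u x \<partial>lborel) - 2 * (\<integral>x. u x \<partial>lborel))"
    by (intro tendsto_intros lim)
  from tendsto_ennrealI[OF this]
  show ?thesis
    unfolding mollify_tends_def by (intro ennreal_squeeze_0[OF _ bound]) simp
qed

lemma mollify_tends_add:
  fixes f g :: "'a::euclidean_space \<Rightarrow> 'b::euclidean_space"
  assumes "loc_int f" "loc_int g" "mollify_tends 1 (\<lambda>_. 1) f" "mollify_tends 1 (\<lambda>_. 1) g"
  shows "mollify_tends 1 (\<lambda>_. 1) (\<lambda>x. f x + g x)"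
proof -
  note [measurable] = loc_int_borel[OF assms(1)] loc_int_borel[OF assms(2)]
  have m: "mollify n f \<in> borel_measurable borel" "mollify n g \<in> borel_measurable borel" for n
    unfolding mollify_def by (rule conv_borel; measurable)+
  note [measurable] = this
  have "mollify n (\<lambda>x. f x + g x) x = mollify n f x + mollify n g x" for n x
    unfolding mollify_def conv_def scaleR_add_right
    using assms by (intro Bochner_Integration.integral_add integrable_mollifier) auto
  then have le: "energy 1 (\<lambda>_. 1) (\<lambda>x. mollify n (\<lambda>x. f x + g x) x - (f x + g x))
     \<le> 2 ^ 1 * (energy 1 (\<lambda>_. 1) (\<lambda>x. mollify n f x - f x) + energy 1 (\<lambda>_. 1) (\<lambda>x. mollify n g x - g x))" for n
    using energy_add[of "\<lambda>x. mollify n f x - f x" "\<lambda>x. mollify n g x - g x" "\<lambda>_. 1" 1]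
    by (simp add: add_diff_add)
  have lim: "(\<lambda>n. 2 ^ 1 * (energy 1 (\<lambda>_. 1) (\<lambda>x. mollify n f x - f x) + energy 1 (\<lambda>_. 1) (\<lambda>x. mollify n g x - g x)))
      \<longlonglongrightarrow> 2 ^ 1 * (0 + 0)"
    using assms(3,4) unfolding mollify_tends_def
    by (intro ennreal_tendsto_cmult tendsto_add) auto
  show ?thesis
    unfolding mollify_tends_def by (rule ennreal_squeeze_0[OF _ le]) (use lim in simp)
qed

text \<open>Induction over integrable functions: outer regularity reduces indicators to those of
  open sets, and \<open>mollify_tends_closure\<close> justifies this reduction as well as the
  passage to limits.\<close>

lemma mollify_tends_L1:
  fixes f :: "'a::euclidean_space \<Rightarrow> 'b::euclidean_space"
  assumes "integrable lborel f"
  shows "mollify_tends 1 (\<lambda>_. 1) f"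
  using assms
proof (induction rule: integrable_induct)
  case (base A c)
  have [measurable]: "A \<in> sets borel" using base by simp
  show ?case
  proof (rule mollify_tends_closure[OF slow_weight_1])
    show "loc_int (\<lambda>x. indicator A x *\<^sub>R c)"
      using base by (intro loc_int_integrable) auto
    fix e :: real assume e: "e > 0"
    \<comment> \<open>The summand 1 takes care of \<open>c = 0\<close>.\<close>
    define d where "d = e / (norm c + 1)"
    have d: "d > 0" using e norm_ge_zero[of c] unfolding d_def by (intro divide_pos_pos) linarith+
    obtain U where U: "open U" "A \<subseteq> U" "emeasure lborel (U - A) < ennreal d"
      using outer_regular_lborel[of A d] d by auto
    have [measurable]: "U \<in> sets borel" using U by simp
    have "emeasure lborel U \<le> emeasure lborel A + emeasure lborel (U - A)"
      using emeasure_subadditive[of A lborel "U - A"] U(2) by (simp add: Un_absorb1)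
    also have "\<dots> < \<infinity>" using base(2) U(3) order.strict_trans[OF U(3) ennreal_less_top] by simp
    finally have fin: "emeasure lborel U < \<infinity>" .
    have "energy 1 (\<lambda>_. 1) (\<lambda>x. indicator A x *\<^sub>R c - indicator U x *\<^sub>R c)
        = (\<integral>\<^sup>+x. ennreal (norm c) * indicator (U - A) x \<partial>lborel)"
      unfolding energy_def using U(2) by (intro nn_integral_cong) (auto simp: indicator_def)
    also have "\<dots> = ennreal (norm c) * emeasure lborel (U - A)"
      by (simp add: nn_integral_cmult_indicator)
    also have "\<dots> \<le> ennreal (norm c) * ennreal d"
      using U(3) by (intro mult_left_mono) auto
    also have "\<dots> = ennreal (norm c * d)" using d by (simp add: ennreal_mult)
    also have "\<dots> \<le> ennreal e"
    proof (rule ennreal_leI)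
      have "norm c * d \<le> (norm c + 1) * d" using d by (intro mult_right_mono) auto
      also have "\<dots> = e"
        using norm_ge_zero[of c] by (simp add: d_def add_nonneg_eq_0_iff)
      finally show "norm c * d \<le> e" by (simp add: mult.commute)
    qed
    finally have "energy 1 (\<lambda>_. 1) (\<lambda>x. indicator A x *\<^sub>R c - indicator U x *\<^sub>R c) \<le> ennreal e" .
    then show "\<exists>f'. loc_int f' \<and> energy 1 (\<lambda>_. 1) (\<lambda>x. indicator A x *\<^sub>R c - f' x) \<le> ennreal e \<and> mollify_tends 1 (\<lambda>_. 1) f'"
      using fin U(1) mollify_tends_open[OF U(1) fin, of c]
      by (intro exI[of _ "\<lambda>x. indicator U x *\<^sub>R c"]) (auto intro!: loc_int_integrable)
  qed simp
next
  case (add f g)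
  then show ?case by (intro mollify_tends_add loc_int_integrable)
next
  case (lim f s)
  note [measurable] = borel_measurable_integrable[OF lim.hyps(4), simplified] borel_measurable_integrable[OF lim.hyps(1), simplified]
  have conv: "(\<lambda>n. \<integral>\<^sup>+x. ennreal (norm (f x - s n x)) \<partial>lborel) \<longlonglongrightarrow> (\<integral>\<^sup>+x. 0 \<partial>(lborel::'a measure))"
  proof (rule nn_integral_dominated_convergence[where w = "\<lambda>x. ennreal (3 * norm (f x))"])
    \<comment> \<open>The induction rule supplies approximations with
      \<open>norm (s n x) \<le> 2 * norm (f x)\<close>, whence 3 = 1 + 2.\<close>
    have "norm (f x - s n x) \<le> 3 * norm (f x)" for n x
      using lim.hyps(3)[of x n] norm_triangle_ineq4[of "f x" "s n x"] by simp
    then show "AE x in lborel. ennreal (norm (f x - s n x)) \<le> ennreal (3 * norm (f x))" for n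
      by (simp add: ennreal_leI)
    show "(\<integral>\<^sup>+x. ennreal (3 * norm (f x)) \<partial>lborel) < \<infinity>"
      using lim.hyps(4) by (subst nn_integral_eq_integral) auto
    have "(\<lambda>n. ennreal (norm (f x - s n x))) \<longlonglongrightarrow> ennreal (norm (f x - f x))" for x
      using lim.hyps(2)[of x] by (intro tendsto_intros) auto
    then show "AE x in lborel. (\<lambda>n. ennreal (norm (f x - s n x))) \<longlonglongrightarrow> 0" by simp
  qed auto
  show ?case
  proof (rule mollify_tends_closure[OF slow_weight_1 _ loc_int_integrable[OF lim.hyps(4)]])
    fix e :: real assume "e > 0"
    have "\<forall>\<^sub>F n in sequentially. (\<integral>\<^sup>+x. ennreal (norm (f x - s n x)) \<partial>lborel) \<le> ennreal e"
      using conv \<open>e > 0\<close> by (intro ennreal_tendsto_0_le) auto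
    then obtain n where "(\<integral>\<^sup>+x. ennreal (norm (f x - s n x)) \<partial>lborel) \<le> ennreal e"
      by (auto simp: eventually_sequentially)
    then show "\<exists>f'. loc_int f' \<and> energy 1 (\<lambda>_. 1) (\<lambda>x. f x - f' x) \<le> ennreal e \<and> mollify_tends 1 (\<lambda>_. 1) f'"
      using lim.hyps(1) lim.IH by (intro exI[of _ "s n"]) (auto simp: energy_def loc_int_integrable)
  qed simp
qed

text \<open>Averages of values bounded by \<open>k\<close> are bounded by \<open>k\<close>, so the
  error is at most 2 k and its p-th power at most (2 k)^(p - 1) times the error itself. With the
  upper bound of the weight this reduces the claim to unweighted L^1 convergence.\<close>

lemma mollify_tends_bounded:
  fixes f :: "'a::euclidean_space \<Rightarrow> 'b::euclidean_space"
  assumes w: "slow_weight C w" and p: "p \<ge> 1"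
    and f: "integrable lborel f" and k: "\<And>x. norm (f x) \<le> k"
  shows "mollify_tends p w f"
proof -
  have wm [measurable]: "w \<in> borel_measurable borel" and w0: "\<And>x. w x \<ge> 0" and wC: "\<And>x. w x \<le> C"
    using w by (auto simp: slow_weight_def)
  have C: "C \<ge> 0" using w0 wC order_trans by blast
  have k0: "k \<ge> 0" using k[of 0] norm_ge_zero order_trans by blast
  obtain q where q: "p = Suc q" using p by (cases p) auto
  have r: "0 < 1 / real (Suc n)" for n by auto
  note [measurable] = borel_measurable_integrable[OF f, simplified] 
  note lf = loc_int_integrable[OF f]
  have [measurable]: "mollify n f \<in> borel_measurable borel" for n
    unfolding mollify_def by (rule conv_borel) measurable
  have mk: "norm (mollify n f x) \<le> k" for n x
  proof -
    let ?m = "\<lambda>y. mollifier (1 / Suc n) (x - y)"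
    have "norm (mollify n f x) \<le> (\<integral>y. norm (?m y *\<^sub>R f y) \<partial>lborel)"
      unfolding mollify_def conv_def by (rule integral_norm_bound)
    also have "\<dots> \<le> (\<integral>y. ?m y * k \<partial>lborel)"
    proof (rule integral_mono)
      show "norm (?m y *\<^sub>R f y) \<le> ?m y * k" for y
        using mollifier(2)[OF r, where 'a='a] k by (simp add: mult_left_mono del: of_nat_Suc)
    qed (intro integrable_norm integrable_mult_left integrable_mollifier integral_mollifier(1) r lf)+
    also have "\<dots> = k" by (simp add: integral_mollifier[OF r] del: of_nat_Suc)
    finally show ?thesis .
  qed
  define K where "K = (2 * k) ^ q * C"
  have K: "K \<ge> 0" using C k0 by (simp add: K_def)
  have le: "energy p w (\<lambda>x. mollify n f x - f x) \<le> ennreal K * energy 1 (\<lambda>_. 1) (\<lambda>x. mollify n f x - f x)" for n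
  proof -
    have "energy p w (\<lambda>x. mollify n f x - f x) \<le> (\<integral>\<^sup>+x. ennreal K * ennreal (norm (mollify n f x - f x)) \<partial>lborel)"
      unfolding energy_def
    proof (rule nn_integral_mono)
      fix x
      let ?d = "norm (mollify n f x - f x)"
      have "?d \<le> 2 * k" using norm_triangle_ineq4[of "mollify n f x" "f x"] mk[of n x] k[of x] by simp
      then have "?d ^ q * ?d * w x \<le> (2 * k) ^ q * ?d * C"
        using w0 wC k0 by (intro mult_mono power_mono) auto
      then have "ennreal (?d ^ p * w x) \<le> ennreal (K * ?d)"
        by (intro ennreal_leI) (simp add: q K_def mult_ac)
      then show "ennreal (?d ^ p * w x) \<le> ennreal K * ennreal ?d"
        using K by (simp add: ennreal_mult)
    qed
    also have "\<dots> = ennreal K * energy 1 (\<lambda>_. 1) (\<lambda>x. mollify n f x - f x)"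
      unfolding energy_def by (simp add: nn_integral_cmult)
    finally show ?thesis .
  qed
  have lim: "(\<lambda>n. ennreal K * energy 1 (\<lambda>_. 1) (\<lambda>x. mollify n f x - f x)) \<longlonglongrightarrow> ennreal K * 0"
    using mollify_tends_L1[OF f] unfolding mollify_tends_def by (intro ennreal_tendsto_cmult) auto
  show ?thesis
    unfolding mollify_tends_def by (rule ennreal_squeeze_0[OF _ le]) (use lim in simp)
qed

text \<open>Truncation in space and in value at once gives bounded integrable functions. They
  converge in energy with \<open>norm (f x) ^ p * w x\<close> as majorant, and
  \<open>mollify_tends_closure\<close> does the rest.\<close>

theorem mollify_tends_weighted:
  fixes f :: "'a::euclidean_space \<Rightarrow> 'b::euclidean_space"
  assumes w: "slow_weight C w" and p: "p \<ge> 1" and f: "loc_int f" and fin: "energy p w f < \<infinity>"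
  shows "mollify_tends p w f"
proof (rule mollify_tends_closure[OF w p f])
  have wm [measurable]: "w \<in> borel_measurable borel" and w0: "\<And>x. w x \<ge> 0"
    using w by (auto simp: slow_weight_def)
  note [measurable] = loc_int_borel[OF f]
  define s where "s k x = (if norm x \<le> real k \<and> norm (f x) \<le> real k then f x else 0)" for k x
  have sm [measurable]: "s k \<in> borel_measurable borel" for k unfolding s_def by measurable
  have si: "integrable lborel (s k)" for k
  proof (rule Bochner_Integration.integrable_bound)
    show "integrable lborel (\<lambda>x. indicator (cball 0 (real k)) x *\<^sub>R f x)" using f by (simp add: loc_int_def)
  qed (auto simp: s_def)
  have s_ev: "\<forall>\<^sub>F k in sequentially. s k x = f x" for x
  proof -
    have "\<forall>\<^sub>F k in sequentially. max (norm (f x)) (norm x) \<le> real k"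
      using eventually_ge_at_top[of "nat \<lceil>max (norm (f x)) (norm x)\<rceil>"] by eventually_elim linarith
    then show ?thesis by eventually_elim (simp add: s_def)
  qed
  have conv: "(\<lambda>k. energy p w (\<lambda>x. f x - s k x)) \<longlonglongrightarrow> (\<integral>\<^sup>+x. 0 \<partial>(lborel::'a measure))"
    unfolding energy_def
  proof (rule nn_integral_dominated_convergence[where w = "\<lambda>x. ennreal (norm (f x) ^ p * w x)"])
    show "AE x in lborel. ennreal (norm (f x - s k x) ^ p * w x) \<le> ennreal (norm (f x) ^ p * w x)" for k
      using w0 by (intro AE_I2 ennreal_leI mult_right_mono power_mono) (auto simp: s_def indicator_def)
    show "(\<integral>\<^sup>+x. ennreal (norm (f x) ^ p * w x) \<partial>lborel) < \<infinity>"
      using fin by (simp add: energy_def)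
    show "AE x in lborel. (\<lambda>k. ennreal (norm (f x - s k x) ^ p * w x)) \<longlonglongrightarrow> 0"
    proof (intro AE_I2 tendsto_eventually)
      fix x
      show "\<forall>\<^sub>F k in sequentially. ennreal (norm (f x - s k x) ^ p * w x) = 0"
        by (rule eventually_mono[OF s_ev[of x]]) (use p in \<open>simp add: power_0_left\<close>)
    qed
  qed auto
  fix e :: real assume "e > 0"
  have "\<forall>\<^sub>F k in sequentially. energy p w (\<lambda>x. f x - s k x) \<le> ennreal e"
    using conv \<open>e > 0\<close> by (intro ennreal_tendsto_0_le) auto
  then obtain k where "energy p w (\<lambda>x. f x - s k x) \<le> ennreal e"
    by (auto simp: eventually_sequentially)
  moreover have "mollify_tends p w (s k)"
    by (rule mollify_tends_bounded[OF w p si, where k = "real k"]) (auto simp: s_def indicator_def)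
  ultimately show "\<exists>f'. loc_int f' \<and> energy p w (\<lambda>x. f x - f' x) \<le> ennreal e \<and> mollify_tends p w f'"
    using loc_int_integrable[OF si] by blast
qed

section \<open>Approximation by test functions\<close>

text \<open>The mollifications of both candidates are the classical gradient of the mollified
  \<open>u\<close>, so their difference mollifies to 0 at every scale, and L^1 convergence forces it
  to vanish. That convergence needs integrability on the whole space, hence the truncation to
  balls.\<close>

lemma weak_gradient_unique:
  fixes g h :: "'a::euclidean_space \<Rightarrow> 'a"
  assumes g: "weak_gradient u g" and h: "weak_gradient u h"
  shows "AE x in lborel. g x = h x"
proof -
  have lg: "loc_int g" "loc_int h" using g h by (auto simp: weak_gradient_def)
  define d where "d x = g x - h x" for x
  have ld: "loc_int d" unfolding d_def by (intro loc_int_diff lg)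
  note dm [measurable] = loc_int_borel[OF ld]
  have r: "0 < 1 / real (Suc n)" for n by simp
  have z: "mollify n d = (\<lambda>x. 0)" for n
    unfolding mollify_def d_def conv_diff[OF r lg]
    using grad_conv[OF g mollifier(1)[OF r]] grad_conv[OF h mollifier(1)[OF r]] by (metis diff_self)
  have ae: "AE x in lborel. norm x \<le> real k \<longrightarrow> d x = 0" for k
  proof -
    \<comment> \<open>The kernels have radius at most 1, so at points of norm at most k
      mollification does not notice a truncation at radius k + 1.\<close>
    define e where "e x = indicator (cball 0 (real k + 1)) x *\<^sub>R d x" for x
    have ei: "integrable lborel e" using ld unfolding e_def loc_int_def by blast
    note [measurable] = borel_measurable_integrable[OF ei, simplified]
    have [measurable]: "cball 0 (real k) \<in> sets (borel :: 'a measure)" by simp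
    have ez: "mollify n e x = 0" if "norm x \<le> real k" for n x
    proof -
      have "mollifier (1 / Suc n) (x - y) *\<^sub>R e y = mollifier (1 / Suc n) (x - y) *\<^sub>R d y" for y
      proof (cases "norm y \<le> real k + 1")
        case False
        then have "norm (x - y) \<ge> 1" using that norm_triangle_ineq2[of y x] by (simp add: norm_minus_commute)
        then have "norm (x - y) \<ge> 1 / Suc n" by (rule order_trans[rotated]) simp
        then show ?thesis using mollifier(3)[OF r, of n "x - y"] by (simp del: of_nat_Suc)
      qed (simp add: e_def)
      then have "mollify n e x = mollify n d x" by (simp only: mollify_def conv_def)
      then show ?thesis by (simp add: z)
    qed
    have "(\<integral>\<^sup>+x. indicator (cball 0 (real k)) x * ennreal (norm (d x)) \<partial>lborel)
        \<le> energy 1 (\<lambda>_. 1) (\<lambda>x. mollify n e x - e x)" for n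
      unfolding energy_def
      by (intro nn_integral_mono) (auto simp: ez e_def indicator_def)
    moreover have "(\<lambda>n. energy 1 (\<lambda>_. 1) (\<lambda>x. mollify n e x - e x)) \<longlonglongrightarrow> 0"
      using mollify_tends_L1[OF ei] by (simp add: mollify_tends_def)
    ultimately have "(\<integral>\<^sup>+x. indicator (cball 0 (real k)) x * ennreal (norm (d x)) \<partial>lborel) \<le> 0"
      by (intro LIMSEQ_le_const) auto
    then have "AE x in lborel. indicator (cball 0 (real k)) x * ennreal (norm (d x)) = 0"
      by (subst (asm) le_zero_eq, subst (asm) nn_integral_0_iff_AE) auto
    then show ?thesis by eventually_elim (auto simp: indicator_def)
  qed
  then have "AE x in lborel. \<forall>k::nat. norm x \<le> real k \<longrightarrow> d x = 0" by (subst AE_all_countable) blast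
  then show ?thesis
  proof eventually_elim
    case (elim x)
    then show ?case using real_arch_simple[of "norm x"] by (auto simp: d_def)
  qed
qed

text \<open>The factor 2 accommodates differences between \<open>F\<close> and a modification of it
  that is nowhere larger in norm.\<close>

lemma energy_dominated:
  fixes f :: "nat \<Rightarrow> 'a::euclidean_space \<Rightarrow> 'b::euclidean_space" and F :: "'a \<Rightarrow> 'c::euclidean_space"
  assumes [measurable]: "\<And>n. f n \<in> borel_measurable borel" "F \<in> borel_measurable borel" "w \<in> borel_measurable borel"
    and w: "\<And>x. w x \<ge> 0" and p: "p \<ge> 1"
    and le: "\<And>n x. norm (f n x) \<le> 2 * norm (F x)" and fin: "energy p w F < \<infinity>"
    and lim: "\<And>x. (\<lambda>n. f n x) \<longlonglongrightarrow> 0"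
  shows "(\<lambda>n. energy p w (f n)) \<longlonglongrightarrow> 0"
proof -
  have "(\<lambda>n. energy p w (f n)) \<longlonglongrightarrow> (\<integral>\<^sup>+x. 0 \<partial>(lborel::'a measure))"
    unfolding energy_def
  proof (rule nn_integral_dominated_convergence[where w = "\<lambda>x. ennreal (2 ^ p * (norm (F x) ^ p * w x))"])
    show "AE x in lborel. ennreal (norm (f n x) ^ p * w x) \<le> ennreal (2 ^ p * (norm (F x) ^ p * w x))" for n
    proof (intro AE_I2 ennreal_leI)
      fix x
      have "norm (f n x) ^ p * w x \<le> (2 * norm (F x)) ^ p * w x"
        by (intro mult_right_mono power_mono le w) auto
      then show "norm (f n x) ^ p * w x \<le> 2 ^ p * (norm (F x) ^ p * w x)"
        by (simp add: power_mult_distrib mult.assoc)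
    qed
    have "(\<integral>\<^sup>+x. ennreal (2 ^ p * (norm (F x) ^ p * w x)) \<partial>lborel) = ennreal (2 ^ p) * energy p w F"
      unfolding energy_def by (subst ennreal_mult') (auto simp: nn_integral_cmult)
    also have "\<dots> < \<infinity>" using fin by (simp add: ennreal_mult_less_top)
    finally show "(\<integral>\<^sup>+x. ennreal (2 ^ p * (norm (F x) ^ p * w x)) \<partial>lborel) < \<infinity>" .
    have "(\<lambda>n. ennreal (norm (f n x) ^ p * w x)) \<longlonglongrightarrow> ennreal (norm (0::'b) ^ p * w x)" for x
      by (intro tendsto_ennrealI tendsto_intros lim)
    then show "AE x in lborel. (\<lambda>n. ennreal (norm (f n x) ^ p * w x)) \<longlonglongrightarrow> 0"
      using p by (simp add: power_0_left)
  qed auto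
  then show ?thesis by simp
qed

lemma energy_mono:
  fixes f :: "'a::euclidean_space \<Rightarrow> 'b::euclidean_space" and g :: "'a \<Rightarrow> 'c::euclidean_space"
  assumes "\<And>x. norm (f x) \<le> norm (g x)" "\<And>x. w x \<ge> 0"
  shows "energy p w f \<le> energy p w g"
  unfolding energy_def using assms
  by (intro nn_integral_mono ennreal_leI mult_right_mono power_mono) auto

section \<open>Dyadic cutoff functions\<close>

lemma norm_sum_power_disjoint:
  fixes a :: "'i \<Rightarrow> 'b::real_normed_vector"
  assumes "finite I" "p \<ge> 1"
    and disj: "\<And>i j. i \<in> I \<Longrightarrow> j \<in> I \<Longrightarrow> a i \<noteq> 0 \<Longrightarrow> a j \<noteq> 0 \<Longrightarrow> i = j"
  shows "norm (\<Sum>i\<in>I. a i) ^ p = (\<Sum>i\<in>I. norm (a i) ^ p)"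
proof (cases "\<exists>i\<in>I. a i \<noteq> 0")
  case True
  then obtain i where i: "i \<in> I" "a i \<noteq> 0" by blast
  then have z: "a j = 0" if "j \<in> I - {i}" for j using disj that by blast
  \<comment> \<open>The assumption \<open>p \<ge> 1\<close> makes the vanishing terms contribute 0
    and not \<open>0 ^ 0 = 1\<close>.\<close>
  have "(\<Sum>j\<in>I. a j) = a i" "(\<Sum>j\<in>I. norm (a j) ^ p) = norm (a i) ^ p"
    using assms(1,2) i z by (simp_all add: sum.remove power_0_left)
  then show ?thesis by simp
qed (use assms in \<open>simp add: power_0_left\<close>)

text \<open>A quotient f / (f + g) of flat functions that are positive on the overlapping regions
  |x| < 2 and |x|^2 > 2. The squared inner radius 2 lies strictly between 1 and 4: the plateau is
  constant in a neighbourhood of the closed unit ball, and the denominator never vanishes.\<close>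

definition plateau :: "'a::euclidean_space \<Rightarrow> real" where
  "plateau x = bump 2 x * inverse (bump 2 x + flat_exp 1 ((norm x)\<^sup>2 - 2))"

lemma plateau_denominator: "bump 2 x + flat_exp 1 ((norm x)\<^sup>2 - 2) > 0"
proof (cases "norm x < 2")
  case True
  then show ?thesis using bump_pos_iff[of 2 x] by (auto simp: flat_exp_def intro: add_pos_nonneg)
next
  case False
  then have "(norm x)\<^sup>2 \<ge> 2\<^sup>2" by (intro power_mono) auto
  then have "flat_exp 1 ((norm x)\<^sup>2 - 2) > 0" by (simp add: flat_exp_def)
  then show ?thesis by (intro add_nonneg_pos bump_nonneg)
qed

lemma smooth_plateau: "smooth (plateau :: 'a::euclidean_space \<Rightarrow> real)"
  unfolding plateau_def[abs_def] smooth_def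
proof (intro allI C_k_mult C_k_inverse C_k_add C_k_flat_exp C_k_diff C_k_norm_square C_k_const
    smooth_bump[unfolded smooth_def, rule_format])
  show "bump 2 x + flat_exp 1 ((norm x)\<^sup>2 - 2) \<noteq> 0" for x :: 'a
    using plateau_denominator[of x] by simp
qed

lemma plateau_bounds: "0 \<le> plateau x" "plateau x \<le> 1"
proof -
  have "flat_exp 1 ((norm x)\<^sup>2 - 2) \<ge> 0" by (simp add: flat_exp_def)
  then show "0 \<le> plateau x" "plateau x \<le> 1"
    using plateau_denominator[of x] bump_nonneg[of 2 x]
    by (auto simp: plateau_def divide_simps simp flip: divide_inverse)
qed

lemma plateau_eq_1: "(norm x)\<^sup>2 < 2 \<Longrightarrow> plateau x = 1"
  using plateau_denominator[of x] by (simp add: plateau_def flat_exp_def)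

lemma plateau_eq_0: "norm x \<ge> 2 \<Longrightarrow> plateau x = 0"
  by (simp add: plateau_def bump_eq_0)

lemma grad_plateau_eq_0:
  fixes x :: "'a::euclidean_space"
  assumes "norm x \<le> 1 \<or> norm x > 2"
  shows "grad plateau x = 0"
  using assms
proof
  assume x: "norm x \<le> 1"
  have "open {y::'a. (norm y)\<^sup>2 < 2}" by (intro open_Collect_less continuous_intros)
  moreover have "x \<in> {y. (norm y)\<^sup>2 < 2}" using power_mono[OF x, of 2] by simp
  ultimately show ?thesis by (rule grad_eq_0_of_const[where c = 1]) (simp add: plateau_eq_1)
next
  assume x: "norm x > 2"
  have "open (- cball (0::'a) 2)" by (simp add: open_Compl)
  moreover have "x \<in> - cball 0 2" using x by simp
  ultimately show ?thesis by (rule grad_eq_0_of_const[where c = 0]) (simp add: plateau_eq_0)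
qed

lemma grad_plateau_bounded:
  obtains B where "B > 0" "\<And>x::'a::euclidean_space. norm (grad plateau x) \<le> B"
proof -
  have "continuous_on UNIV (grad plateau :: 'a \<Rightarrow> 'a)" by (rule smooth_continuous_grad[OF smooth_plateau])
  moreover have "grad plateau x = 0" if "norm x \<ge> 3" for x :: 'a using that by (intro grad_plateau_eq_0) auto
  ultimately show thesis using bounded_compact_support that by blast
qed

definition cutoff :: "nat \<Rightarrow> 'a::euclidean_space \<Rightarrow> real" where
  "cutoff m x = inverse (Suc m) * (\<Sum>k\<le>m. plateau ((1 / 2 ^ k) *\<^sub>R x))"

lemma smooth_scaled_plateau: "smooth (\<lambda>x. plateau (c *\<^sub>R x))"
  using smooth_affine[OF smooth_plateau, of 0 c] by simp

lemma cutoff_C0_infinity: "cutoff m \<in> C0_infinity"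
proof (rule C0_infinityI[where R = "2 ^ Suc m"])
  show "smooth (cutoff m)"
    unfolding cutoff_def[abs_def] by (intro smooth_mult smooth_const smooth_sum smooth_scaled_plateau)
  fix x :: 'a assume x: "norm x > 2 ^ Suc m"
  have "plateau ((1 / 2 ^ k) *\<^sub>R x) = 0" if "k \<le> m" for k
  proof (rule plateau_eq_0)
    have "(2::real) ^ Suc k \<le> 2 ^ Suc m" using that by (intro power_increasing) auto
    then have "2 * 2 ^ k \<le> norm x" using x unfolding power_Suc by linarith
    then show "2 \<le> norm ((1 / 2 ^ k) *\<^sub>R x)" by (simp add: field_simps)
  qed
  then show "cutoff m x = 0" by (simp add: cutoff_def)
qed

lemma cutoff_bounds: "0 \<le> cutoff m x" "cutoff m x \<le> 1"
proof -
  have "(\<Sum>k\<le>m. plateau ((1 / 2 ^ k) *\<^sub>R x)) \<le> (\<Sum>k\<le>m. 1)" by (intro sum_mono plateau_bounds)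
  then show "cutoff m x \<le> 1" by (simp add: cutoff_def field_simps)
  show "0 \<le> cutoff m x" unfolding cutoff_def by (intro mult_nonneg_nonneg sum_nonneg plateau_bounds) auto
qed

text \<open>For \<open>norm x < 2 ^ j\<close> only the first j plateaus can differ from 1 at x, so
  the average misses 1 by at most j / (m + 1).\<close>

lemma cutoff_tendsto: "(\<lambda>m. cutoff m x) \<longlonglongrightarrow> 1"
proof -
  obtain j where j: "norm x < 2 ^ j" using real_arch_pow[of 2 "norm x"] by auto
  have bd: "norm (cutoff m x - 1) \<le> real j * inverse (real (Suc m))" for m
  proof -
    have "1 - plateau ((1 / 2 ^ k) *\<^sub>R x) \<le> (if k < j then 1 else 0)" for k
    proof (cases "k < j")
      case False
      then have "norm x < 2 ^ k" using j by (meson less_le_trans not_less one_le_numeral power_increasing)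
      then have "norm ((1 / 2 ^ k) *\<^sub>R x) \<le> 1" by (simp add: field_simps)
      then have "(norm ((1 / 2 ^ k) *\<^sub>R x))\<^sup>2 \<le> 1\<^sup>2" by (rule power_mono) simp
      then have "plateau ((1 / 2 ^ k) *\<^sub>R x) = 1" by (intro plateau_eq_1) simp
      then show ?thesis using False by simp
    qed (simp add: plateau_bounds)
    then have "(\<Sum>k\<le>m. 1 - plateau ((1 / 2 ^ k) *\<^sub>R x)) \<le> (\<Sum>k\<le>m. if k < j then 1 else 0)"
      by (intro sum_mono) auto
    also have "\<dots> = real (card {k. k \<le> m \<and> k < j})" by (simp add: sum.If_cases Int_def)
    also have "\<dots> \<le> real (card {..<j})" by (intro of_nat_mono card_mono) auto
    finally have "(\<Sum>k\<le>m. 1 - plateau ((1 / 2 ^ k) *\<^sub>R x)) \<le> real j" by simp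
    then have "1 - cutoff m x \<le> real j * inverse (Suc m)"
    proof -
      have "1 - cutoff m x = (\<Sum>k\<le>m. 1 - plateau ((1 / 2 ^ k) *\<^sub>R x)) * inverse (Suc m)"
        by (simp add: cutoff_def sum_subtractf divide_simps)
      also have "\<dots> \<le> real j * inverse (Suc m)"
        using \<open>(\<Sum>k\<le>m. 1 - plateau ((1 / 2 ^ k) *\<^sub>R x)) \<le> real j\<close> by (rule mult_right_mono) simp
      finally show ?thesis .
    qed
    then show ?thesis using cutoff_bounds[of m x] by simp
  qed
  have "(\<lambda>m. real j * inverse (real (Suc m))) \<longlonglongrightarrow> 0"
    by (rule tendsto_mult_right_zero[OF LIMSEQ_inverse_real_of_nat])
  then have "(\<lambda>m. cutoff m x - 1) \<longlonglongrightarrow> 0"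
    by (rule Lim_null_comparison[OF always_eventually[OF allI[OF bd]]])
  then show ?thesis by (simp add: LIM_zero_iff)
qed

lemma grad_cutoff:
  "grad (cutoff m) x = inverse (Suc m) *\<^sub>R (\<Sum>k\<le>m. (1 / 2 ^ k) *\<^sub>R grad plateau ((1 / 2 ^ k) *\<^sub>R x))"
proof (rule grad_eqI)
  have 1: "GDERIV (\<lambda>x. plateau ((1 / 2 ^ k) *\<^sub>R x)) x :> (1 / 2 ^ k) *\<^sub>R grad plateau ((1 / 2 ^ k) *\<^sub>R x)" for k
    using GDERIV_affine[of plateau 0 "1 / 2 ^ k" x, OF smooth_GDERIV[OF smooth_plateau]] by simp
  have "GDERIV (\<lambda>x. \<Sum>k\<in>I. plateau ((1 / 2 ^ k) *\<^sub>R x)) x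
      :> (\<Sum>k\<in>I. (1 / 2 ^ k) *\<^sub>R grad plateau ((1 / 2 ^ k) *\<^sub>R x))" if "finite I" for I
    using that by (induction I) (auto intro!: GDERIV_const GDERIV_add 1)
  from GDERIV_mult[OF GDERIV_const[of "inverse (Suc m)" x] this[of "{..m}"]]
  show "GDERIV (cutoff m) x :> inverse (Suc m) *\<^sub>R (\<Sum>k\<le>m. (1 / 2 ^ k) *\<^sub>R grad plateau ((1 / 2 ^ k) *\<^sub>R x))"
    by (simp add: cutoff_def[abs_def])
qed

lemma emeasure_cball_scaled:
  "r \<ge> 0 \<Longrightarrow> emeasure lborel (cball (0::'a::euclidean_space) r)
    = ennreal (r ^ DIM('a) * measure lborel (ball (0::'a) 1))"
  using content_ball_conv_unit_ball[of r "0::'a"] emeasure_lborel_cball_finite[of "0::'a" r]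
  by (simp add: emeasure_eq_ennreal_measure content_cball_conv_ball less_top)

text \<open>The gradients of the dyadic plateaus live on disjoint annuli, and each contributes the same
  amount to the scale invariant energy; averaging \<open>m + 1\<close> of them gains the factor \<open>(m + 1) ^ (1 - p)\<close>.\<close>

lemma energy_grad_cutoff:
  fixes w :: "'a::euclidean_space \<Rightarrow> real"
  assumes [measurable]: "w \<in> borel_measurable borel" and w0: "\<And>x. w x \<ge> 0"
    and w1: "\<And>x. w x * norm x ^ (DIM('a) - p) \<le> 1" and p: "2 \<le> p" "p \<le> DIM('a)"
  shows "(\<lambda>m. energy p w (grad (cutoff m))) \<longlonglongrightarrow> 0"
proof -
  let ?N = "DIM('a)"
  obtain B where B: "B > 0" "\<And>x::'a. norm (grad plateau x) \<le> B" using grad_plateau_bounded by blast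
  define V where "V = measure lborel (ball (0::'a) 1)"
  have V0: "V \<ge> 0" by (simp add: V_def)
  define a where "a k x = (1 / 2 ^ k) *\<^sub>R grad plateau ((1 / 2 ^ k) *\<^sub>R x)" for k :: nat and x :: 'a
  have a0: "a k x = 0" if "\<not> (2 ^ k < norm x \<and> norm x \<le> 2 ^ Suc k)" for k x
  proof -
    have "norm ((1 / 2 ^ k) *\<^sub>R x) \<le> 1 \<or> norm ((1 / 2 ^ k) *\<^sub>R x) > 2"
      using that by (auto simp: field_simps)
    then show ?thesis by (simp add: a_def grad_plateau_eq_0)
  qed
  have disj: "i = j" if "a i x \<noteq> 0" "a j x \<noteq> 0" for i j x
  proof -
    have "i \<le> j" if "2 ^ i < norm x" "norm x \<le> 2 ^ Suc j" for i j
    proof -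
      have "(2::real) ^ i < 2 ^ Suc j" using that by linarith
      then show ?thesis by (subst (asm) power_strict_increasing_iff) auto
    qed
    then show ?thesis using a0[of i x] a0[of j x] that by (meson antisym)
  qed
  \<comment> \<open>On the k-th annulus the gradient is at most B / 2^k and the weight at most 2^(-k
    (N - p)). The resulting factor 2^(-k N) balances the volume of the ball of radius 2^(k + 1) up
    to the constant 2^N, so the bound for each term is independent of k.\<close>
  have ak: "norm (a k x) ^ p * w x \<le> B ^ p / 2 ^ (k * ?N) * indicator (cball (0::'a) (2 ^ Suc k)) x" for k x
  proof (cases "2 ^ k < norm x \<and> norm x \<le> 2 ^ Suc k")
    case True
    have "w x * (2 ^ k) ^ (?N - p) \<le> w x * norm x ^ (?N - p)"
      using True w0 by (intro mult_left_mono power_mono) auto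
    also have "\<dots> \<le> 1" by (rule w1)
    finally have w: "w x \<le> 1 / (2 ^ k) ^ (?N - p)" by (simp add: field_simps)
    have "norm (a k x) \<le> B / 2 ^ k" using B(2) by (simp add: a_def divide_simps)
    then have "norm (a k x) ^ p * w x \<le> (B / 2 ^ k) ^ p * (1 / (2 ^ k) ^ (?N - p))"
      using B w w0 by (intro mult_mono power_mono) auto
    also have "\<dots> = B ^ p / ((2 ^ k) ^ p * (2 ^ k) ^ (?N - p))" by (simp add: power_divide)
    also have "((2::real) ^ k) ^ p * (2 ^ k) ^ (?N - p) = 2 ^ (k * ?N)"
      using p by (simp add: power_add[symmetric] power_mult[symmetric] distrib_left[symmetric])
    finally show ?thesis using True by simp
  next
    case False
    then show ?thesis using a0[OF False] p B by (simp add: power_0_left)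
  qed
  have bound: "energy p w (grad (cutoff m)) \<le> ennreal (B ^ p * V * 2 ^ ?N * inverse (Suc m))" for m
  proof -
    have pw: "norm (grad (cutoff m) x) ^ p * w x
       \<le> inverse (Suc m) ^ p * (\<Sum>k\<le>m. B ^ p / 2 ^ (k * ?N) * indicator (cball (0::'a) (2 ^ Suc k)) x)" for x
    proof -
      have "norm (grad (cutoff m) x) ^ p = inverse (Suc m) ^ p * norm (\<Sum>k\<le>m. a k x) ^ p"
        by (simp add: grad_cutoff a_def[symmetric] power_mult_distrib)
      also have "norm (\<Sum>k\<le>m. a k x) ^ p = (\<Sum>k\<le>m. norm (a k x) ^ p)"
        using p disj by (intro norm_sum_power_disjoint) auto
      finally have "norm (grad (cutoff m) x) ^ p * w x = inverse (Suc m) ^ p * (\<Sum>k\<le>m. norm (a k x) ^ p * w x)"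
        by (simp add: sum_distrib_right mult.assoc)
      also have "\<dots> \<le> inverse (Suc m) ^ p * (\<Sum>k\<le>m. B ^ p / 2 ^ (k * ?N) * indicator (cball (0::'a) (2 ^ Suc k)) x)"
        by (intro mult_left_mono sum_mono ak) auto
      finally show ?thesis .
    qed
    have "energy p w (grad (cutoff m))
       \<le> (\<integral>\<^sup>+x. ennreal (inverse (Suc m) ^ p) * (\<Sum>k\<le>m. ennreal (B ^ p / 2 ^ (k * ?N)) * indicator (cball (0::'a) (2 ^ Suc k)) x) \<partial>lborel)"
      unfolding energy_def
    proof (rule nn_integral_mono)
      fix x :: 'a
      have "ennreal (norm (grad (cutoff m) x) ^ p * w x)
        \<le> ennreal (inverse (Suc m) ^ p * (\<Sum>k\<le>m. B ^ p / 2 ^ (k * ?N) * indicator (cball (0::'a) (2 ^ Suc k)) x))"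
        by (rule ennreal_leI[OF pw])
      also have "\<dots> = ennreal (inverse (Suc m) ^ p) * (\<Sum>k\<le>m. ennreal (B ^ p / 2 ^ (k * ?N) * indicator (cball (0::'a) (2 ^ Suc k)) x))"
        using B by (subst ennreal_mult') (auto intro!: sum_ennreal[symmetric])
      also have "\<dots> = ennreal (inverse (Suc m) ^ p) * (\<Sum>k\<le>m. ennreal (B ^ p / 2 ^ (k * ?N)) * indicator (cball (0::'a) (2 ^ Suc k)) x)"
        by (intro arg_cong2[where f = "(*)"] sum.cong) (auto simp: indicator_def)
      finally show "ennreal (norm (grad (cutoff m) x) ^ p * w x)
        \<le> ennreal (inverse (Suc m) ^ p) * (\<Sum>k\<le>m. ennreal (B ^ p / 2 ^ (k * ?N)) * indicator (cball (0::'a) (2 ^ Suc k)) x)" .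
    qed
    also have "\<dots> = ennreal (inverse (Suc m) ^ p) * (\<Sum>k\<le>m. ennreal (B ^ p / 2 ^ (k * ?N)) * emeasure lborel (cball (0::'a) (2 ^ Suc k)))"
    proof (subst nn_integral_cmult)
      have 1: "(\<lambda>x. ennreal c * indicator (cball 0 r) x) \<in> borel_measurable (lborel :: 'a measure)" for c r
        by (intro borel_measurable_times_ennreal borel_measurable_const borel_measurable_indicator) simp
      then show "(\<lambda>x. \<Sum>k\<le>m. ennreal (B ^ p / 2 ^ (k * ?N)) * indicator (cball (0::'a) (2 ^ Suc k)) x) \<in> borel_measurable lborel"
        by (intro borel_measurable_sum)
      show "ennreal (inverse (Suc m) ^ p) * (\<integral>\<^sup>+x. (\<Sum>k\<le>m. ennreal (B ^ p / 2 ^ (k * ?N)) * indicator (cball (0::'a) (2 ^ Suc k)) x) \<partial>lborel)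
        = ennreal (inverse (Suc m) ^ p) * (\<Sum>k\<le>m. ennreal (B ^ p / 2 ^ (k * ?N)) * emeasure lborel (cball (0::'a) (2 ^ Suc k)))"
        by (subst nn_integral_sum, rule 1)
          (intro arg_cong2[where f = "(*)"] sum.cong refl nn_integral_cmult_indicator, simp)
    qed
    also have "\<dots> = ennreal (inverse (Suc m) ^ p) * (\<Sum>k\<le>m. ennreal (B ^ p * V * 2 ^ ?N))"
    proof (intro arg_cong2[where f = "(*)"] sum.cong refl)
      fix k
      have "ennreal (B ^ p / 2 ^ (k * ?N)) * emeasure lborel (cball (0::'a) (2 ^ Suc k))
        = ennreal (B ^ p / 2 ^ (k * ?N) * ((2 ^ Suc k) ^ ?N * V))"
        using B by (subst emeasure_cball_scaled, simp, subst ennreal_mult'[symmetric]) (auto simp: V_def)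
      also have "((2::real) ^ Suc k) ^ ?N = 2 ^ (k * ?N) * 2 ^ ?N"
        by (simp add: power_mult power_mult_distrib)
      finally show "ennreal (B ^ p / 2 ^ (k * ?N)) * emeasure lborel (cball (0::'a) (2 ^ Suc k)) = ennreal (B ^ p * V * 2 ^ ?N)"
        by (simp add: field_simps)
    qed
    also have "\<dots> = ennreal (inverse (Suc m) ^ p * (Suc m * (B ^ p * V * 2 ^ ?N)))"
      using B V0 by (simp add: ennreal_mult ennreal_of_nat_eq_real_of_nat del: of_nat_Suc)
    also have "\<dots> \<le> ennreal (B ^ p * V * 2 ^ ?N * inverse (Suc m))"
    proof (rule ennreal_leI)
      \<comment> \<open>One factor 1 / (m + 1) is used up by the m + 1 equal summands;
        \<open>2 \<le> p\<close> leaves at least one more.\<close>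
      have "inverse (real (Suc m)) ^ p \<le> inverse (Suc m) ^ 2"
        using p by (intro power_decreasing) (auto simp: field_simps)
      then have "inverse (Suc m) ^ p * (Suc m * (B ^ p * V * 2 ^ ?N)) \<le> inverse (Suc m) ^ 2 * (Suc m * (B ^ p * V * 2 ^ ?N))"
        using B V0 by (intro mult_right_mono mult_nonneg_nonneg) auto
      also have "\<dots> = B ^ p * V * 2 ^ ?N * inverse (Suc m)"
      proof -
        have "inverse s ^ 2 * (s * K) = K * inverse s" if "s \<noteq> 0" for s K :: real
          using that by (simp add: power2_eq_square field_simps)
        then show ?thesis by simp
      qed
      finally show "inverse (Suc m) ^ p * (Suc m * (B ^ p * V * 2 ^ ?N)) \<le> B ^ p * V * 2 ^ ?N * inverse (Suc m)" .
    qed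
    finally show ?thesis .
  qed
  have "(\<lambda>m. ennreal (B ^ p * V * 2 ^ ?N * inverse (real (Suc m)))) \<longlonglongrightarrow> ennreal 0"
    by (intro tendsto_ennrealI tendsto_mult_right_zero LIMSEQ_inverse_real_of_nat)
  then show ?thesis by (intro ennreal_squeeze_0[OF _ bound]) simp
qed

section \<open>Approximable pairs of a function and a gradient\<close>

definition sobolev_dist ::
    "('a::euclidean_space \<Rightarrow> real) \<Rightarrow> ('a \<Rightarrow> real) \<Rightarrow> ('a \<Rightarrow> real) \<Rightarrow> ('a \<Rightarrow> 'a) \<Rightarrow> ('a \<Rightarrow> real) \<Rightarrow> ('a \<Rightarrow> 'a) \<Rightarrow> ennreal" where
  "sobolev_dist \<mu> \<omega> u g v h = energy 1 \<mu> (\<lambda>x. u x - v x)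
     + energy DIM('a) (\<lambda>_. 1) (\<lambda>x. g x - h x) + energy 2 \<omega> (\<lambda>x. g x - h x)"

text \<open>The gradient is a separate argument, so that the stages of the approximation never refer
  to the choice made in \<open>weak_grad\<close>. Smallness of the powers that
  \<open>sobolev_dist\<close> adds up serves as well as smallness of the norms.\<close>

definition approximable :: "('a::euclidean_space \<Rightarrow> real) \<Rightarrow> ('a \<Rightarrow> real) \<Rightarrow> ('a \<Rightarrow> real) \<Rightarrow> ('a \<Rightarrow> 'a) \<Rightarrow> bool" where
  "approximable \<mu> \<omega> u g \<longleftrightarrow>
    (\<forall>e::real>0. \<exists>\<phi>\<in>C0_infinity. sobolev_dist \<mu> \<omega> u g \<phi> (grad \<phi>) \<le> ennreal e)"

lemma sobolev_dist_triangle: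
  fixes \<mu> \<omega> :: "'a::euclidean_space \<Rightarrow> real"
  assumes [measurable]: "\<mu> \<in> borel_measurable borel" "\<omega> \<in> borel_measurable borel"
    "u1 \<in> borel_measurable borel" "u2 \<in> borel_measurable borel" "u3 \<in> borel_measurable borel"
    "g1 \<in> borel_measurable borel" "g2 \<in> borel_measurable borel" "g3 \<in> borel_measurable borel"
    and w: "\<And>x. \<mu> x \<ge> 0" "\<And>x. \<omega> x \<ge> 0" and N: "DIM('a) \<ge> 2"
  shows "sobolev_dist \<mu> \<omega> u1 g1 u3 g3
    \<le> 2 ^ DIM('a) * (sobolev_dist \<mu> \<omega> u1 g1 u2 g2 + sobolev_dist \<mu> \<omega> u2 g2 u3 g3)"
proof -
  have le: "2 ^ p * x \<le> 2 ^ DIM('a) * x" if "p \<le> DIM('a)" for p and x :: ennreal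
    using that by (intro mult_right_mono power_increasing) auto
  have "energy 1 \<mu> (\<lambda>x. u1 x - u3 x) \<le> 2 ^ DIM('a) * (energy 1 \<mu> (\<lambda>x. u1 x - u2 x) + energy 1 \<mu> (\<lambda>x. u2 x - u3 x))"
    by (rule order_trans[OF energy_triangle[of u1 u2 u3] le]) (use w in \<open>auto simp: Suc_leI\<close>)
  moreover have "energy DIM('a) (\<lambda>_. 1) (\<lambda>x. g1 x - g3 x)
      \<le> 2 ^ DIM('a) * (energy DIM('a) (\<lambda>_. 1) (\<lambda>x. g1 x - g2 x) + energy DIM('a) (\<lambda>_. 1) (\<lambda>x. g2 x - g3 x))"
    by (rule energy_triangle) auto
  moreover have "energy 2 \<omega> (\<lambda>x. g1 x - g3 x) \<le> 2 ^ DIM('a) * (energy 2 \<omega> (\<lambda>x. g1 x - g2 x) + energy 2 \<omega> (\<lambda>x. g2 x - g3 x))"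
    by (rule order_trans[OF energy_triangle[of g1 g2 g3] le]) (use w N in auto)
  ultimately show ?thesis
    unfolding sobolev_dist_def
    by (rule order_trans[OF add_mono[OF add_mono] eq_refl]) (simp add: distrib_left ac_simps)
qed

text \<open>Chains the stages: cutoff, truncation of the values and mollification are one
  application each of this closedness, so no diagonal sequence has to be built.\<close>

lemma approximable_limit:
  fixes \<mu> \<omega> :: "'a::euclidean_space \<Rightarrow> real"
  assumes m: "\<mu> \<in> borel_measurable borel" "\<omega> \<in> borel_measurable borel"
    "u \<in> borel_measurable borel" "g \<in> borel_measurable borel"
    "\<And>n. v n \<in> borel_measurable borel" "\<And>n. h n \<in> borel_measurable borel"
    and w: "\<And>x. \<mu> x \<ge> 0" "\<And>x. \<omega> x \<ge> 0" and N: "DIM('a) \<ge> 2"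
    and vh: "\<And>n. approximable \<mu> \<omega> (v n) (h n)"
    and lim: "(\<lambda>n. energy 1 \<mu> (\<lambda>x. u x - v n x)) \<longlonglongrightarrow> 0"
      "(\<lambda>n. energy DIM('a) (\<lambda>_. 1) (\<lambda>x. g x - h n x)) \<longlonglongrightarrow> 0"
      "(\<lambda>n. energy 2 \<omega> (\<lambda>x. g x - h n x)) \<longlonglongrightarrow> 0"
  shows "approximable \<mu> \<omega> u g"
  unfolding approximable_def
proof (intro allI impI)
  fix e :: real assume e: "e > 0"
  define d where "d = e / (2 ^ DIM('a) * 2)"
  have d: "d > 0" using e by (simp add: d_def)
  have "(\<lambda>n. sobolev_dist \<mu> \<omega> u g (v n) (h n)) \<longlonglongrightarrow> 0 + 0 + 0"
    unfolding sobolev_dist_def by (intro tendsto_add lim)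
  then have "\<forall>\<^sub>F n in sequentially. sobolev_dist \<mu> \<omega> u g (v n) (h n) \<le> ennreal d"
    using d by (intro ennreal_tendsto_0_le) simp_all
  then obtain n where n: "sobolev_dist \<mu> \<omega> u g (v n) (h n) \<le> ennreal d"
    by (auto simp: eventually_sequentially)
  obtain \<phi> where \<phi>: "\<phi> \<in> C0_infinity" "sobolev_dist \<mu> \<omega> (v n) (h n) \<phi> (grad \<phi>) \<le> ennreal d"
    using vh[of n] d unfolding approximable_def by blast
  note s = C0_infinity_smooth[OF \<phi>(1)]
  have "sobolev_dist \<mu> \<omega> u g \<phi> (grad \<phi>)
      \<le> 2 ^ DIM('a) * (sobolev_dist \<mu> \<omega> u g (v n) (h n) + sobolev_dist \<mu> \<omega> (v n) (h n) \<phi> (grad \<phi>))"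
    by (rule sobolev_dist_triangle) (use m w N smooth_borel[OF s] in auto)
  also have "\<dots> \<le> 2 ^ DIM('a) * (ennreal d + ennreal d)"
    by (intro mult_left_mono add_mono n \<phi>) auto
  also have "\<dots> = ennreal (2 ^ DIM('a) * (d + d))"
  proof -
    have "(2::ennreal) ^ DIM('a) = ennreal (2 ^ DIM('a))" by (simp flip: ennreal_power)
    then show ?thesis using d by (simp only: ennreal_mult' ennreal_plus less_imp_le zero_le_power zero_le_numeral)
  qed
  also have "2 ^ DIM('a) * (d + d) = e" by (simp add: d_def)
  finally show "\<exists>\<phi>\<in>C0_infinity. sobolev_dist \<mu> \<omega> u g \<phi> (grad \<phi>) \<le> ennreal e"
    using \<phi>(1) by blast
qed

lemma approximable_C0_infinity: "\<phi> \<in> C0_infinity \<Longrightarrow> approximable \<mu> \<omega> \<phi> (grad \<phi>)"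
  unfolding approximable_def
  by (intro allI impI bexI[of _ \<phi>])
    (use DIM_positive in \<open>auto simp: sobolev_dist_def energy_def power_0_left\<close>)

lemma energy_mult_bounded:
  fixes f :: "'a::euclidean_space \<Rightarrow> 'b::euclidean_space"
  assumes [measurable]: "f \<in> borel_measurable borel" "w \<in> borel_measurable borel"
    and v: "\<And>x. \<bar>v x\<bar> \<le> M" and w: "\<And>x. w x \<ge> 0"
  shows "energy p w (\<lambda>x. v x *\<^sub>R f x) \<le> ennreal (M ^ p) * energy p w f"
proof -
  have M: "M \<ge> 0" using v[of 0] by linarith
  have "energy p w (\<lambda>x. v x *\<^sub>R f x) \<le> (\<integral>\<^sup>+x. ennreal (M ^ p) * ennreal (norm (f x) ^ p * w x) \<partial>lborel)"
    unfolding energy_def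
  proof (rule nn_integral_mono)
    fix x
    have "norm (v x *\<^sub>R f x) ^ p * w x \<le> (M * norm (f x)) ^ p * w x"
      using v[of x] by (intro mult_right_mono power_mono w) (auto intro: mult_right_mono)
    then show "ennreal (norm (v x *\<^sub>R f x) ^ p * w x) \<le> ennreal (M ^ p) * ennreal (norm (f x) ^ p * w x)"
      using M w by (subst ennreal_mult'[symmetric]) (auto simp: power_mult_distrib mult.assoc intro: ennreal_leI)
  qed
  also have "\<dots> = ennreal (M ^ p) * energy p w f"
    unfolding energy_def by (rule nn_integral_cmult) simp
  finally show ?thesis .
qed

text \<open>The product rule leaves two terms. The factor 1 - \<open>cutoff m\<close> tends to 0
  boundedly, which settles the first by domination; the second, \<open>v\<close> times the gradient
  of the cutoff, is where the bound \<open>M\<close> enters, with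
  \<open>energy_grad_cutoff\<close>.\<close>

lemma energy_cutoff_gradient:
  fixes v w :: "'a::euclidean_space \<Rightarrow> real"
  assumes s: "smooth v" and M: "\<And>x. \<bar>v x\<bar> \<le> M" and fin: "energy p w (grad v) < \<infinity>"
    and wm [measurable]: "w \<in> borel_measurable borel" and w0: "\<And>x. w x \<ge> 0"
    and w1: "\<And>x. w x * norm x ^ (DIM('a) - p) \<le> 1" and p: "2 \<le> p" "p \<le> DIM('a)"
  shows "(\<lambda>m. energy p w (\<lambda>x. grad v x - grad (\<lambda>x. v x * cutoff m x) x)) \<longlonglongrightarrow> 0"
proof -
  note [measurable] = smooth_borel[OF s] smooth_borel[OF C0_infinity_smooth[OF cutoff_C0_infinity]]
  have "grad v x - grad (\<lambda>x. v x * cutoff m x) x = (1 - cutoff m x) *\<^sub>R grad v x + (- v x) *\<^sub>R grad (cutoff m) x" for m x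
    by (simp add: grad_mult[OF s C0_infinity_smooth[OF cutoff_C0_infinity]] algebra_simps)
  then have eq: "(\<lambda>x. grad v x - grad (\<lambda>x. v x * cutoff m x) x)
      = (\<lambda>x. (1 - cutoff m x) *\<^sub>R grad v x + (- v x) *\<^sub>R grad (cutoff m) x)" for m by blast
  have le: "energy p w (\<lambda>x. grad v x - grad (\<lambda>x. v x * cutoff m x) x)
     \<le> 2 ^ p * (energy p w (\<lambda>x. (1 - cutoff m x) *\<^sub>R grad v x) + ennreal (M ^ p) * energy p w (grad (cutoff m)))" for m
    unfolding eq
  proof (rule order_trans[OF energy_add])
    show "2 ^ p * (energy p w (\<lambda>x. (1 - cutoff m x) *\<^sub>R grad v x) + energy p w (\<lambda>x. (- v x) *\<^sub>R grad (cutoff m) x))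
      \<le> 2 ^ p * (energy p w (\<lambda>x. (1 - cutoff m x) *\<^sub>R grad v x) + ennreal (M ^ p) * energy p w (grad (cutoff m)))"
      by (intro mult_left_mono add_left_mono energy_mult_bounded) (use M w0 in auto)
  qed (use w0 in auto)
  have 1: "(\<lambda>m. energy p w (\<lambda>x. (1 - cutoff m x) *\<^sub>R grad v x)) \<longlonglongrightarrow> 0"
  proof (rule energy_dominated[where F = "grad v"])
    show "norm ((1 - cutoff m x) *\<^sub>R grad v x) \<le> 2 * norm (grad v x)" for m x
      using cutoff_bounds[of m x] by (auto intro!: mult_right_mono)
    show "(\<lambda>m. (1 - cutoff m x) *\<^sub>R grad v x) \<longlonglongrightarrow> 0" for x
      using tendsto_scaleR[OF tendsto_diff[OF tendsto_const[of 1] cutoff_tendsto[of x]] tendsto_const[of "grad v x"]] by simp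
  qed (use p fin w0 in auto)
  have "(\<lambda>m. 2 ^ p * (energy p w (\<lambda>x. (1 - cutoff m x) *\<^sub>R grad v x) + ennreal (M ^ p) * energy p w (grad (cutoff m))))
      \<longlonglongrightarrow> 2 ^ p * (0 + ennreal (M ^ p) * 0)"
    by (intro ennreal_tendsto_cmult tendsto_add 1 energy_grad_cutoff[OF wm w0 w1 p])
      (auto simp: power_less_top_ennreal)
  then show ?thesis by (intro ennreal_squeeze_0[OF _ le]) simp
qed

text \<open>What the approximation uses of the weights: slow variation for mollification, and
  \<open>decay\<close>, which is the bound required by \<open>energy_grad_cutoff\<close> for p = 2.
  For p = N and weight 1 that bound is automatic.\<close>

locale sobolev_weights =
  fixes C :: real and \<mu> \<omega> :: "'a::euclidean_space \<Rightarrow> real"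
  assumes slow: "slow_weight C \<mu>" "slow_weight C \<omega>"
    and decay: "\<And>x. \<omega> x * norm x ^ (DIM('a) - 2) \<le> 1"
    and dim: "DIM('a) \<ge> 2"
begin

lemma weights: "\<mu> \<in> borel_measurable borel" "\<omega> \<in> borel_measurable borel"
    "\<And>x. \<mu> x \<ge> 0" "\<And>x. \<omega> x \<ge> 0"
  using slow by (auto simp: slow_weight_def)

lemma approximable_smooth_bounded:
  assumes s: "smooth v" and M: "\<And>x. \<bar>v x\<bar> \<le> M" and fin: "energy 1 \<mu> v < \<infinity>"
    "energy DIM('a) (\<lambda>_. 1) (grad v) < \<infinity>" "energy 2 \<omega> (grad v) < \<infinity>"
  shows "approximable \<mu> \<omega> v (grad v)"
proof (rule approximable_limit[where v = "\<lambda>m x. v x * cutoff m x" and h = "\<lambda>m. grad (\<lambda>x. v x * cutoff m x)"])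
  have c: "(\<lambda>x. v x * cutoff m x) \<in> C0_infinity" for m
    by (rule C0_infinity_mult[OF s cutoff_C0_infinity])
  show "(\<lambda>x. v x * cutoff m x) \<in> borel_measurable borel" "grad (\<lambda>x. v x * cutoff m x) \<in> borel_measurable borel" for m
    using smooth_borel[OF C0_infinity_smooth[OF c]] by auto
  show "v \<in> borel_measurable borel" "grad v \<in> borel_measurable borel" using smooth_borel[OF s] by auto
  show "approximable \<mu> \<omega> (\<lambda>x. v x * cutoff m x) (grad (\<lambda>x. v x * cutoff m x))" for m
    by (rule approximable_C0_infinity[OF c])
  show "(\<lambda>m. energy 1 \<mu> (\<lambda>x. v x - v x * cutoff m x)) \<longlonglongrightarrow> 0"
  proof (rule energy_dominated[where F = v])
    show "(\<lambda>x. v x - v x * cutoff m x) \<in> borel_measurable borel" for m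
      using smooth_borel(1)[OF s] smooth_borel(1)[OF C0_infinity_smooth[OF c]] by measurable
    show "norm (v x - v x * cutoff m x) \<le> 2 * norm (v x)" for m x
    proof -
      have "norm (v x - v x * cutoff m x) = \<bar>v x\<bar> * \<bar>1 - cutoff m x\<bar>"
        by (simp add: abs_mult[symmetric] algebra_simps)
      also have "\<dots> \<le> \<bar>v x\<bar> * 2" using cutoff_bounds[of m x] by (intro mult_left_mono) auto
      finally show ?thesis by simp
    qed
    show "(\<lambda>m. v x - v x * cutoff m x) \<longlonglongrightarrow> 0" for x
      using tendsto_diff[OF tendsto_const[of "v x"] tendsto_mult[OF tendsto_const[of "v x"] cutoff_tendsto[of x]]] by simp
  qed (use weights fin smooth_borel[OF s] in auto)
  show "(\<lambda>m. energy DIM('a) (\<lambda>_. 1) (\<lambda>x. grad v x - grad (\<lambda>x. v x * cutoff m x) x)) \<longlonglongrightarrow> 0"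
    by (rule energy_cutoff_gradient[OF s M]) (use fin dim in auto)
  show "(\<lambda>m. energy 2 \<omega> (\<lambda>x. grad v x - grad (\<lambda>x. v x * cutoff m x) x)) \<longlonglongrightarrow> 0"
    by (rule energy_cutoff_gradient[OF s M]) (use fin dim weights decay in auto)
qed (use weights dim in auto)

text \<open>Truncating the values by \<open>M sin (v / M)\<close> keeps everything smooth.\<close>

lemma approximable_smooth:
  assumes s: "smooth v" and fin: "energy 1 \<mu> v < \<infinity>"
    "energy DIM('a) (\<lambda>_. 1) (grad v) < \<infinity>" "energy 2 \<omega> (grad v) < \<infinity>"
  shows "approximable \<mu> \<omega> v (grad v)"
proof -
  define M where "M m = real (Suc m)" for m
  have M: "M m > 0" for m by (simp add: M_def)
  define t where "t m x = M m * sin (inverse (M m) * v x)" for m x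
  have st: "smooth (t m)" for m
    unfolding t_def by (intro smooth_mult smooth_const smooth_sin s)
  \<comment> \<open>The factor cos (v / M) has modulus at most 1 and tends to 1 pointwise, so the
    energies of the gradients converge by domination alone.\<close>
  have gt: "grad (t m) x = cos (inverse (M m) * v x) *\<^sub>R grad v x" for m x
  proof (rule grad_eqI)
    have "((\<lambda>r. M m * sin (inverse (M m) * r)) has_real_derivative cos (inverse (M m) * v x)) (at (v x))"
      using M[of m] by (auto intro!: derivative_eq_intros)
    from GDERIV_DERIV_compose[OF smooth_GDERIV[OF s] this]
    show "GDERIV (t m) x :> cos (inverse (M m) * v x) *\<^sub>R grad v x" by (simp add: t_def[abs_def])
  qed
  have tv: "\<bar>t m x\<bar> \<le> \<bar>v x\<bar>" for m x
  proof -
    have "\<bar>t m x\<bar> \<le> M m * \<bar>inverse (M m) * v x\<bar>"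
      using M[of m] abs_sin_x_le_abs_x[of "inverse (M m) * v x"] by (simp add: t_def abs_mult)
    then show ?thesis using M[of m] by (simp add: abs_mult flip: mult.assoc)
  qed
  have iM: "(\<lambda>m. inverse (M m) * v x) \<longlonglongrightarrow> 0" for x
    unfolding M_def using tendsto_mult_left_zero[OF LIMSEQ_inverse_real_of_nat] by simp
  have gle: "norm (grad (t m) x) \<le> norm (grad v x)" for m x
    by (simp add: gt mult_left_le_one_le)
  have glim: "(\<lambda>m. grad v x - grad (t m) x) \<longlonglongrightarrow> 0" for x
  proof -
    have "(\<lambda>m. grad v x - cos (inverse (M m) * v x) *\<^sub>R grad v x) \<longlonglongrightarrow> grad v x - cos 0 *\<^sub>R grad v x"
      by (intro tendsto_intros iM)
    then show ?thesis by (simp add: gt)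
  qed
  have gdom: "norm (grad v x - grad (t m) x) \<le> 2 * norm (grad v x)" for m x
    using gle[of m x] norm_triangle_ineq4[of "grad v x" "grad (t m) x"] by linarith
  show ?thesis
  proof (rule approximable_limit[where v = t and h = "\<lambda>m. grad (t m)"])
    show "approximable \<mu> \<omega> (t m) (grad (t m))" for m
    proof (rule approximable_smooth_bounded[OF st])
      show "\<bar>t m x\<bar> \<le> M m" for x
        using M[of m] by (simp add: t_def abs_mult mult_left_le)
      show "energy 1 \<mu> (t m) < \<infinity>"
        by (rule le_less_trans[OF energy_mono fin(1)]) (use tv weights in auto)
      show "energy DIM('a) (\<lambda>_. 1) (grad (t m)) < \<infinity>"
        by (rule le_less_trans[OF energy_mono fin(2)]) (use gle weights in auto)
      show "energy 2 \<omega> (grad (t m)) < \<infinity>"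
        by (rule le_less_trans[OF energy_mono fin(3)]) (use gle weights in auto)
    qed
    show "(\<lambda>m. energy 1 \<mu> (\<lambda>x. v x - t m x)) \<longlonglongrightarrow> 0"
    proof (rule energy_dominated[where F = v])
      show "norm (v x - t m x) \<le> 2 * norm (v x)" for m x using tv[of m x] by simp
      show "(\<lambda>m. v x - t m x) \<longlonglongrightarrow> 0" for x
      proof -
        have "((\<lambda>y. sin y / y) \<longlongrightarrow> 1) (at (0::real))"
          using DERIV_sin[of 0] by (simp add: has_field_derivative_iff)
        have "(\<lambda>m. t m x) \<longlonglongrightarrow> v x"
        proof (cases "v x = 0")
          case False
          have "filterlim (\<lambda>m. inverse (M m) * v x) (at 0) sequentially"
            using iM[of x] False less_imp_neq[OF M, symmetric] by (auto simp: filterlim_at intro!: always_eventually)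
          from filterlim_compose[OF \<open>((\<lambda>y. sin y / y) \<longlongrightarrow> 1) (at 0)\<close> this]
          have "(\<lambda>m. v x * (sin (inverse (M m) * v x) / (inverse (M m) * v x))) \<longlonglongrightarrow> v x * 1"
            by (intro tendsto_mult tendsto_const)
          moreover have "v x * (sin (inverse (M m) * v x) / (inverse (M m) * v x)) = t m x" for m
            using False M[of m] by (simp add: t_def field_simps)
          ultimately show ?thesis by simp
        qed (simp add: t_def)
        from tendsto_diff[OF tendsto_const[of "v x"] this] show ?thesis by simp
      qed
      show "(\<lambda>x. v x - t m x) \<in> borel_measurable borel" for m
        using smooth_borel(1)[OF s] smooth_borel(1)[OF st] by measurable
    qed (use weights fin smooth_borel[OF s] in auto)
    have gm: "(\<lambda>x. grad v x - grad (t m) x) \<in> borel_measurable borel" for m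
      using smooth_borel(2)[OF s] smooth_borel(2)[OF st] by measurable
    show "(\<lambda>m. energy DIM('a) (\<lambda>_. 1) (\<lambda>x. grad v x - grad (t m) x)) \<longlonglongrightarrow> 0"
      by (rule energy_dominated[where F = "grad v"]) (use gm glim gdom fin dim smooth_borel[OF s] in auto)
    show "(\<lambda>m. energy 2 \<omega> (\<lambda>x. grad v x - grad (t m) x)) \<longlonglongrightarrow> 0"
      by (rule energy_dominated[where F = "grad v"]) (use gm glim gdom fin weights smooth_borel[OF s] in auto)
  qed (use weights dim smooth_borel[OF s] smooth_borel[OF st] in auto)
qed

theorem approximable_weak:
  assumes ug: "weak_gradient u g" and fin: "energy 1 \<mu> u < \<infinity>"
    "energy DIM('a) (\<lambda>_. 1) g < \<infinity>" "energy 2 \<omega> g < \<infinity>"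
  shows "approximable \<mu> \<omega> u g"
proof -
  have u: "loc_int u" and g: "loc_int g" using ug by (auto simp: weak_gradient_def)
  have r: "0 < 1 / real (Suc n)" "1 / real (Suc n) \<le> 1" for n by auto
  have sm: "smooth (mollify n u)" for n
    unfolding mollify_def by (rule smooth_conv[OF mollifier(1)[OF r(1)] u])
  have gr: "grad (mollify n u) = mollify n g" for n
    unfolding mollify_def using grad_conv[OF ug mollifier(1)[OF r(1)]] by blast
  have en: "energy p w (mollify n f) < \<infinity>" if "slow_weight K w" "loc_int f" "p \<ge> 1" "energy p w f < \<infinity>"
    for K p w n and f :: "'a \<Rightarrow> 'b::euclidean_space"
  proof (rule le_less_trans)
    show "energy p w (mollify n f) \<le> ennreal K * energy p w f"
      unfolding mollify_def by (rule energy_conv[OF that(1) r that(2,3)])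
    show "ennreal K * energy p w f < \<infinity>" using that(4) by (simp add: ennreal_mult_less_top)
  qed
  show ?thesis
  proof (rule approximable_limit[where v = "\<lambda>n. mollify n u" and h = "\<lambda>n. mollify n g"])
    show "approximable \<mu> \<omega> (mollify n u) (mollify n g)" for n
      using approximable_smooth[OF sm[of n]] en[OF slow(1) u _ fin(1)] en[OF slow_weight_1 g _ fin(2)]
        en[OF slow(2) g _ fin(3)] by (auto simp: gr Suc_leI)
    show "(\<lambda>n. energy 1 \<mu> (\<lambda>x. u x - mollify n u x)) \<longlonglongrightarrow> 0"
      using mollify_tends_weighted[OF slow(1) _ u fin(1)]
      by (simp add: mollify_tends_def energy_minus_commute[of _ _ u])
    show "(\<lambda>n. energy DIM('a) (\<lambda>_. 1) (\<lambda>x. g x - mollify n g x)) \<longlonglongrightarrow> 0"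
      using mollify_tends_weighted[OF slow_weight_1 _ g fin(2)]
      by (simp add: mollify_tends_def energy_minus_commute[of _ _ g] Suc_leI)
    show "(\<lambda>n. energy 2 \<omega> (\<lambda>x. g x - mollify n g x)) \<longlonglongrightarrow> 0"
      using mollify_tends_weighted[OF slow(2) _ g fin(3)]
      by (simp add: mollify_tends_def energy_minus_commute[of _ _ g])
  qed (use weights dim loc_int_borel[OF u] loc_int_borel[OF g] smooth_borel[OF sm] gr in auto)
qed

end

section \<open>The space with weights from the density\<close>

text \<open>\<open>lebesgue\<close> is complete, so a preimage that agrees with a Borel set up to a
  null set is measurable.\<close>

lemma borel_measurable_lebesgue_AE:
  fixes f f' :: "'a::euclidean_space \<Rightarrow> 'b::euclidean_space"
  assumes f': "f' \<in> borel_measurable borel" and ae: "AE x in lborel. f x = f' x"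
  shows "f \<in> borel_measurable lebesgue"
proof (rule measurableI)
  fix A :: "'b set" assume A: "A \<in> sets borel"
  show "f -` A \<inter> space lebesgue \<in> sets lebesgue"
  proof (rule completion.in_sets_AE)
    have "AE x in lebesgue. f x = f' x" using ae by (rule AE_completion)
    then show "AE x in lebesgue. x \<in> f' -` A \<longleftrightarrow> x \<in> f -` A \<inter> space lebesgue"
      by eventually_elim auto
    have "f' -` A \<inter> space borel \<in> sets borel" using f' A by (rule measurable_sets)
    then show "f' -` A \<in> sets lebesgue" by simp
  qed simp
qed simp

lemma lebesgue_borel_representative:
  fixes f :: "'a::euclidean_space \<Rightarrow> 'b::euclidean_space"
  assumes "f \<in> borel_measurable lebesgue"
  obtains f' where "f' \<in> borel_measurable borel" "AE x in lborel. f x = f' x"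
proof -
  have "\<exists>h\<in>borel_measurable lborel. AE x in lborel. f x \<bullet> b = h x" for b
    by (rule completion_ex_borel_measurable_real) (use assms in measurable)
  then obtain h where h: "\<And>b. h b \<in> borel_measurable borel" "\<And>b. AE x in lborel. f x \<bullet> b = h b x"
    unfolding bex_simps measurable_lborel2 by metis
  have "AE x in lborel. \<forall>b\<in>Basis. f x \<bullet> b = h b x"
    using h(2) by (intro AE_finite_allI) auto
  then have "AE x in lborel. f x = (\<Sum>b\<in>Basis. h b x *\<^sub>R b)"
  proof eventually_elim
    case (elim x)
    then have "(\<Sum>b\<in>Basis. h b x *\<^sub>R b) = (\<Sum>b\<in>Basis. (f x \<bullet> b) *\<^sub>R b)" by (intro sum.cong) auto
    then show ?case by (simp add: euclidean_representation)
  qed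
  moreover have "(\<lambda>x. \<Sum>b\<in>Basis. h b x *\<^sub>R b) \<in> borel_measurable borel"
    using h(1) by measurable
  ultimately show thesis by (rule that[rotated])
qed

lemma lebesgue_lborel_transfer:
  fixes f f' :: "'a::euclidean_space \<Rightarrow> 'b::euclidean_space"
  assumes f': "f' \<in> borel_measurable borel" and ae: "AE x in lborel. f x = f' x"
  shows "integrable lebesgue f \<longleftrightarrow> integrable lborel f'"
    and "(\<integral>x. f x \<partial>lebesgue) = (\<integral>x. f' x \<partial>lborel)"
proof -
  have f: "f \<in> borel_measurable lebesgue" by (rule borel_measurable_lebesgue_AE[OF f' ae])
  have f'l: "f' \<in> borel_measurable lebesgue" using f' by (intro measurable_completion) simp
  have ae': "AE x in lebesgue. f x = f' x" using ae by (rule AE_completion)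
  show "integrable lebesgue f \<longleftrightarrow> integrable lborel f'"
    using integrable_cong_AE[OF f f'l ae'] integrable_completion[of f' lborel] f' by simp
  show "(\<integral>x. f x \<partial>lebesgue) = (\<integral>x. f' x \<partial>lborel)"
    using integral_cong_AE[OF f f'l ae'] integral_completion[of f' lborel] f' by simp
qed

lemma locally_integrable_iff_loc_int:
  fixes f f' :: "'a::euclidean_space \<Rightarrow> 'b::euclidean_space"
  assumes f' [measurable]: "f' \<in> borel_measurable borel" and ae: "AE x in lborel. f x = f' x"
  shows "locally_integrable f \<longleftrightarrow> loc_int f'"
proof -
  have eq: "f absolutely_integrable_on K \<longleftrightarrow> integrable lborel (\<lambda>x. indicator K x *\<^sub>R f' x)"
    if "compact K" for K
  proof -
    have [measurable]: "K \<in> sets borel" using that by (rule borel_compact)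
    show ?thesis
      unfolding set_integrable_def
      by (rule lebesgue_lborel_transfer) (use ae in auto)
  qed
  show ?thesis
  proof
    assume "locally_integrable f"
    then show "loc_int f'" using eq f' by (simp add: locally_integrable_def loc_int_def)
  next
    assume l: "loc_int f'"
    have "integrable lborel (\<lambda>x. indicator K x *\<^sub>R f' x)" if K: "compact K" for K :: "'a set"
    proof -
      obtain R where R: "\<And>x. x \<in> K \<Longrightarrow> norm x \<le> R"
        using compact_imp_bounded[OF K] unfolding bounded_iff by blast
      have [measurable]: "K \<in> sets borel" using K by (rule borel_compact)
      show ?thesis
        by (rule loc_int_bounded_mult[OF _ l, where R = R and B = 1]) (use R in \<open>force simp: indicator_def\<close>)+
    qed
    then show "locally_integrable f" using eq by (simp add: locally_integrable_def)
  qed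
qed

text \<open>The restrictions to growing balls are integrable, hence measurable, and converge
  pointwise.\<close>

lemma locally_integrable_borel_measurable:
  fixes f :: "'a::euclidean_space \<Rightarrow> 'b::euclidean_space"
  assumes "locally_integrable f"
  shows "f \<in> borel_measurable lebesgue"
proof (rule borel_measurable_LIMSEQ_metric)
  show "(\<lambda>x. indicator (cball 0 (real n)) x *\<^sub>R f x) \<in> borel_measurable lebesgue" for n
    using assms unfolding locally_integrable_def set_integrable_def
    by (intro borel_measurable_integrable) auto
  show "(\<lambda>n. indicator (cball 0 (real n)) x *\<^sub>R f x) \<longlonglongrightarrow> f x" for x
  proof (rule tendsto_eventually)
    have "\<forall>\<^sub>F n in sequentially. norm x \<le> real n"
      using eventually_ge_at_top[of "nat \<lceil>norm x\<rceil>"] by eventually_elim linarith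
    then show "\<forall>\<^sub>F n in sequentially. indicator (cball 0 (real n)) x *\<^sub>R f x = f x"
      by eventually_elim simp
  qed
qed

section \<open>Borel representatives of weak gradients\<close>

lemma has_weak_gradient_iff:
  assumes u' [measurable]: "u' \<in> borel_measurable borel" and u: "AE x in lborel. u x = u' x"
    and g' [measurable]: "g' \<in> borel_measurable borel" and g: "AE x in lborel. g x = g' x"
  shows "has_weak_gradient u g \<longleftrightarrow> weak_gradient u' g'"
proof -
  have "(\<integral>x. u x * (grad \<phi> x \<bullet> b) \<partial>lebesgue) = (\<integral>x. u' x * (grad \<phi> x \<bullet> b) \<partial>lborel)"
    "(\<integral>x. (g x \<bullet> b) * \<phi> x \<partial>lebesgue) = (\<integral>x. (g' x \<bullet> b) * \<phi> x \<partial>lborel)"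
    if "\<phi> \<in> C0_infinity" for \<phi> and b :: 'a
  proof -
    note [measurable] = smooth_borel[OF C0_infinity_smooth[OF that]]
    show "(\<integral>x. u x * (grad \<phi> x \<bullet> b) \<partial>lebesgue) = (\<integral>x. u' x * (grad \<phi> x \<bullet> b) \<partial>lborel)"
      by (rule lebesgue_lborel_transfer) (use u in auto)
    show "(\<integral>x. (g x \<bullet> b) * \<phi> x \<partial>lebesgue) = (\<integral>x. (g' x \<bullet> b) * \<phi> x \<partial>lborel)"
      by (rule lebesgue_lborel_transfer) (use g in auto)
  qed
  then show ?thesis
    unfolding has_weak_gradient_def weak_gradient_def
    using locally_integrable_iff_loc_int[OF u' u] locally_integrable_iff_loc_int[OF g' g] by simp
qed

lemma has_weak_gradient_borel:
  assumes "has_weak_gradient u g"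
  obtains u' g' where "u' \<in> borel_measurable borel" "AE x in lborel. u x = u' x"
    "g' \<in> borel_measurable borel" "AE x in lborel. g x = g' x" "weak_gradient u' g'"
proof -
  have "u \<in> borel_measurable lebesgue" "g \<in> borel_measurable lebesgue"
    using assms by (auto simp: has_weak_gradient_def intro: locally_integrable_borel_measurable)
  then obtain u' g' where *: "u' \<in> borel_measurable borel" "AE x in lborel. u x = u' x"
    "g' \<in> borel_measurable borel" "AE x in lborel. g x = g' x"
    using lebesgue_borel_representative by metis
  with assms have "weak_gradient u' g'" by (simp add: has_weak_gradient_iff)
  with * that show thesis by blast
qed

lemma has_weak_gradient_weak_grad: "has_weak_gradient u g \<Longrightarrow> has_weak_gradient u (weak_grad u)"
  unfolding weak_grad_def by (rule someI[of "has_weak_gradient u"])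

text \<open>By uniqueness, the representative that \<open>SOME\<close> picks in
  \<open>weak_grad\<close> agrees almost everywhere with any Borel weak gradient at hand, so norms
  may be computed with the latter.\<close>

lemma weak_grad_AE_eq:
  assumes u' : "u' \<in> borel_measurable borel" "AE x in lborel. u x = u' x" and g': "weak_gradient u' g'"
  shows "AE x in lborel. weak_grad u x = g' x"
proof -
  have g'm: "g' \<in> borel_measurable borel" using g' by (auto simp: weak_gradient_def loc_int_borel)
  have "has_weak_gradient u g'"
    using has_weak_gradient_iff[OF u' g'm, of g'] g' by simp
  then have "has_weak_gradient u (weak_grad u)" by (rule has_weak_gradient_weak_grad)
  moreover from this have "weak_grad u \<in> borel_measurable lebesgue"
    by (auto simp: has_weak_gradient_def intro: locally_integrable_borel_measurable)
  then obtain h where h: "h \<in> borel_measurable borel" "AE x in lborel. weak_grad u x = h x"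
    by (rule lebesgue_borel_representative)
  ultimately have "weak_gradient u' h" using has_weak_gradient_iff[OF u' h] by simp
  from weak_gradient_unique[OF this g'] h(2) show ?thesis by eventually_elim simp
qed

lemma weak_gradient_diff:
  assumes u: "weak_gradient u g" and v: "weak_gradient v h"
  shows "weak_gradient (\<lambda>x. u x - v x) (\<lambda>x. g x - h x)"
  unfolding weak_gradient_def
proof (intro conjI ballI)
  have l: "loc_int u" "loc_int v" "loc_int g" "loc_int h" using u v by (auto simp: weak_gradient_def)
  show "loc_int (\<lambda>x. u x - v x)" "loc_int (\<lambda>x. g x - h x)" by (intro loc_int_diff l)+
  fix \<phi> :: "'a \<Rightarrow> real" and b :: 'a assume \<phi>: "\<phi> \<in> C0_infinity" and b: "b \<in> Basis"
  \<comment> \<open>Additivity of the Bochner integral asks for integrability of each pairing with a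
    test function; bounded support and boundedness of the test function provide it.\<close>
  have i: "integrable lborel (\<lambda>x. \<psi> x *\<^sub>R f x)" if \<psi>: "\<psi> \<in> C0_infinity" and f: "loc_int f" for \<psi> and f :: "'a \<Rightarrow> 'b::euclidean_space"
  proof -
    obtain R where R: "R > 0" "\<And>x. norm x \<ge> R \<Longrightarrow> \<psi> x = 0" "\<And>x. norm x \<ge> R \<Longrightarrow> grad \<psi> x = 0"
      using C0_infinity_support[OF \<psi>] by blast
    have c: "continuous_on UNIV \<psi>" by (rule smooth_continuous[OF C0_infinity_smooth[OF \<psi>]])
    obtain B where "\<And>x. norm (\<psi> x) \<le> B" using bounded_compact_support[OF c R(2)] by blast
    then show ?thesis
      using R(2) by (intro loc_int_bounded_mult[OF _ f, where R = R and B = B] borel_measurable_continuous_onI c) auto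
  qed
  have iu: "integrable lborel (\<lambda>x. f x * (grad \<phi> x \<bullet> b))" if "loc_int f" for f
    using i[OF C0_infinity_grad[OF \<phi> b] that] by (simp add: mult.commute)
  have ig: "integrable lborel (\<lambda>x. (f x \<bullet> b) * \<phi> x)" if "loc_int f" for f :: "'a \<Rightarrow> 'a"
    using integrable_inner_left[OF i[OF \<phi> that], of b] by (simp add: mult.commute)
  have "(\<integral>x. (u x - v x) * (grad \<phi> x \<bullet> b) \<partial>lborel)
      = (\<integral>x. u x * (grad \<phi> x \<bullet> b) \<partial>lborel) - (\<integral>x. v x * (grad \<phi> x \<bullet> b) \<partial>lborel)"
    using iu[OF l(1)] iu[OF l(2)] by (simp add: left_diff_distrib)
  also have "\<dots> = - ((\<integral>x. (g x \<bullet> b) * \<phi> x \<partial>lborel) - (\<integral>x. (h x \<bullet> b) * \<phi> x \<partial>lborel))"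
    using u v \<phi> b by (simp add: weak_gradient_def)
  also have "\<dots> = - (\<integral>x. ((g x - h x) \<bullet> b) * \<phi> x \<partial>lborel)"
    using ig[OF l(3)] ig[OF l(4)] by (simp add: left_diff_distrib inner_diff_left)
  finally show "(\<integral>x. (u x - v x) * (grad \<phi> x \<bullet> b) \<partial>lborel) = - (\<integral>x. ((g x - h x) \<bullet> b) * \<phi> x \<partial>lborel)" .
qed

text \<open>The second identity covers infinite energy as well: the Bochner integral of a
  non-integrable function and \<open>enn2real\<close> of infinity are both 0 by default.\<close>

lemma energy_lebesgue:
  fixes f f' :: "'a::euclidean_space \<Rightarrow> 'b::euclidean_space"
  assumes [measurable]: "f' \<in> borel_measurable borel" "w \<in> borel_measurable borel"
    and ae: "AE x in lborel. f x = f' x" and w: "\<And>x. w x \<ge> 0"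
  shows "integrable lebesgue (\<lambda>x. norm (f x) ^ p * w x) \<longleftrightarrow> energy p w f' < \<infinity>"
    and "(\<integral>x. norm (f x) ^ p * w x \<partial>lebesgue) = enn2real (energy p w f')"
proof -
  have ae': "AE x in lborel. norm (f x) ^ p * w x = norm (f' x) ^ p * w x"
    using ae by eventually_elim simp
  have m: "(\<lambda>x. norm (f' x) ^ p * w x) \<in> borel_measurable borel" by measurable
  note t = lebesgue_lborel_transfer[OF m ae']
  show "integrable lebesgue (\<lambda>x. norm (f x) ^ p * w x) \<longleftrightarrow> energy p w f' < \<infinity>"
    unfolding t(1) unfolding integrable_iff_bounded energy_def using w m by simp
  show "(\<integral>x. norm (f x) ^ p * w x \<partial>lebesgue) = enn2real (energy p w f')"
    unfolding t(2) energy_def using w m by (intro integral_eq_nn_integral) auto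
qed

lemma energy_finite:
  fixes F :: "'a::euclidean_space \<Rightarrow> 'b::euclidean_space"
  assumes "continuous_on UNIV F" "\<And>x. norm x \<ge> R \<Longrightarrow> F x = 0"
    and w: "\<And>x. 0 \<le> w x" "\<And>x. w x \<le> C" and p: "p \<ge> 1"
  shows "energy p w F < \<infinity>"
proof -
  obtain B where B: "B > 0" "\<And>x. norm (F x) \<le> B" using bounded_compact_support[OF assms(1,2)] by blast
  have "energy p w F \<le> (\<integral>\<^sup>+x. ennreal (B ^ p * C) * indicator (cball (0::'a) R) x \<partial>lborel)"
    unfolding energy_def
  proof (rule nn_integral_mono)
    fix x
    show "ennreal (norm (F x) ^ p * w x) \<le> ennreal (B ^ p * C) * indicator (cball 0 R) x"
    proof (cases "norm x \<le> R")
      case True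
      have "norm (F x) ^ p * w x \<le> B ^ p * C"
        using B w by (intro mult_mono power_mono) auto
      then show ?thesis using True by (simp add: ennreal_leI)
    next
      case False
      then show ?thesis using assms(2)[of x] p by (simp add: power_0_left)
    qed
  qed
  also have "\<dots> < \<infinity>"
    using emeasure_lborel_cball_finite[of "0::'a" R]
    by (simp add: nn_integral_cmult_indicator ennreal_mult_less_top)
  finally show ?thesis .
qed

section \<open>Comparison of the concrete weights\<close>

definition conj_exp :: "'a::euclidean_space itself \<Rightarrow> real" where
  "conj_exp _ = real DIM('a) / (real DIM('a) - 1)"

definition unit_volume :: "'a::euclidean_space itself \<Rightarrow> real" where
  "unit_volume _ = measure lebesgue (ball (0::'a) 1)"

definition regular_weight :: "'a::euclidean_space \<Rightarrow> real" where
  "regular_weight x = 1 / (1 + norm x) ^ (DIM('a) - 2)"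

context
  assumes dim: "DIM('a::euclidean_space) \<ge> 2"
begin

text \<open>\<open>conj_exp\<close> is the Hoelder conjugate of the dimension. Being above 1 makes
  the power of the norm differentiable at the origin; the bound 2 enters the constant of
  \<open>grad_weight_le\<close>.\<close>

lemma conj_exp_bounds: "1 < conj_exp TYPE('a)" "conj_exp TYPE('a) \<le> 2"
  using dim by (auto simp: conj_exp_def field_simps)

lemma unit_volume_pos: "unit_volume TYPE('a) > 0"
  using content_ball_pos[of 1 "0::'a"] by (simp add: unit_volume_def)

lemma mu_density_eq: "mu_density (x::'a) = 1 / (unit_volume TYPE('a) * (1 + norm x powr conj_exp TYPE('a)) ^ DIM('a))"
  by (simp add: mu_density_def conj_exp_def unit_volume_def)

lemma mu_density_borel: "(mu_density :: 'a \<Rightarrow> real) \<in> borel_measurable borel"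
  unfolding mu_density_def[abs_def] by measurable

lemma mu_density_nonneg: "mu_density (x::'a) \<ge> 0"
  using unit_volume_pos by (simp add: mu_density_eq)

lemma slow_weight_mono: "slow_weight C w \<Longrightarrow> C \<le> D \<Longrightarrow> slow_weight D w"
  unfolding slow_weight_def by (meson mult_right_mono order_trans)

lemma slow_weight_mu_density:
  "slow_weight (max (1 / unit_volume TYPE('a)) ((1 + 2 powr conj_exp TYPE('a)) ^ DIM('a))) (mu_density :: 'a \<Rightarrow> real)"
  unfolding slow_weight_def
proof (intro conjI allI impI mu_density_borel mu_density_nonneg)
  fix x y :: 'a
  have ge1: "(1 + norm x powr conj_exp TYPE('a)) ^ DIM('a) \<ge> 1" by (intro one_le_power) simp
  then have "unit_volume TYPE('a) * 1 \<le> unit_volume TYPE('a) * (1 + norm x powr conj_exp TYPE('a)) ^ DIM('a)" using unit_volume_pos by (intro mult_left_mono) auto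
  then have "mu_density x \<le> 1 / unit_volume TYPE('a)"
    unfolding mu_density_eq using unit_volume_pos less_le_trans[OF zero_less_one ge1]
    by (intro divide_left_mono mult_pos_pos) auto
  then show "mu_density x \<le> max (1 / unit_volume TYPE('a)) ((1 + 2 powr conj_exp TYPE('a)) ^ DIM('a))" by simp
  assume xy: "norm (x - y) \<le> 1"
  \<comment> \<open>A bound by a product splits under \<open>powr\<close>; this is the origin of
    \<open>2 powr conj_exp TYPE('a)\<close> in the constant. The other entry of the constant, 1 /
    \<open>unit_volume TYPE('a)\<close>, bounds the density itself.\<close>
  have "norm y \<le> 2 * max 1 (norm x)"
    using xy norm_triangle_ineq2[of y x] by (simp add: norm_minus_commute)
  then have "norm y powr conj_exp TYPE('a) \<le> (2 * max 1 (norm x)) powr conj_exp TYPE('a)"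
    using conj_exp_bounds by (intro powr_mono2) auto
  also have "\<dots> = 2 powr conj_exp TYPE('a) * max 1 (norm x) powr conj_exp TYPE('a)" by (simp add: powr_mult)
  also have "\<dots> \<le> 2 powr conj_exp TYPE('a) * (1 + norm x powr conj_exp TYPE('a))" by (intro mult_left_mono) (auto simp: max_def)
  finally have "1 + norm y powr conj_exp TYPE('a) \<le> (1 + 2 powr conj_exp TYPE('a)) * (1 + norm x powr conj_exp TYPE('a))"
    by (simp add: algebra_simps add_increasing)
  then have "(1 + norm y powr conj_exp TYPE('a)) ^ DIM('a) \<le> ((1 + 2 powr conj_exp TYPE('a)) * (1 + norm x powr conj_exp TYPE('a))) ^ DIM('a)"
    by (intro power_mono) auto
  then have *: "(1 + norm y powr conj_exp TYPE('a)) ^ DIM('a) \<le> (1 + 2 powr conj_exp TYPE('a)) ^ DIM('a) * (1 + norm x powr conj_exp TYPE('a)) ^ DIM('a)"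
    by (simp add: power_mult_distrib)
  have pos: "(1 + norm z powr conj_exp TYPE('a)) ^ DIM('a) > 0" for z :: 'a
    by (intro zero_less_power add_pos_nonneg) auto
  have "mu_density x \<le> (1 + 2 powr conj_exp TYPE('a)) ^ DIM('a) * mu_density y"
    unfolding mu_density_eq using * pos[of x] pos[of y] unit_volume_pos
    by (simp add: divide_simps mult_ac)
  also have "\<dots> \<le> max (1 / unit_volume TYPE('a)) ((1 + 2 powr conj_exp TYPE('a)) ^ DIM('a)) * mu_density y"
    by (intro mult_right_mono mu_density_nonneg) simp
  finally show "mu_density x \<le> max (1 / unit_volume TYPE('a)) ((1 + 2 powr conj_exp TYPE('a)) ^ DIM('a)) * mu_density y" .
qed

lemma regular_weight_pos: "regular_weight (x::'a) > 0"
  by (auto simp: regular_weight_def intro!: divide_pos_pos zero_less_power add_pos_nonneg)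

lemma regular_weight_le_1: "regular_weight (x::'a) \<le> 1"
proof -
  have "(1 + norm x) ^ (DIM('a) - 2) \<ge> 1" by (intro one_le_power) simp
  then show ?thesis by (simp add: regular_weight_def divide_le_eq)
qed

lemma slow_weight_regular_weight: "slow_weight (2 ^ (DIM('a) - 2)) (regular_weight :: 'a \<Rightarrow> real)"
  unfolding slow_weight_def
proof (intro conjI allI impI)
  let ?k = "DIM('a) - 2"
  show "(regular_weight :: 'a \<Rightarrow> real) \<in> borel_measurable borel" unfolding regular_weight_def[abs_def] by measurable
  fix x y :: 'a
  show "0 \<le> regular_weight x" using regular_weight_pos[of x] by simp
  have "regular_weight x \<le> 1" by (rule regular_weight_le_1)
  also have "1 \<le> (2::real) ^ ?k" by simp
  finally show "regular_weight x \<le> 2 ^ ?k" .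
  assume "norm (x - y) \<le> 1"
  then have "norm y \<le> 1 + norm x"
    using norm_triangle_ineq2[of y x] by (simp add: norm_minus_commute)
  then have "1 + norm y \<le> 2 * (1 + norm x)"
    using norm_ge_zero[of x] by (simp del: norm_ge_zero)
  then have "(1 + norm y) ^ ?k \<le> (2 * (1 + norm x)) ^ ?k" by (intro power_mono) auto
  then have *: "(1 + norm y) ^ ?k \<le> 2 ^ ?k * (1 + norm x) ^ ?k" by (simp only: power_mult_distrib)
  have pos: "(1 + norm z) ^ ?k > 0" for z :: 'a by (intro zero_less_power add_pos_nonneg) auto
  show "regular_weight x \<le> 2 ^ ?k * regular_weight y"
    using * pos[of x] pos[of y] by (simp add: regular_weight_def divide_simps mult_ac)
qed

lemma regular_weight_decay: "regular_weight (x::'a) * norm x ^ (DIM('a) - 2) \<le> 1"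
proof -
  have "norm x ^ (DIM('a) - 2) \<le> (1 + norm x) ^ (DIM('a) - 2)" by (intro power_mono) auto
  moreover have "(1 + norm x) ^ (DIM('a) - 2) > 0" by (intro zero_less_power add_pos_nonneg) auto
  ultimately show ?thesis by (simp add: regular_weight_def)
qed

lemma sobolev_weights_mu:
  "sobolev_weights (max (2 ^ (DIM('a) - 2)) (max (1 / unit_volume TYPE('a)) ((1 + 2 powr conj_exp TYPE('a)) ^ DIM('a)))) mu_density (regular_weight :: 'a \<Rightarrow> real)"
  by unfold_locales
    (use dim regular_weight_decay in \<open>auto intro: slow_weight_mono[OF slow_weight_mu_density]
      slow_weight_mono[OF slow_weight_regular_weight]\<close>)

text \<open>The norm itself is not differentiable at the origin, but \<open>a > 1\<close> makes
  \<open>norm y powr a\<close> of smaller order than \<open>norm y\<close>. The formula returns the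
  correct value 0 there because \<open>sgn 0 = 0\<close>.\<close>

lemma GDERIV_norm_powr:
  fixes x :: 'a and a :: real
  assumes "a > 1"
  shows "GDERIV (\<lambda>x. norm x powr a) x :> (a * norm x powr (a - 1)) *\<^sub>R sgn x"
proof (cases "x = 0")
  case False
  then show ?thesis
    using GDERIV_DERIV_compose[OF GDERIV_norm[OF False] has_real_derivative_powr[of "norm x" a]] by simp
next
  case True
  have "((\<lambda>x::'a. norm x powr a) has_derivative (\<lambda>h. 0)) (at 0)"
    unfolding has_derivative_at_alt
  proof (intro conjI allI impI)
    fix e :: real assume e: "e > 0"
    show "\<exists>d>0. \<forall>y::'a. norm (y - 0) < d \<longrightarrow> norm (norm y powr a - norm (0::'a) powr a - 0) \<le> e * norm (y - 0)"
    proof (intro exI[of _ "e powr (1 / (a - 1))"] conjI allI impI)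
      fix y :: 'a assume y: "norm (y - 0) < e powr (1 / (a - 1))"
      have "norm y powr (a - 1) \<le> (e powr (1 / (a - 1))) powr (a - 1)"
        using y assms by (intro powr_mono2) auto
      also have "\<dots> = e" using assms e by (simp add: powr_powr)
      finally have "norm y * norm y powr (a - 1) \<le> norm y * e" by (intro mult_left_mono) auto
      moreover have "norm y powr a = norm y * norm y powr (a - 1)"
        using powr_mult_base[of "norm y" "a - 1"] by simp
      ultimately show "norm (norm y powr a - norm (0::'a) powr a - 0) \<le> e * norm (y - 0)"
        by (simp add: mult.commute)
    qed (use e in simp)
  qed simp
  then show ?thesis using True by (simp add: gderiv_def)
qed

lemma grad_weight_eq:
  "grad_weight (x::'a) = (DIM('a) * conj_exp TYPE('a) * norm x powr (conj_exp TYPE('a) - 1) / (1 + norm x powr conj_exp TYPE('a))) ^ (DIM('a) - 2)"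
proof -
  have v: "v_mu y = - ln (unit_volume TYPE('a)) - DIM('a) * ln (1 + norm y powr conj_exp TYPE('a))" for y :: 'a
  proof -
    have "1 + norm y powr conj_exp TYPE('a) > 0" by (intro add_pos_nonneg) auto
    then show ?thesis using unit_volume_pos by (simp add: v_mu_def mu_density_eq ln_div ln_mult ln_realpow)
  qed
  define t where "t = norm x powr conj_exp TYPE('a)"
  have t: "1 + t > 0" unfolding t_def by (intro add_pos_nonneg) auto
  have "((\<lambda>s. - ln (unit_volume TYPE('a)) - DIM('a) * ln (1 + s)) has_real_derivative - (DIM('a) / (1 + t))) (at t)"
    using t by (auto intro!: derivative_eq_intros)
  from GDERIV_DERIV_compose[OF GDERIV_norm_powr[OF conj_exp_bounds(1)] this[unfolded t_def]]
  have "GDERIV v_mu x :> (- (DIM('a) / (1 + t))) *\<^sub>R ((conj_exp TYPE('a) * norm x powr (conj_exp TYPE('a) - 1)) *\<^sub>R sgn x)"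
    by (simp add: v[abs_def] t_def)
  then have "norm (grad v_mu x) = norm ((- (DIM('a) / (1 + t))) *\<^sub>R ((conj_exp TYPE('a) * norm x powr (conj_exp TYPE('a) - 1)) *\<^sub>R sgn x))"
    by (simp only: grad_eqI)
  also have "\<dots> = DIM('a) / (1 + t) * (conj_exp TYPE('a) * norm x powr (conj_exp TYPE('a) - 1) * norm (sgn x))"
    using t conj_exp_bounds by (simp add: abs_mult)
  \<comment> \<open>At the origin both sides vanish: \<open>sgn 0 = 0\<close> on the left, and 0
    raised by \<open>powr\<close> is 0 on the right. Elsewhere \<open>sgn x\<close> has norm
    1.\<close>
  also have "\<dots> = DIM('a) * conj_exp TYPE('a) * norm x powr (conj_exp TYPE('a) - 1) / (1 + t)"
    by (cases "x = 0") (auto simp: norm_sgn)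
  finally show ?thesis by (simp add: grad_weight_def t_def)
qed

lemma grad_weight_borel: "(grad_weight :: 'a \<Rightarrow> real) \<in> borel_measurable borel"
  unfolding grad_weight_eq[abs_def] by measurable

lemma grad_weight_nonneg: "grad_weight (x::'a) \<ge> 0"
  by (simp add: grad_weight_def)

text \<open>With r = \<open>norm x\<close> and c the conjugate exponent, r^(c - 1) / (1 + r^c) is at
  most 2 / (1 + r); with \<open>c \<le> 2\<close> this bounds the gradient of \<open>v_mu\<close> by
  4 N / (1 + r). Smallness with respect to \<open>regular_weight\<close> thereby carries over to
  \<open>grad_weight\<close>.\<close>

lemma grad_weight_le: "grad_weight (x::'a) \<le> real (4 * DIM('a)) ^ (DIM('a) - 2) * regular_weight x"
proof -
  let ?r = "norm x"
  have pos: "1 + ?r powr conj_exp TYPE('a) > 0" "1 + ?r > 0" by (auto intro!: add_pos_nonneg)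
  have "(1 + ?r) * ?r powr (conj_exp TYPE('a) - 1) \<le> 2 * (1 + ?r powr conj_exp TYPE('a))"
  proof (cases "?r \<le> 1")
    case True
    have "?r powr (conj_exp TYPE('a) - 1) \<le> 1" using True conj_exp_bounds by (simp add: powr_le1)
    then have "(1 + ?r) * ?r powr (conj_exp TYPE('a) - 1) \<le> 2 * 1" using True by (intro mult_mono) auto
    also have "\<dots> \<le> 2 * (1 + ?r powr conj_exp TYPE('a))" by simp
    finally show ?thesis .
  next
    case False
    have "(1 + ?r) * ?r powr (conj_exp TYPE('a) - 1) \<le> (2 * ?r) * ?r powr (conj_exp TYPE('a) - 1)"
      using False by (intro mult_right_mono) auto
    also have "\<dots> = 2 * ?r powr conj_exp TYPE('a)" using powr_mult_base[of ?r "conj_exp TYPE('a) - 1"] by simp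
    finally show ?thesis by simp
  qed
  then have "?r powr (conj_exp TYPE('a) - 1) / (1 + ?r powr conj_exp TYPE('a)) \<le> 2 / (1 + ?r)"
    using pos by (simp add: divide_simps mult_ac)
  then have "(DIM('a) * conj_exp TYPE('a)) * (?r powr (conj_exp TYPE('a) - 1) / (1 + ?r powr conj_exp TYPE('a))) \<le> (DIM('a) * 2) * (2 / (1 + ?r))"
    using conj_exp_bounds pos by (intro mult_mono) auto
  then have "DIM('a) * conj_exp TYPE('a) * ?r powr (conj_exp TYPE('a) - 1) / (1 + ?r powr conj_exp TYPE('a)) \<le> 4 * DIM('a) / (1 + ?r)" by (simp add: mult_ac)
  then have "grad_weight x \<le> (4 * DIM('a) / (1 + ?r)) ^ (DIM('a) - 2)"
    unfolding grad_weight_eq using conj_exp_bounds by (intro power_mono) auto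
  then show ?thesis by (simp add: regular_weight_def power_divide)
qed

text \<open>Away from the origin 1 + r^c is at most 2 r^c, and N c is at least 2. At the origin the
  inequality fails for N > 2, where \<open>grad_weight\<close> is 0.\<close>

lemma regular_weight_le: "norm (x::'a) \<ge> 1 \<Longrightarrow> regular_weight x \<le> grad_weight x"
proof -
  let ?r = "norm x"
  assume r: "?r \<ge> 1"
  have "1 + ?r powr conj_exp TYPE('a) \<le> 2 * ?r powr conj_exp TYPE('a)" using r conj_exp_bounds by (simp add: ge_one_powr_ge_zero)
  also have "\<dots> = 2 * (?r * ?r powr (conj_exp TYPE('a) - 1))" using powr_mult_base[of ?r "conj_exp TYPE('a) - 1"] by simp
  also have "\<dots> \<le> (DIM('a) * conj_exp TYPE('a)) * ((1 + ?r) * ?r powr (conj_exp TYPE('a) - 1))"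
  proof -
    have "2 * 1 \<le> real DIM('a) * conj_exp TYPE('a)" using dim conj_exp_bounds by (intro mult_mono) auto
    then show ?thesis by (intro mult_mono mult_right_mono) auto
  qed
  finally have "1 / (1 + ?r) \<le> DIM('a) * conj_exp TYPE('a) * ?r powr (conj_exp TYPE('a) - 1) / (1 + ?r powr conj_exp TYPE('a))"
    using r by (simp add: divide_simps mult_ac add_pos_nonneg)
  then have "(1 / (1 + ?r)) ^ (DIM('a) - 2) \<le> grad_weight x"
    unfolding grad_weight_eq by (intro power_mono) auto
  then show ?thesis by (simp add: regular_weight_def power_divide)
qed

text \<open>Inside the unit ball the square is at most 1 plus the N-th power, because
  \<open>DIM('a) \<ge> 2\<close>, and the ball has finite measure; outside,
  \<open>regular_weight_le\<close> applies.\<close>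

lemma energy_regular_weight_finite:
  fixes g :: "'a \<Rightarrow> 'a"
  assumes [measurable]: "g \<in> borel_measurable borel"
    and "energy DIM('a) (\<lambda>_. 1) g < \<infinity>" "energy 2 grad_weight g < \<infinity>"
  shows "energy 2 regular_weight g < \<infinity>"
proof -
  note [measurable] = grad_weight_borel
  have [measurable]: "cball 0 1 \<in> sets (borel :: 'a measure)" by simp
  have "energy 2 regular_weight g
     \<le> (\<integral>\<^sup>+x. ennreal (norm (g x) ^ 2 * grad_weight x) + (indicator (cball 0 1) x + ennreal (norm (g x) ^ DIM('a) * 1)) \<partial>lborel)"
    unfolding energy_def
  proof (rule nn_integral_mono)
    fix x
    show "ennreal (norm (g x) ^ 2 * regular_weight x)
       \<le> ennreal (norm (g x) ^ 2 * grad_weight x) + (indicator (cball 0 1) x + ennreal (norm (g x) ^ DIM('a) * 1))"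
    proof (cases "norm x \<ge> 1")
      case True
      then have "ennreal (norm (g x) ^ 2 * regular_weight x) \<le> ennreal (norm (g x) ^ 2 * grad_weight x)"
        by (intro ennreal_leI mult_left_mono regular_weight_le) auto
      then show ?thesis by (rule order_trans) simp
    next
      case False
      have "norm (g x) ^ 2 \<le> 1 + norm (g x) ^ DIM('a)"
      proof (cases "norm (g x) \<le> 1")
        case True
        then have "norm (g x) ^ 2 \<le> 1" by (simp add: power_le_one)
        then show ?thesis by (simp add: add_increasing2)
      next
        case False
        then have "norm (g x) ^ 2 \<le> norm (g x) ^ DIM('a)" using dim by (intro power_increasing) auto
        then show ?thesis by simp
      qed
      moreover have "regular_weight x \<le> 1" by (rule regular_weight_le_1)
      ultimately have "norm (g x) ^ 2 * regular_weight x \<le> (1 + norm (g x) ^ DIM('a)) * 1"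
        using regular_weight_pos[of x] by (intro mult_mono) auto
      then have "ennreal (norm (g x) ^ 2 * regular_weight x) \<le> ennreal (1 + norm (g x) ^ DIM('a))"
        by (intro ennreal_leI) simp
      also have "\<dots> = indicator (cball 0 1) x + ennreal (norm (g x) ^ DIM('a) * 1)"
        using False by (simp add: ennreal_plus)
      finally show ?thesis by (rule order_trans) simp
    qed
  qed
  also have "\<dots> = energy 2 grad_weight g + (emeasure lborel (cball (0::'a) 1) + energy DIM('a) (\<lambda>_. 1) g)"
    by (simp add: energy_def nn_integral_add)
  also have "\<dots> < \<infinity>" using assms emeasure_lborel_cball_finite[of "0::'a" 1] by simp
  finally show ?thesis .
qed

section \<open>The space and its norm in terms of energies\<close>

lemma mu_measure_energy:
  fixes u u' :: "'a \<Rightarrow> real"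
  assumes [measurable]: "u' \<in> borel_measurable borel" and ae: "AE x in lborel. u x = u' x"
  shows "integrable mu_measure u \<longleftrightarrow> energy 1 mu_density u' < \<infinity>"
    and "(\<integral>x. \<bar>u x\<bar> \<partial>mu_measure) = enn2real (energy 1 mu_density u')"
proof -
  have ul: "u \<in> borel_measurable lebesgue" by (rule borel_measurable_lebesgue_AE[OF assms])
  have ml: "(mu_density :: 'a \<Rightarrow> real) \<in> borel_measurable lebesgue"
    using mu_density_borel by (intro measurable_completion) simp
  have "integrable mu_measure u \<longleftrightarrow> integrable mu_measure (\<lambda>x. \<bar>u x\<bar>)"
    using ul by (subst integrable_norm_iff[symmetric]) (auto simp: mu_measure_def)
  also have "\<dots> \<longleftrightarrow> integrable lebesgue (\<lambda>x. norm (u x) ^ 1 * mu_density x)"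
    unfolding mu_measure_def using ul ml mu_density_nonneg
    by (subst integrable_density) (auto simp: mult.commute)
  also have "\<dots> \<longleftrightarrow> energy 1 mu_density u' < \<infinity>"
    by (rule energy_lebesgue(1)) (use assms mu_density_borel mu_density_nonneg in auto)
  finally show "integrable mu_measure u \<longleftrightarrow> energy 1 mu_density u' < \<infinity>" .
  have "(\<integral>x. \<bar>u x\<bar> \<partial>mu_measure) = (\<integral>x. norm (u x) ^ 1 * mu_density x \<partial>lebesgue)"
    unfolding mu_measure_def using ul ml mu_density_nonneg
    by (subst integral_density) (auto simp: mult.commute)
  also have "\<dots> = enn2real (energy 1 mu_density u')"
    by (rule energy_lebesgue(2)) (use assms mu_density_borel mu_density_nonneg in auto)
  finally show "(\<integral>x. \<bar>u x\<bar> \<partial>mu_measure) = enn2real (energy 1 mu_density u')" .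
qed

text \<open>Replaces the chosen \<open>weak_grad u\<close> by any Borel pair (u', g'), which brings
  membership and norm into the form in which the approximation was proved.\<close>

lemma W_mu_iff:
  fixes u u' :: "'a \<Rightarrow> real"
  assumes u: "AE x in lborel. u x = u' x" and ug: "weak_gradient u' g'"
  shows "u \<in> W_mu \<longleftrightarrow> energy 1 mu_density u' < \<infinity> \<and> energy DIM('a) (\<lambda>_. 1) g' < \<infinity>
      \<and> energy 2 grad_weight g' < \<infinity>"
    and "mu_norm u = enn2real (energy 1 mu_density u') + root DIM('a) (enn2real (energy DIM('a) (\<lambda>_. 1) g'))
      + sqrt (enn2real (energy 2 grad_weight g'))"
proof -
  have u': "u' \<in> borel_measurable borel" and g': "g' \<in> borel_measurable borel"
    using ug by (auto simp: weak_gradient_def loc_int_borel)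
  have ae: "AE x in lborel. weak_grad u x = g' x" by (rule weak_grad_AE_eq[OF u' u ug])
  have ex: "has_weak_gradient u g'" using has_weak_gradient_iff[OF u' u g', of g'] ug by simp
  note m = mu_measure_energy[OF u' u]
  note e1 = energy_lebesgue[OF g' borel_measurable_const ae zero_le_one, of "DIM('a)", simplified]
  note e2 = energy_lebesgue[OF g' grad_weight_borel ae grad_weight_nonneg, of 2]
  show "u \<in> W_mu \<longleftrightarrow> energy 1 mu_density u' < \<infinity> \<and> energy DIM('a) (\<lambda>_. 1) g' < \<infinity>
      \<and> energy 2 grad_weight g' < \<infinity>"
    using ex by (auto simp: W_mu_def m e1 e2)
  show "mu_norm u = enn2real (energy 1 mu_density u') + root DIM('a) (enn2real (energy DIM('a) (\<lambda>_. 1) g'))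
      + sqrt (enn2real (energy 2 grad_weight g'))"
    by (simp add: mu_norm_def m e1 e2)
qed

lemma C0_infinity_subset_W_mu: "(C0_infinity :: ('a \<Rightarrow> real) set) \<subseteq> W_mu"
proof
  fix \<phi> :: "'a \<Rightarrow> real" assume \<phi>: "\<phi> \<in> C0_infinity"
  note s = C0_infinity_smooth[OF \<phi>]
  obtain R where R: "R > 0" "\<And>x. norm x \<ge> R \<Longrightarrow> \<phi> x = 0" "\<And>x. norm x \<ge> R \<Longrightarrow> grad \<phi> x = 0"
    using C0_infinity_support[OF \<phi>] by blast
  note slow = slow_weight_mu_density[unfolded slow_weight_def] slow_weight_regular_weight[unfolded slow_weight_def]
  have "energy 1 mu_density \<phi> < \<infinity>"
    by (rule energy_finite[OF smooth_continuous[OF s] R(2)]) (use slow in auto)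
  moreover have "energy DIM('a) (\<lambda>_. 1) (grad \<phi>) < \<infinity>"
    by (rule energy_finite[OF smooth_continuous_grad[OF s] R(3), where C = 1]) (use dim in auto)
  moreover have "energy 2 grad_weight (grad \<phi>) < \<infinity>"
  proof (rule energy_finite[OF smooth_continuous_grad[OF s] R(3)])
    fix x :: 'a
    have "regular_weight x \<le> 2 ^ (DIM('a) - 2)" using slow by blast
    then have "real (4 * DIM('a)) ^ (DIM('a) - 2) * regular_weight x \<le> real (4 * DIM('a)) ^ (DIM('a) - 2) * 2 ^ (DIM('a) - 2)"
      by (intro mult_left_mono) auto
    then show "grad_weight x \<le> real (4 * DIM('a)) ^ (DIM('a) - 2) * 2 ^ (DIM('a) - 2)"
      using grad_weight_le[of x] by linarith
  qed (use grad_weight_nonneg in auto)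
  ultimately show "\<phi> \<in> W_mu"
    using W_mu_iff(1)[OF _ weak_gradient_smooth[OF s], of \<phi>] by simp
qed

lemma enn2real_le: "x \<le> ennreal d \<Longrightarrow> 0 \<le> d \<Longrightarrow> enn2real x \<le> d"
  using enn2real_mono[of x "ennreal d"] by simp

lemma W_mu_subset_closure: "(W_mu :: ('a \<Rightarrow> real) set) \<subseteq> W_mu_closure C0_infinity"
proof
  fix u :: "'a \<Rightarrow> real" assume u: "u \<in> W_mu"
  then obtain g where "has_weak_gradient u g" by (auto simp: W_mu_def)
  then obtain u' g' where ug: "u' \<in> borel_measurable borel" "AE x in lborel. u x = u' x"
    "g' \<in> borel_measurable borel" "weak_gradient u' g'"
    by (rule has_weak_gradient_borel)
  have fin: "energy 1 mu_density u' < \<infinity>" "energy DIM('a) (\<lambda>_. 1) g' < \<infinity>" "energy 2 grad_weight g' < \<infinity>"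
    using W_mu_iff(1)[OF ug(2,4)] u by auto
  interpret sobolev_weights "max (2 ^ (DIM('a) - 2)) (max (1 / unit_volume TYPE('a)) ((1 + 2 powr conj_exp TYPE('a)) ^ DIM('a)))" mu_density "regular_weight :: 'a \<Rightarrow> real"
    by (rule sobolev_weights_mu)
  have ap: "approximable mu_density regular_weight u' g'"
    by (rule approximable_weak[OF ug(4) fin(1,2) energy_regular_weight_finite[OF ug(3) fin(2,3)]])
  \<comment> \<open>The factor of \<open>grad_weight_le\<close>, which converts energies with the
    substitute weight into energies with the original one.\<close>
  define K where "K = real (4 * DIM('a)) ^ (DIM('a) - 2)"
  have K: "K > 0" by (simp add: K_def)
  have "\<exists>\<phi>\<in>C0_infinity. mu_norm (\<lambda>x. u x - \<phi> x) < e" if e: "e > 0" for e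
  proof -
    \<comment> \<open>The three entries make the mean, the N-th root and the square root at most e /
      4 each; the total 3 e / 4 leaves the inequality strict.\<close>
    define d where "d = min (e / 4) (min ((e / 4) ^ DIM('a)) ((e / 4)\<^sup>2 / K))"
    have "d > 0" using e K by (simp add: d_def)
    moreover have "d \<le> e / 4" "d \<le> (e / 4) ^ DIM('a)" "d \<le> (e / 4)\<^sup>2 / K"
      unfolding d_def by linarith+
    ultimately have d: "d > 0" "d \<le> e / 4" "d \<le> (e / 4) ^ DIM('a)" "d \<le> (e / 4)\<^sup>2 / K" .
    obtain \<phi> where \<phi>: "\<phi> \<in> C0_infinity"
      and D: "sobolev_dist mu_density regular_weight u' g' \<phi> (grad \<phi>) \<le> ennreal d"
      using ap d(1) unfolding approximable_def by blast
    note s = C0_infinity_smooth[OF \<phi>]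
    have e1: "energy 1 mu_density (\<lambda>x. u' x - \<phi> x) \<le> ennreal d"
      and e2: "energy DIM('a) (\<lambda>_. 1) (\<lambda>x. g' x - grad \<phi> x) \<le> ennreal d"
      and e3: "energy 2 regular_weight (\<lambda>x. g' x - grad \<phi> x) \<le> ennreal d"
      using D unfolding sobolev_dist_def
      by (auto elim: order_trans[rotated] intro: add_increasing add_increasing2)
    note [measurable] = ug(3) smooth_borel[OF s] weights(2)
    have "energy 2 grad_weight (\<lambda>x. g' x - grad \<phi> x)
       \<le> (\<integral>\<^sup>+x. ennreal K * ennreal (norm (g' x - grad \<phi> x) ^ 2 * regular_weight x) \<partial>lborel)"
      unfolding energy_def
    proof (rule nn_integral_mono)
      fix x
      have "norm (g' x - grad \<phi> x) ^ 2 * grad_weight x \<le> norm (g' x - grad \<phi> x) ^ 2 * (K * regular_weight x)"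
        using grad_weight_le[of x] by (intro mult_left_mono) (auto simp: K_def)
      then show "ennreal (norm (g' x - grad \<phi> x) ^ 2 * grad_weight x)
          \<le> ennreal K * ennreal (norm (g' x - grad \<phi> x) ^ 2 * regular_weight x)"
        using K by (subst ennreal_mult'[symmetric]) (auto intro: ennreal_leI simp: mult_ac)
    qed
    also have "\<dots> = ennreal K * energy 2 regular_weight (\<lambda>x. g' x - grad \<phi> x)"
      unfolding energy_def by (rule nn_integral_cmult) measurable
    also have "\<dots> \<le> ennreal K * ennreal d" by (intro mult_left_mono e3) simp
    also have "\<dots> = ennreal (K * d)" using K d by (simp add: ennreal_mult)
    finally have e3': "energy 2 grad_weight (\<lambda>x. g' x - grad \<phi> x) \<le> ennreal (K * d)" .
    have "AE x in lborel. u x - \<phi> x = u' x - \<phi> x" using ug(2) by eventually_elim simp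
    from W_mu_iff(2)[OF this weak_gradient_diff[OF ug(4) weak_gradient_smooth[OF s]]]
    have "mu_norm (\<lambda>x. u x - \<phi> x) = enn2real (energy 1 mu_density (\<lambda>x. u' x - \<phi> x))
       + root DIM('a) (enn2real (energy DIM('a) (\<lambda>_. 1) (\<lambda>x. g' x - grad \<phi> x)))
       + sqrt (enn2real (energy 2 grad_weight (\<lambda>x. g' x - grad \<phi> x)))" .
    also have "\<dots> \<le> e / 4 + e / 4 + e / 4"
    proof (intro add_mono)
      show "enn2real (energy 1 mu_density (\<lambda>x. u' x - \<phi> x)) \<le> e / 4"
        using enn2real_le[OF e1] d by simp
      have "root DIM('a) (enn2real (energy DIM('a) (\<lambda>_. 1) (\<lambda>x. g' x - grad \<phi> x))) \<le> root DIM('a) ((e / 4) ^ DIM('a))"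
        using enn2real_le[OF e2] d by simp
      also have "\<dots> = e / 4" using e by (simp add: real_root_power_cancel)
      finally show "root DIM('a) (enn2real (energy DIM('a) (\<lambda>_. 1) (\<lambda>x. g' x - grad \<phi> x))) \<le> e / 4" .
      have "K * d \<le> (e / 4)\<^sup>2" using d(4) K by (simp add: field_simps)
      then have "sqrt (enn2real (energy 2 grad_weight (\<lambda>x. g' x - grad \<phi> x))) \<le> sqrt ((e / 4)\<^sup>2)"
        using enn2real_le[OF e3'] K d(1) by (intro real_sqrt_le_mono) simp
      then show "sqrt (enn2real (energy 2 grad_weight (\<lambda>x. g' x - grad \<phi> x))) \<le> e / 4" using e by simp
    qed
    also have "\<dots> < e" using e by simp
    finally show ?thesis using \<phi> by blast
  qed
  then show "u \<in> W_mu_closure C0_infinity" using u by (simp add: W_mu_closure_def)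
qed

end

text \<open>\<open>W_mu_closure\<close> accepts any set of functions; the first conjunct certifies
  that the closure is taken of a subset of the space. One inclusion of the equality is built into
  \<open>W_mu_closure\<close>, the other is the approximation result.\<close>

theorem theorem1p1:
  assumes "CARD('n::finite) \<ge> 2"
  shows "(C0_infinity :: (real ^ 'n \<Rightarrow> real) set) \<subseteq> W_mu
    \<and> (W_mu :: (real ^ 'n \<Rightarrow> real) set) = W_mu_closure C0_infinity"
proof -
  have dim: "DIM(real ^ 'n) \<ge> 2" using assms by simp
  have "(W_mu_closure C0_infinity :: (real ^ 'n \<Rightarrow> real) set) \<subseteq> W_mu"
    by (auto simp: W_mu_closure_def)
  with C0_infinity_subset_W_mu[OF dim] W_mu_subset_closure[OF dim] show ?thesis by blast
qed

end
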